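(* Let $\mathcal{E}$ be a category with a strict initial object $\mathbf{0}$, provided with a pretorsion theory $(\mathcal{T},\mathcal{F})$ and a coherent system of (distinguished) subobjects which are compatible. Let $\sigma\colon\mathcal{E}\to\mathsf{Stab}(\mathcal{E})$ be the associated stable category, whose objects are those of $\mathcal{E}$. Choosing in $\mathsf{Stab}(\mathcal{E})$ as torsion objects and torsion free objects the same objects as in $\mathcal{E}$, one gets a torsion theory on $\mathsf{Stab}(\mathcal{E})$, and this turns $\sigma\colon\mathcal{E}\to\mathsf{Stab}(\mathcal{E})$ into a torsion functor.
   Context: Subobjects and monomorphisms representing them are not distinguished; unions are suprema of subobjects. **Coherent system of subobjects** on a category with strict initial object $\mathbf{0}$: for each object a class of "distinguished" subobjects (represented by "distinguished monomorphisms") such that: (CS1) $\mathbf{0}$ and $A$ are distinguished in $A$; (CS2) the union of two distinguished subobjects exists and is distinguished; (CS3) the pullback of a distinguished subobject along any morphism exists and is distinguished; (CS4) pulling back distinguished subobjects preserves their unions; (CS5) if $A$ is distinguished in $B$ and $B$ is distinguished in $C$, then $A$ is distinguished in $C$. A **distinguished epimorphism** $A\to B$ is an epimorphism not factoring through any proper distinguished subobject of $B$. **Pretorsion theory** on a category: a pair $(\mathcal{T},\mathcal{F})$ of isomorphism-closed classes of objects (torsion, torsion free objects). Objects in $\mathcal{T}\cap\mathcal{F}$ are trivial; $\mathcal{Z}$ is the ideal of trivial morphisms, i.e. those factoring through a trivial object. A $\mathcal{Z}$-kernel of $f$ is an arrow $k$ with $fk\in\mathcal{Z}$ such that every $m$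 with $fm\in\mathcal{Z}$ factors uniquely through $k$; $\mathcal{Z}$-cokernels are dual. $K\xrightarrow{k}A\xrightarrow{q}Q$ is short $\mathcal{Z}$-exact when $k$ is a $\mathcal{Z}$-kernel of $q$ and $q$ is a $\mathcal{Z}$-cokernel of $k$. Axioms: (PT1) every arrow from a torsion object to a torsion free object is trivial; (PT2) each object $A$ has a (canonical) short $\mathcal{Z}$-exact sequence $\tau(A)\xrightarrow{\varepsilon_A}A\xrightarrow{\eta_A}\phi(A)$ with $\tau(A)\in\mathcal{T}$, $\phi(A)\in\mathcal{F}$. These sequences are unique up to isomorphism and make $\tau,\phi$ functors (coreflection onto torsion objects, reflection onto torsion free objects). It is a **torsion theory** when all trivial objects are zero objects. A **torsion functor** is a functor between categories with pretorsion theories that preserves torsion objects, torsion free objects and the canonical $\mathcal{Z}$-exact sequences of (PT2). **Compatibility**: (CC1) trivial objects are closed under distinguished subobjects; (CC2) if $S,T$ are distinguished subobjects of $A$, a morphism $f\colon S\cup T\to B$ is trivial as soon as its restrictions to $S$ and $T$ are trivial; (CC3) $\phi$ preserves distinguished subobjects; (CC4) the pullback $v\colon P\to S$ of $\eta_A\colon A\to\phi(A)$ along a distinguished monomorphism $s\colon S\to\phi(A)$ is a distinguished epimorphism; (CC5) a distinguished monomorphism $s$ with $\phi(s)$ an isomorphism is an isomorphism. **Stable category.** $\mathsf{DisPar}(\mathcal{E})$ has the objects of $\mathcal{E}$; a morphism $A\to B$ is a triple $(S_0,S_1,f)$ with $S_0,S_1$ distinguished subobjects of $A$, $S_0\cup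 S_1=A$, $f\colon S_1\to B$ in $\mathcal{E}$, and $f$ restricted to $S_0\cap S_1$ trivial. Composition: $(T_0,T_1,g)\circ(S_0,S_1,f)=(S_0\cup f^{-1}(T_0),\,f^{-1}(T_1),\,gf')$ where $f'\colon f^{-1}(T_1)\to T_1$ is the restriction of $f$. Two parallel morphisms $(S_0,S_1,f),(T_0,T_1,g)\colon A\to B$ are equivalent when there are distinguished subobjects $U_0,U_1$ of $A$ with $U_0\cup U_1=A$, $U_1\subseteq S_1$, $U_1\subseteq T_1$, $f$ and $g$ equal on $U_1$, $f$ trivial on $U_0\cap S_1$ and $g$ trivial on $U_0\cap T_1$. This is a congruence, and $\mathsf{Stab}(\mathcal{E})$ is the quotient of $\mathsf{DisPar}(\mathcal{E})$ by it. The functor $\sigma\colon\mathcal{E}\to\mathsf{Stab}(\mathcal{E})$ is the identity on objects and sends $f\colon A\to B$ to the class of $(\mathbf{0},A,f)$. *)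

theory Defs
  imports Main
begin

section \<open>Categories\<close>

record ('o, 'a) cat =
  Obj :: "'o set"
  Arr :: "'a set"
  Dom :: "'a \<Rightarrow> 'o"
  Cod :: "'a \<Rightarrow> 'o"
  Id  :: "'o \<Rightarrow> 'a"
  Comp :: "'a \<Rightarrow> 'a \<Rightarrow> 'a"  (infixr "\<cdot>\<index>" 70)

definition hom :: "('o, 'a, 'm) cat_scheme \<Rightarrow> 'o \<Rightarrow> 'o \<Rightarrow> 'a set" where
  "hom C A B = {f \<in> Arr C. Dom C f = A \<and> Cod C f = B}"

locale category =
  fixes C :: "('o, 'a, 'm) cat_scheme" (structure)
  assumes Dom_in_Obj: "f \<in> Arr C \<Longrightarrow> Dom C f \<in> Obj C"
    and Cod_in_Obj: "f \<in> Arr C \<Longrightarrow> Cod C f \<in> Obj C"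
    and Id_in_hom: "A \<in> Obj C \<Longrightarrow> Id C A \<in> hom C A A"
    and Comp_in_hom: "\<lbrakk>f \<in> hom C A B; g \<in> hom C B D\<rbrakk> \<Longrightarrow> g \<cdot> f \<in> hom C A D"
    and Comp_Id: "f \<in> hom C A B \<Longrightarrow> f \<cdot> Id C A = f"
    and Id_Comp: "f \<in> hom C A B \<Longrightarrow> Id C B \<cdot> f = f"
    and Comp_assoc: "\<lbrakk>f \<in> hom C A B; g \<in> hom C B D; h \<in> hom C D E\<rbrakk>
          \<Longrightarrow> (h \<cdot> g) \<cdot> f = h \<cdot> (g \<cdot> f)"

definition mono_arr :: "('o, 'a, 'm) cat_scheme \<Rightarrow> 'a \<Rightarrow> bool" where
  "mono_arr C s \<longleftrightarrow> s \<in> Arr C \<and>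
     (\<forall>X. \<forall>g \<in> hom C X (Dom C s). \<forall>h \<in> hom C X (Dom C s).
        s \<cdot>\<^bsub>C\<^esub> g = s \<cdot>\<^bsub>C\<^esub> h \<longrightarrow> g = h)"

definition epi_arr :: "('o, 'a, 'm) cat_scheme \<Rightarrow> 'a \<Rightarrow> bool" where
  "epi_arr C e \<longleftrightarrow> e \<in> Arr C \<and>
     (\<forall>Y. \<forall>g \<in> hom C (Cod C e) Y. \<forall>h \<in> hom C (Cod C e) Y.
        g \<cdot>\<^bsub>C\<^esub> e = h \<cdot>\<^bsub>C\<^esub> e \<longrightarrow> g = h)"

definition iso_arr :: "('o, 'a, 'm) cat_scheme \<Rightarrow> 'a \<Rightarrow> bool" where
  "iso_arr C f \<longleftrightarrow> f \<in> Arr C \<and>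
     (\<exists>g \<in> hom C (Cod C f) (Dom C f).
        g \<cdot>\<^bsub>C\<^esub> f = Id C (Dom C f) \<and> f \<cdot>\<^bsub>C\<^esub> g = Id C (Cod C f))"

definition isomorphic_objs :: "('o, 'a, 'm) cat_scheme \<Rightarrow> 'o \<Rightarrow> 'o \<Rightarrow> bool" where
  "isomorphic_objs C A B \<longleftrightarrow> (\<exists>f \<in> hom C A B. iso_arr C f)"

definition initial_obj :: "('o, 'a, 'm) cat_scheme \<Rightarrow> 'o \<Rightarrow> bool" where
  "initial_obj C Z \<longleftrightarrow> Z \<in> Obj C \<and> (\<forall>A \<in> Obj C. \<exists>!f. f \<in> hom C Z A)"

definition terminal_obj :: "('o, 'a, 'm) cat_scheme \<Rightarrow> 'o \<Rightarrow> bool" where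
  "terminal_obj C Z \<longleftrightarrow> Z \<in> Obj C \<and> (\<forall>A \<in> Obj C. \<exists>!f. f \<in> hom C A Z)"

definition zero_obj :: "('o, 'a, 'm) cat_scheme \<Rightarrow> 'o \<Rightarrow> bool" where
  "zero_obj C Z \<longleftrightarrow> initial_obj C Z \<and> terminal_obj C Z"

definition strict_initial_obj :: "('o, 'a, 'm) cat_scheme \<Rightarrow> 'o \<Rightarrow> bool" where
  "strict_initial_obj C Z \<longleftrightarrow> initial_obj C Z \<and>
     (\<forall>f \<in> Arr C. Cod C f = Z \<longrightarrow> iso_arr C f)"

definition initial_arr :: "('o, 'a, 'm) cat_scheme \<Rightarrow> 'o \<Rightarrow> 'o \<Rightarrow> 'a" where
  "initial_arr C Z A = (THE f. f \<in> hom C Z A)"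

text \<open>The square \<open>f \<cdot> p = g \<cdot> q\<close> is a pullback; \<open>p\<close> is the pullback of \<open>g\<close> along \<open>f\<close>, and
  \<open>q\<close> the pullback of \<open>f\<close> along \<open>g\<close>.\<close>

definition is_pullback ::
    "('o, 'a, 'm) cat_scheme \<Rightarrow> 'a \<Rightarrow> 'a \<Rightarrow> 'a \<Rightarrow> 'a \<Rightarrow> bool" where
  "is_pullback C f g p q \<longleftrightarrow>
     f \<in> Arr C \<and> g \<in> Arr C \<and> p \<in> Arr C \<and> q \<in> Arr C \<and>
     Cod C f = Cod C g \<and> Dom C p = Dom C q \<and> Cod C p = Dom C f \<and> Cod C q = Dom C g \<and>
     f \<cdot>\<^bsub>C\<^esub> p = g \<cdot>\<^bsub>C\<^esub> q \<and>
     (\<forall>X. \<forall>x \<in> hom C X (Dom C f). \<forall>y \<in> hom C X (Dom C g).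
        f \<cdot>\<^bsub>C\<^esub> x = g \<cdot>\<^bsub>C\<^esub> y \<longrightarrow>
        (\<exists>!h. h \<in> hom C X (Dom C p) \<and> p \<cdot>\<^bsub>C\<^esub> h = x \<and> q \<cdot>\<^bsub>C\<^esub> h = y))"

locale cat_functor =
  source: category C + target: category C'
  for C :: "('o, 'a, 'm) cat_scheme" and C' :: "('p, 'b, 'n) cat_scheme" +
  fixes Fo :: "'o \<Rightarrow> 'p" and Fa :: "'a \<Rightarrow> 'b"
  assumes functor_obj: "A \<in> Obj C \<Longrightarrow> Fo A \<in> Obj C'"
    and functor_hom: "f \<in> hom C A B \<Longrightarrow> Fa f \<in> hom C' (Fo A) (Fo B)"
    and functor_Id: "A \<in> Obj C \<Longrightarrow> Fa (Id C A) = Id C' (Fo A)"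
    and functor_Comp: "\<lbrakk>f \<in> hom C A B; g \<in> hom C B D\<rbrakk>
          \<Longrightarrow> Fa (g \<cdot>\<^bsub>C\<^esub> f) = Fa g \<cdot>\<^bsub>C'\<^esub> Fa f"


section \<open>Subobjects and coherent systems\<close>

text \<open>Subobjects are handled through representing monomorphisms. Accordingly intersections,
  inverse images and unions appear as predicates that hold for every representative, and a class
  of subobjects is a class of monomorphisms closed under isomorphism of representatives.\<close>

definition sub_le :: "('o, 'a, 'm) cat_scheme \<Rightarrow> 'a \<Rightarrow> 'a \<Rightarrow> bool" where
  "sub_le C s t \<longleftrightarrow> Cod C s = Cod C t \<and>
     (\<exists>h \<in> hom C (Dom C s) (Dom C t). t \<cdot>\<^bsub>C\<^esub> h = s)"

definition is_union :: "('o, 'a, 'm) cat_scheme \<Rightarrow> 'a \<Rightarrow> 'a \<Rightarrow> 'a \<Rightarrow> bool" where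
  "is_union C s t u \<longleftrightarrow> mono_arr C u \<and> sub_le C s u \<and> sub_le C t u \<and>
     (\<forall>w. mono_arr C w \<and> sub_le C s w \<and> sub_le C t w \<longrightarrow> sub_le C u w)"

locale coherent_system = category C
  for C :: "('o, 'a, 'm) cat_scheme" (structure) +
  fixes zero :: 'o and \<D> :: "'a set"
  assumes strict_initial: "strict_initial_obj C zero"
    and dist_mono: "s \<in> \<D> \<Longrightarrow> mono_arr C s"
    and dist_representative:
      "\<lbrakk>s \<in> \<D>; iso_arr C i; Cod C i = Dom C s\<rbrakk> \<Longrightarrow> s \<cdot> i \<in> \<D>"
    and CS1_zero: "A \<in> Obj C \<Longrightarrow> initial_arr C zero A \<in> \<D>"
    and CS1_whole: "A \<in> Obj C \<Longrightarrow> Id C A \<in> \<D>"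
    and CS2: "\<lbrakk>s \<in> \<D>; t \<in> \<D>; Cod C s = Cod C t\<rbrakk> \<Longrightarrow> \<exists>u \<in> \<D>. is_union C s t u"
    and CS3: "\<lbrakk>s \<in> \<D>; f \<in> Arr C; Cod C f = Cod C s\<rbrakk>
          \<Longrightarrow> \<exists>p q. is_pullback C f s p q \<and> p \<in> \<D>"
    and CS4: "\<lbrakk>s \<in> \<D>; t \<in> \<D>; is_union C s t u;
          is_pullback C f s ps qs; is_pullback C f t pt qt; is_pullback C f u pu qu\<rbrakk>
          \<Longrightarrow> is_union C ps pt pu"
    and CS5: "\<lbrakk>s \<in> \<D>; t \<in> \<D>; Cod C s = Dom C t\<rbrakk> \<Longrightarrow> t \<cdot> s \<in> \<D>"

definition dist_epi :: "('o, 'a, 'm) cat_scheme \<Rightarrow> 'a set \<Rightarrow> 'a \<Rightarrow> bool" where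
  "dist_epi C \<D> e \<longleftrightarrow> epi_arr C e \<and>
     \<not> (\<exists>s \<in> \<D>. Cod C s = Cod C e \<and> \<not> iso_arr C s \<and>
          (\<exists>g \<in> hom C (Dom C e) (Dom C s). s \<cdot>\<^bsub>C\<^esub> g = e))"


section \<open>Pretorsion theories\<close>

definition trivial_arr :: "('o, 'a, 'm) cat_scheme \<Rightarrow> 'o set \<Rightarrow> 'o set \<Rightarrow> 'a \<Rightarrow> bool" where
  "trivial_arr C \<T> \<F> f \<longleftrightarrow> f \<in> Arr C \<and>
     (\<exists>Z \<in> \<T> \<inter> \<F>. \<exists>g \<in> hom C (Dom C f) Z. \<exists>h \<in> hom C Z (Cod C f). f = h \<cdot>\<^bsub>C\<^esub> g)"

definition is_zkernel ::
    "('o, 'a, 'm) cat_scheme \<Rightarrow> 'o set \<Rightarrow> 'o set \<Rightarrow> 'a \<Rightarrow> 'a \<Rightarrow> bool" where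
  "is_zkernel C \<T> \<F> k f \<longleftrightarrow>
     k \<in> Arr C \<and> f \<in> Arr C \<and> Cod C k = Dom C f \<and> trivial_arr C \<T> \<F> (f \<cdot>\<^bsub>C\<^esub> k) \<and>
     (\<forall>m \<in> Arr C. Cod C m = Dom C f \<and> trivial_arr C \<T> \<F> (f \<cdot>\<^bsub>C\<^esub> m) \<longrightarrow>
        (\<exists>!h. h \<in> hom C (Dom C m) (Dom C k) \<and> k \<cdot>\<^bsub>C\<^esub> h = m))"

definition is_zcokernel ::
    "('o, 'a, 'm) cat_scheme \<Rightarrow> 'o set \<Rightarrow> 'o set \<Rightarrow> 'a \<Rightarrow> 'a \<Rightarrow> bool" where
  "is_zcokernel C \<T> \<F> q f \<longleftrightarrow>
     q \<in> Arr C \<and> f \<in> Arr C \<and> Dom C q = Cod C f \<and> trivial_arr C \<T> \<F> (q \<cdot>\<^bsub>C\<^esub> f) \<and>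
     (\<forall>m \<in> Arr C. Dom C m = Cod C f \<and> trivial_arr C \<T> \<F> (m \<cdot>\<^bsub>C\<^esub> f) \<longrightarrow>
        (\<exists>!h. h \<in> hom C (Cod C q) (Cod C m) \<and> h \<cdot>\<^bsub>C\<^esub> q = m))"

definition short_zexact ::
    "('o, 'a, 'm) cat_scheme \<Rightarrow> 'o set \<Rightarrow> 'o set \<Rightarrow> 'a \<Rightarrow> 'a \<Rightarrow> bool" where
  "short_zexact C \<T> \<F> k q \<longleftrightarrow> is_zkernel C \<T> \<F> k q \<and> is_zcokernel C \<T> \<F> q k"

text \<open>The sequences of axiom (PT2) at the object \<open>A\<close>; they are unique up to isomorphism.\<close>

definition canonical_seq ::
    "('o, 'a, 'm) cat_scheme \<Rightarrow> 'o set \<Rightarrow> 'o set \<Rightarrow> 'o \<Rightarrow> 'a \<Rightarrow> 'a \<Rightarrow> bool" where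
  "canonical_seq C \<T> \<F> A k q \<longleftrightarrow>
     short_zexact C \<T> \<F> k q \<and> Cod C k = A \<and> Dom C k \<in> \<T> \<and> Cod C q \<in> \<F>"

locale pretorsion_theory = category C
  for C :: "('o, 'a, 'm) cat_scheme" (structure) +
  fixes \<T> :: "'o set" and \<F> :: "'o set"
  assumes torsion_subset: "\<T> \<subseteq> Obj C"
    and torsionfree_subset: "\<F> \<subseteq> Obj C"
    and torsion_iso_closed: "\<lbrakk>A \<in> \<T>; isomorphic_objs C A B\<rbrakk> \<Longrightarrow> B \<in> \<T>"
    and torsionfree_iso_closed: "\<lbrakk>A \<in> \<F>; isomorphic_objs C A B\<rbrakk> \<Longrightarrow> B \<in> \<F>"
    and PT1: "\<lbrakk>A \<in> \<T>; B \<in> \<F>; f \<in> hom C A B\<rbrakk> \<Longrightarrow> trivial_arr C \<T> \<F> f"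
    and PT2: "A \<in> Obj C \<Longrightarrow> \<exists>k q. canonical_seq C \<T> \<F> A k q"

locale torsion_theory = pretorsion_theory C \<T> \<F>
  for C :: "('o, 'a, 'm) cat_scheme" (structure) and \<T> and \<F> +
  assumes trivial_objs_zero: "Z \<in> \<T> \<inter> \<F> \<Longrightarrow> zero_obj C Z"

text \<open>A choice of \<open>\<eta>\<^sub>A : A \<rightarrow> \<phi>(A)\<close>, and the resulting functor \<open>\<phi>\<close>, whose value on \<open>f : A \<rightarrow> B\<close>
  is determined by \<open>\<phi>(f) \<cdot> \<eta>\<^sub>A = \<eta>\<^sub>B \<cdot> f\<close>.\<close>

definition eta :: "('o, 'a, 'm) cat_scheme \<Rightarrow> 'o set \<Rightarrow> 'o set \<Rightarrow> 'o \<Rightarrow> 'a" where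
  "eta C \<T> \<F> A = (SOME q. \<exists>k. canonical_seq C \<T> \<F> A k q)"

definition phi_obj :: "('o, 'a, 'm) cat_scheme \<Rightarrow> 'o set \<Rightarrow> 'o set \<Rightarrow> 'o \<Rightarrow> 'o" where
  "phi_obj C \<T> \<F> A = Cod C (eta C \<T> \<F> A)"

definition phi_arr :: "('o, 'a, 'm) cat_scheme \<Rightarrow> 'o set \<Rightarrow> 'o set \<Rightarrow> 'a \<Rightarrow> 'a" where
  "phi_arr C \<T> \<F> f =
     (THE h. h \<in> hom C (phi_obj C \<T> \<F> (Dom C f)) (phi_obj C \<T> \<F> (Cod C f)) \<and>
             h \<cdot>\<^bsub>C\<^esub> eta C \<T> \<F> (Dom C f) = eta C \<T> \<F> (Cod C f) \<cdot>\<^bsub>C\<^esub> f)"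

text \<open>As the canonical sequences are only determined up to isomorphism, preserving them means
  sending every sequence as in (PT2) to a sequence as in (PT2).\<close>

locale torsion_functor =
  cat_functor C C' Fo Fa +
  source: pretorsion_theory C \<T> \<F> + target: pretorsion_theory C' \<T>' \<F>'
  for C :: "('o, 'a, 'm) cat_scheme" and \<T> and \<F>
    and C' :: "('p, 'b, 'n) cat_scheme" and \<T>' and \<F>' and Fo and Fa +
  assumes preserves_torsion: "A \<in> \<T> \<Longrightarrow> Fo A \<in> \<T>'"
    and preserves_torsionfree: "A \<in> \<F> \<Longrightarrow> Fo A \<in> \<F>'"
    and preserves_canonical_seq: "\<lbrakk>A \<in> Obj C; canonical_seq C \<T> \<F> A k q\<rbrakk>
          \<Longrightarrow> canonical_seq C' \<T>' \<F>' (Fo A) (Fa k) (Fa q)"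


section \<open>Compatibility\<close>

locale compatible =
  coherent_system C zero \<D> + pretorsion_theory C \<T> \<F>
  for C :: "('o, 'a, 'm) cat_scheme" (structure) and zero and \<D> and \<T> and \<F> +
  assumes CC1: "\<lbrakk>s \<in> \<D>; Cod C s \<in> \<T> \<inter> \<F>\<rbrakk> \<Longrightarrow> Dom C s \<in> \<T> \<inter> \<F>"
    and CC2: "\<lbrakk>s \<in> \<D>; t \<in> \<D>; is_union C s t u;
          i \<in> hom C (Dom C s) (Dom C u); u \<cdot> i = s;
          j \<in> hom C (Dom C t) (Dom C u); u \<cdot> j = t;
          f \<in> hom C (Dom C u) B;
          trivial_arr C \<T> \<F> (f \<cdot> i); trivial_arr C \<T> \<F> (f \<cdot> j)\<rbrakk>
          \<Longrightarrow> trivial_arr C \<T> \<F> f"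
    and CC3: "s \<in> \<D> \<Longrightarrow> phi_arr C \<T> \<F> s \<in> \<D>"
    and CC4: "\<lbrakk>A \<in> Obj C; s \<in> \<D>; Cod C s = phi_obj C \<T> \<F> A;
          is_pullback C (eta C \<T> \<F> A) s p v\<rbrakk> \<Longrightarrow> dist_epi C \<D> v"
    and CC5: "\<lbrakk>s \<in> \<D>; iso_arr C (phi_arr C \<T> \<F> s)\<rbrakk> \<Longrightarrow> iso_arr C s"


section \<open>The stable category\<close>

text \<open>For subobjects \<open>r\<close>, \<open>s\<close> of the same object and \<open>f\<close> defined on the domain of \<open>s\<close>: the
  restriction of \<open>f\<close> to the intersection of \<open>r\<close> and \<open>s\<close> is trivial.\<close>

definition trivial_on_inter ::
    "('o, 'a, 'm) cat_scheme \<Rightarrow> 'o set \<Rightarrow> 'o set \<Rightarrow> 'a \<Rightarrow> 'a \<Rightarrow> 'a \<Rightarrow> bool" where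
  "trivial_on_inter C \<T> \<F> r s f \<longleftrightarrow>
     (\<exists>p q. is_pullback C r s p q \<and> trivial_arr C \<T> \<F> (f \<cdot>\<^bsub>C\<^esub> q))"

text \<open>Triples representing the morphisms from \<open>A\<close> to \<open>B\<close> in the category DisPar. Two triples that
  differ only by the choice of the representing monomorphisms are the same morphism of DisPar;
  they are in particular identified by \<open>stab_rel\<close> below.\<close>

definition dispar ::
    "('o, 'a, 'm) cat_scheme \<Rightarrow> 'o set \<Rightarrow> 'o set \<Rightarrow> 'a set \<Rightarrow> 'o \<Rightarrow> 'o \<Rightarrow> ('a \<times> 'a \<times> 'a) set"
  where
  "dispar C \<T> \<F> \<D> A B =
     {(s0, s1, f). s0 \<in> \<D> \<and> s1 \<in> \<D> \<and> Cod C s0 = A \<and> Cod C s1 = A \<and>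
        is_union C s0 s1 (Id C A) \<and> f \<in> hom C (Dom C s1) B \<and>
        trivial_on_inter C \<T> \<F> s0 s1 f}"

text \<open>\<open>dispar_composite C y x z\<close>: the triple \<open>z\<close> represents the composite of \<open>y\<close> after \<open>x\<close>. The
  inverse images along \<open>f : S\<^sub>1 \<rightarrow> B\<close> are subobjects of \<open>S\<^sub>1\<close>, viewed in \<open>A\<close> by composing with
  \<open>s1\<close>.\<close>

fun dispar_composite ::
    "('o, 'a, 'm) cat_scheme \<Rightarrow> 'a \<times> 'a \<times> 'a \<Rightarrow> 'a \<times> 'a \<times> 'a \<Rightarrow> 'a \<times> 'a \<times> 'a \<Rightarrow> bool" where
  "dispar_composite C (t0, t1, g) (s0, s1, f) (r0, r1, h) \<longleftrightarrow>
     (\<exists>p0 f0 p1 f1. is_pullback C f t0 p0 f0 \<and> is_pullback C f t1 p1 f1 \<and>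
        is_union C s0 (s1 \<cdot>\<^bsub>C\<^esub> p0) r0 \<and> r1 = s1 \<cdot>\<^bsub>C\<^esub> p1 \<and> h = g \<cdot>\<^bsub>C\<^esub> f1)"

definition stab_rel ::
    "('o, 'a, 'm) cat_scheme \<Rightarrow> 'o set \<Rightarrow> 'o set \<Rightarrow> 'a set \<Rightarrow> 'o \<Rightarrow> 'o
       \<Rightarrow> (('a \<times> 'a \<times> 'a) \<times> ('a \<times> 'a \<times> 'a)) set" where
  "stab_rel C \<T> \<F> \<D> A B =
     {((s0, s1, f), (t0, t1, g)).
        (s0, s1, f) \<in> dispar C \<T> \<F> \<D> A B \<and> (t0, t1, g) \<in> dispar C \<T> \<F> \<D> A B \<and>
        (\<exists>u0 u1 i j. u0 \<in> \<D> \<and> u1 \<in> \<D> \<and> Cod C u0 = A \<and> Cod C u1 = A \<and>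
           is_union C u0 u1 (Id C A) \<and>
           i \<in> hom C (Dom C u1) (Dom C s1) \<and> s1 \<cdot>\<^bsub>C\<^esub> i = u1 \<and>
           j \<in> hom C (Dom C u1) (Dom C t1) \<and> t1 \<cdot>\<^bsub>C\<^esub> j = u1 \<and>
           f \<cdot>\<^bsub>C\<^esub> i = g \<cdot>\<^bsub>C\<^esub> j \<and>
           trivial_on_inter C \<T> \<F> u0 s1 f \<and> trivial_on_inter C \<T> \<F> u0 t1 g)}"

text \<open>A morphism of the stable category is an equivalence class together with its domain and
  codomain.\<close>

definition stab_sigma ::
    "('o, 'a, 'm) cat_scheme \<Rightarrow> 'o \<Rightarrow> 'a set \<Rightarrow> 'o set \<Rightarrow> 'o set \<Rightarrow> 'a
       \<Rightarrow> 'o \<times> 'o \<times> ('a \<times> 'a \<times> 'a) set" where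
  "stab_sigma C zero \<D> \<T> \<F> f =
     (Dom C f, Cod C f,
      stab_rel C \<T> \<F> \<D> (Dom C f) (Cod C f) ``
        {(initial_arr C zero (Dom C f), Id C (Dom C f), f)})"

text \<open>As \<open>stab_rel\<close> is a congruence, the union in the composition is the class of any composite
  of representatives.\<close>

definition Stab ::
    "('o, 'a, 'm) cat_scheme \<Rightarrow> 'o \<Rightarrow> 'a set \<Rightarrow> 'o set \<Rightarrow> 'o set
       \<Rightarrow> ('o, 'o \<times> 'o \<times> ('a \<times> 'a \<times> 'a) set) cat" where
  "Stab C zero \<D> \<T> \<F> =
     \<lparr>Obj = Obj C,
      Arr = {(A, B, X). A \<in> Obj C \<and> B \<in> Obj C \<and>
               X \<in> dispar C \<T> \<F> \<D> A B // stab_rel C \<T> \<F> \<D> A B},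
      Dom = (\<lambda>(A, B, X). A),
      Cod = (\<lambda>(A, B, X). B),
      Id = (\<lambda>A. stab_sigma C zero \<D> \<T> \<F> (Id C A)),
      Comp = (\<lambda>(B', D, Y) (A, B, X).
                (A, D, \<Union>{stab_rel C \<T> \<F> \<D> A D `` {z} | x y z.
                            x \<in> X \<and> y \<in> Y \<and> dispar_composite C y x z}))\<rparr>"

end

theory Submission
  imports Defs
begin

text \<open>Call \<open>x\<close> a generalised element of its codomain. If \<open>x\<close> lies in the union of two
  distinguished subobjects, then by (CS4) its domain is covered by two distinguished subobjects on
  which \<open>x\<close> lies in the first, respectively in the second. Lying in a distinguished subobject and,
  by (CC2), being trivial are local for such covers, and by (CC1) distinguished monomorphisms reflect
  triviality. So all conditions on triples can be checked on generalised elements, where a triple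
  \<open>(S0, S1, f)\<close> behaves like a function with value \<open>f x\<close> on \<open>S1\<close> and zero on \<open>S0\<close>.

  The class of \<open>(S0, S1, f)\<close> is trivial in the stable category if and only if \<open>f\<close> is trivial, and any
  two such parallel classes are equal, which is why trivial objects become zero objects. Kernels are
  preserved since a class killed by \<open>\<eta>\<close> is represented by \<open>(S0, S1, f)\<close> with \<open>f\<close> factoring through
  \<open>\<epsilon>\<close>. For cokernels, if the class of \<open>(S0, S1, f)\<close> kills \<open>\<epsilon>\<close>, then \<open>f = f' \<eta>\<close> for some \<open>f'\<close> on
  \<open>\<phi>(S1)\<close>, and the factorisation is the class of \<open>(\<phi>(S0), \<phi>(S1), f')\<close>: each distinguished \<open>S\<close> is the
  pullback of \<open>\<phi>(S)\<close> along \<open>\<eta>\<close> by (CC5), and by (CC4) the pullbacks of \<open>\<eta>\<close> along distinguished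
  monomorphisms reflect triviality.\<close>

section \<open>Subobjects and pullbacks\<close>

context category
begin

section \<open>Composition, monomorphisms, epimorphisms and isomorphisms\<close>

lemma hom_iff [simp]: "f \<in> hom C A B \<longleftrightarrow> f \<in> Arr C \<and> Dom C f = A \<and> Cod C f = B"
  by (auto simp: hom_def)

lemma comp_arr [simp]:
  assumes "f \<in> Arr C" "g \<in> Arr C" "Cod C f = Dom C g"
  shows "g \<cdot> f \<in> Arr C" "Dom C (g \<cdot> f) = Dom C f" "Cod C (g \<cdot> f) = Cod C g"
  using Comp_in_hom[of f "Dom C f" "Cod C f" g "Cod C g"] assms by auto

lemma id_arr [simp]:
  assumes "A \<in> Obj C"
  shows "Id C A \<in> Arr C" "Dom C (Id C A) = A" "Cod C (Id C A) = A"
  using Id_in_hom[OF assms] by auto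

lemmas dom_cod_obj [simp] = Dom_in_Obj Cod_in_Obj

lemma comp_id [simp]: "\<lbrakk>f \<in> Arr C; Dom C f = A\<rbrakk> \<Longrightarrow> f \<cdot> Id C A = f"
  using Comp_Id[of f A "Cod C f"] by simp

lemma id_comp [simp]: "\<lbrakk>f \<in> Arr C; Cod C f = A\<rbrakk> \<Longrightarrow> Id C A \<cdot> f = f"
  using Id_Comp[of f "Dom C f" A] by simp

lemma comp_assoc [simp]:
  "\<lbrakk>f \<in> Arr C; g \<in> Arr C; h \<in> Arr C; Cod C f = Dom C g; Cod C g = Dom C h\<rbrakk>
    \<Longrightarrow> (h \<cdot> g) \<cdot> f = h \<cdot> (g \<cdot> f)"
  using Comp_assoc[of f "Dom C f" "Dom C g" g "Dom C h" h "Cod C h"] by simp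

text \<open>Since \<open>comp_assoc\<close> makes the simplifier bracket to the right, a known
  product \<open>g \<cdot> f\<close> is no longer a subterm once a further arrow \<open>x\<close> is
  composed on the right; this rule and \<open>comp_assoc_eq2\<close> apply such an equation
  there.\<close>

lemma comp_assoc_eq:
  assumes "g \<cdot> f = k" "f \<in> Arr C" "g \<in> Arr C" "Cod C f = Dom C g" "x \<in> Arr C" "Cod C x = Dom C f"
  shows "g \<cdot> (f \<cdot> x) = k \<cdot> x"
  using comp_assoc[of x f g] assms by simp

lemma comp_assoc_eq2:
  assumes "g \<cdot> f = k \<cdot> l" "f \<in> Arr C" "g \<in> Arr C" "Cod C f = Dom C g" "x \<in> Arr C" "Cod C x = Dom C f"
    "k \<in> Arr C" "l \<in> Arr C" "Cod C l = Dom C k"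
  shows "g \<cdot> (f \<cdot> x) = k \<cdot> (l \<cdot> x)"
proof -
  have "Dom C l = Dom C f" using assms by (metis comp_arr(2))
  then show ?thesis using comp_assoc_eq[OF assms(1-6)] assms by simp
qed

lemma mono_arrD:
  assumes "mono_arr C s" "s \<cdot> g = s \<cdot> h" "g \<in> Arr C" "h \<in> Arr C"
    "Cod C g = Dom C s" "Cod C h = Dom C s"
  shows "g = h"
proof -
  have "s \<in> Arr C" using assms(1) by (simp add: mono_arr_def)
  then have "Dom C g = Dom C h" using assms comp_arr(2) by metis
  then show ?thesis using assms by (auto simp: mono_arr_def)
qed

lemma mono_arr_arr: "mono_arr C s \<Longrightarrow> s \<in> Arr C"
  by (simp add: mono_arr_def)

lemma epi_arrD:
  assumes "epi_arr C e" "g \<cdot> e = h \<cdot> e" "g \<in> Arr C" "h \<in> Arr C"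
    "Dom C g = Cod C e" "Dom C h = Cod C e"
  shows "g = h"
proof -
  have "e \<in> Arr C" using assms(1) by (simp add: epi_arr_def)
  then have "Cod C g = Cod C h" using assms comp_arr(3) by metis
  then show ?thesis using assms by (auto simp: epi_arr_def)
qed

lemma iso_arrI:
  assumes "f \<in> Arr C" "g \<in> Arr C" "Dom C g = Cod C f" "Cod C g = Dom C f"
    "g \<cdot> f = Id C (Dom C f)" "f \<cdot> g = Id C (Cod C f)"
  shows "iso_arr C f"
  using assms by (auto simp: iso_arr_def)

lemma iso_arrE:
  assumes "iso_arr C f"
  obtains g where "f \<in> Arr C" "g \<in> Arr C" "Dom C g = Cod C f" "Cod C g = Dom C f"
    "g \<cdot> f = Id C (Dom C f)" "f \<cdot> g = Id C (Cod C f)" "iso_arr C g"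
proof -
  obtain g where "f \<in> Arr C" "g \<in> Arr C" "Dom C g = Cod C f" "Cod C g = Dom C f"
    "g \<cdot> f = Id C (Dom C f)" "f \<cdot> g = Id C (Cod C f)"
    using assms by (auto simp: iso_arr_def)
  then show ?thesis using that[of g] iso_arrI[of g f] by auto
qed

lemma iso_id [simp]: "A \<in> Obj C \<Longrightarrow> iso_arr C (Id C A)"
  by (rule iso_arrI[of _ "Id C A"]) auto

section \<open>The preorder on arrows with a common codomain\<close>

lemma sub_leI:
  assumes "w \<cdot> h = x" "h \<in> Arr C" "w \<in> Arr C" "Cod C h = Dom C w"
  shows "sub_le C x w"
  using assms by (auto simp: sub_le_def intro!: bexI[of _ h])

lemma sub_leE:
  assumes "sub_le C x w"
  obtains h where "h \<in> Arr C" "Dom C h = Dom C x" "Cod C h = Dom C w" "w \<cdot> h = x" "Cod C x = Cod C w"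
  using assms by (auto simp: sub_le_def)

lemma sub_le_refl: "x \<in> Arr C \<Longrightarrow> sub_le C x x"
  by (rule sub_leI[of _ "Id C (Dom C x)"]) auto

lemma sub_le_trans:
  assumes "sub_le C x y" "sub_le C y z" "z \<in> Arr C" "y \<in> Arr C"
  shows "sub_le C x z"
proof -
  obtain h where h: "h \<in> Arr C" "Cod C h = Dom C y" "y \<cdot> h = x"
    using assms(1) by (blast elim: sub_leE)
  obtain k where k: "k \<in> Arr C" "Dom C k = Dom C y" "Cod C k = Dom C z" "z \<cdot> k = y"
    using assms(2) by (blast elim: sub_leE)
  show ?thesis using assms h k
    by (intro sub_leI[of z "k \<cdot> h"]) (auto simp: comp_assoc_eq[OF k(4)])
qed

lemma sub_le_comp_right:
  assumes "sub_le C x w" "w \<in> Arr C" "y \<in> Arr C" "Cod C y = Dom C x"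
  shows "sub_le C (x \<cdot> y) w"
proof -
  obtain h where h: "h \<in> Arr C" "Dom C h = Dom C x" "Cod C h = Dom C w" "w \<cdot> h = x"
    using assms(1) by (blast elim: sub_leE)
  then show ?thesis using assms by (intro sub_leI[of w "h \<cdot> y"]) (auto simp: comp_assoc_eq[OF h(4)])
qed

lemma sub_le_comp_left:
  assumes "sub_le C x w" "w \<in> Arr C" "s \<in> Arr C" "Cod C w = Dom C s"
  shows "sub_le C (s \<cdot> x) (s \<cdot> w)"
proof -
  obtain h where h: "h \<in> Arr C" "Dom C h = Dom C x" "Cod C h = Dom C w" "w \<cdot> h = x"
    using assms(1) by (blast elim: sub_leE)
  then show ?thesis using assms by (intro sub_leI[of _ "h"]) auto
qed

lemma sub_le_comp_mono:
  assumes "sub_le C (s \<cdot> x) (s \<cdot> w)" "w \<in> Arr C" "x \<in> Arr C" "mono_arr C s"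
    "Cod C w = Dom C s" "Cod C x = Dom C s"
  shows "sub_le C x w"
proof -
  have s: "s \<in> Arr C" using assms by (simp add: mono_arr_def)
  obtain h where h: "h \<in> Arr C" "Cod C h = Dom C w" "s \<cdot> (w \<cdot> h) = s \<cdot> x"
    using assms s by (auto elim!: sub_leE)
  then have "w \<cdot> h = x" using mono_arrD[OF assms(4), of "w \<cdot> h" x] assms by auto
  then show ?thesis using h assms by (intro sub_leI[of _ "h"]) auto
qed

lemma sub_le_id: "\<lbrakk>x \<in> Arr C; Cod C x = A\<rbrakk> \<Longrightarrow> sub_le C x (Id C A)"
  by (rule sub_leI[of _ x]) auto

lemma sub_le_antisym:
  assumes "mono_arr C u" "mono_arr C w" "sub_le C u w" "sub_le C w u"
  obtains h where "iso_arr C h" "Dom C h = Dom C u" "Cod C h = Dom C w" "w \<cdot> h = u"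
proof -
  have a: "u \<in> Arr C" "w \<in> Arr C" using assms by (auto simp: mono_arr_def)
  obtain h where h: "h \<in> Arr C" "Dom C h = Dom C u" "Cod C h = Dom C w" "w \<cdot> h = u"
    using assms by (blast elim: sub_leE)
  obtain k where k: "k \<in> Arr C" "Dom C k = Dom C w" "Cod C k = Dom C u" "u \<cdot> k = w"
    using assms by (blast elim: sub_leE)
  have "h \<cdot> k = Id C (Dom C w)"
    using mono_arrD[OF assms(2), of "h \<cdot> k" "Id C (Dom C w)"] a h k by (auto simp: comp_assoc_eq[OF h(4)])
  moreover have "k \<cdot> h = Id C (Dom C u)"
    using mono_arrD[OF assms(1), of "k \<cdot> h" "Id C (Dom C u)"] a h k by (auto simp: comp_assoc_eq[OF k(4)])
  ultimately have "iso_arr C h" using h k by (intro iso_arrI[of h k]) auto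
  then show ?thesis using that h by blast
qed

section \<open>Pullbacks and inverse images\<close>

lemma pullbackD:
  assumes "is_pullback C f g p q"
  shows "f \<in> Arr C" "g \<in> Arr C" "p \<in> Arr C" "q \<in> Arr C" "Cod C f = Cod C g" "Dom C p = Dom C q"
    "Cod C p = Dom C f" "Cod C q = Dom C g" "f \<cdot> p = g \<cdot> q"
  using assms by (auto simp: is_pullback_def)

lemma pullback_ex1:
  assumes "is_pullback C f g p q" "x \<in> hom C X (Dom C f)" "y \<in> hom C X (Dom C g)" "f \<cdot> x = g \<cdot> y"
  shows "\<exists>!h. h \<in> hom C X (Dom C p) \<and> p \<cdot> h = x \<and> q \<cdot> h = y"
  using assms unfolding is_pullback_def by blast

lemma pullback_univ:
  assumes "is_pullback C f g p q" "f \<cdot> x = g \<cdot> y" "x \<in> Arr C" "y \<in> Arr C"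
    "Cod C x = Dom C f" "Cod C y = Dom C g"
  obtains h where "h \<in> Arr C" "Dom C h = Dom C x" "Cod C h = Dom C p" "p \<cdot> h = x" "q \<cdot> h = y"
proof -
  have "Dom C x = Dom C y" using assms pullbackD[OF assms(1)] comp_arr(2) by metis
  then have "\<exists>!h. h \<in> hom C (Dom C x) (Dom C p) \<and> p \<cdot> h = x \<and> q \<cdot> h = y"
    using pullback_ex1[OF assms(1) _ _ assms(2)] assms(3-6) by auto
  then show ?thesis using that by auto
qed

text \<open>A monic projection \<open>p\<close> forces uniqueness of the induced arrow, so only its
  existence is left as a premise.\<close>

lemma pullbackI:
  assumes "f \<in> Arr C" "g \<in> Arr C" "p \<in> Arr C" "q \<in> Arr C" "Cod C f = Cod C g" "Dom C p = Dom C q"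
    "Cod C p = Dom C f" "Cod C q = Dom C g" "f \<cdot> p = g \<cdot> q" "mono_arr C p"
    "\<And>x y. \<lbrakk>x \<in> Arr C; y \<in> Arr C; Cod C x = Dom C f; Cod C y = Dom C g; Dom C x = Dom C y;
       f \<cdot> x = g \<cdot> y\<rbrakk>
      \<Longrightarrow> \<exists>h \<in> Arr C. Dom C h = Dom C x \<and> Cod C h = Dom C p \<and> p \<cdot> h = x \<and> q \<cdot> h = y"
  shows "is_pullback C f g p q"
  unfolding is_pullback_def
proof (intro conjI allI ballI impI)
  fix X x y assume *: "x \<in> hom C X (Dom C f)" "y \<in> hom C X (Dom C g)" "f \<cdot> x = g \<cdot> y"
  then obtain h where h: "h \<in> Arr C" "Dom C h = X" "Cod C h = Dom C p" "p \<cdot> h = x" "q \<cdot> h = y"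
    using assms(11)[of x y] by auto
  show "\<exists>!h. h \<in> hom C X (Dom C p) \<and> p \<cdot> h = x \<and> q \<cdot> h = y"
  proof (rule ex1I[of _ h])
    show "h \<in> hom C X (Dom C p) \<and> p \<cdot> h = x \<and> q \<cdot> h = y" using h by simp
    fix h' assume "h' \<in> hom C X (Dom C p) \<and> p \<cdot> h' = x \<and> q \<cdot> h' = y"
    then show "h' = h" using mono_arrD[OF assms(10), of h' h] h by auto
  qed
qed (use assms in auto)

text \<open>Arrows \<open>g\<close>, \<open>h\<close> with \<open>p \<cdot> g = p \<cdot> h\<close>
  have equal composites with \<open>s \<cdot> q\<close>, hence with \<open>q\<close> as
  \<open>s\<close> is monic, and the uniqueness clause of the pullback identifies them.\<close>

lemma pullback_mono:
  assumes "is_pullback C f s p q" "mono_arr C s"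
  shows "mono_arr C p"
  unfolding mono_arr_def
proof (intro conjI allI ballI impI)
  note pb = pullbackD[OF assms(1)]
  show "p \<in> Arr C" by (rule pb)
  fix X g h assume *: "g \<in> hom C X (Dom C p)" "h \<in> hom C X (Dom C p)" "p \<cdot> g = p \<cdot> h"
  have "s \<cdot> (q \<cdot> g) = f \<cdot> (p \<cdot> g)" using pb * comp_assoc_eq2[OF pb(9), of g] by auto
  also have "\<dots> = f \<cdot> (p \<cdot> h)" using * by simp
  also have "\<dots> = s \<cdot> (q \<cdot> h)" using pb * comp_assoc_eq2[OF pb(9), of h] by auto
  finally have **: "q \<cdot> g = q \<cdot> h" using mono_arrD[OF assms(2)] pb * by auto
  have "\<exists>!k. k \<in> hom C X (Dom C p) \<and> p \<cdot> k = p \<cdot> g \<and> q \<cdot> k = q \<cdot> g"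
    using pullback_ex1[OF assms(1), of "p \<cdot> g" X "q \<cdot> g"] * pb comp_assoc_eq2[OF pb(9), of g]
    by auto
  then show "g = h" using * ** by metis
qed

lemma pullback_le_iff:
  assumes "is_pullback C f s p q" "x \<in> Arr C" "Cod C x = Dom C f"
  shows "sub_le C x p \<longleftrightarrow> sub_le C (f \<cdot> x) s"
proof
  note pb = pullbackD[OF assms(1)]
  assume "sub_le C x p"
  then obtain h where h: "h \<in> Arr C" "Dom C h = Dom C x" "Cod C h = Dom C p" "p \<cdot> h = x"
    by (blast elim: sub_leE)
  then show "sub_le C (f \<cdot> x) s"
    using pb comp_assoc_eq2[OF pb(9), of h] by (intro sub_leI[of s "q \<cdot> h"]) auto
next
  note pb = pullbackD[OF assms(1)]
  assume "sub_le C (f \<cdot> x) s"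
  then obtain h where h: "h \<in> Arr C" "Cod C h = Dom C s" "s \<cdot> h = f \<cdot> x"
    by (blast elim: sub_leE)
  obtain k where "k \<in> Arr C" "Cod C k = Dom C p" "p \<cdot> k = x"
    using pullback_univ[OF assms(1), of x h] assms h pb by metis
  then show "sub_le C x p" using pb by (intro sub_leI[of p k]) auto
qed

lemma pullback_id:
  assumes "f \<in> Arr C" "Cod C f = B"
  shows "is_pullback C f (Id C B) (Id C (Dom C f)) f"
proof (rule pullbackI)
  show "mono_arr C (Id C (Dom C f))" using assms by (auto simp: mono_arr_def)
  fix x y assume "x \<in> Arr C" "y \<in> Arr C" "Cod C x = Dom C f" "Cod C y = Dom C (Id C B)"
    "Dom C x = Dom C y" "f \<cdot> x = Id C B \<cdot> y"
  then show "\<exists>h\<in>Arr C. Dom C h = Dom C x \<and> Cod C h = Dom C (Id C (Dom C f)) \<and>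
     Id C (Dom C f) \<cdot> h = x \<and> f \<cdot> h = y"
    using assms by (intro bexI[of _ x]) auto
qed (use assms in auto)

lemma pullback_along_id:
  assumes "mono_arr C s" "Cod C s = B"
  shows "is_pullback C (Id C B) s s (Id C (Dom C s))"
proof (rule pullbackI)
  show "mono_arr C s" by (rule assms)
  have s: "s \<in> Arr C" by (rule mono_arr_arr[OF assms(1)])
  fix x y assume "x \<in> Arr C" "y \<in> Arr C" "Cod C x = Dom C (Id C B)" "Cod C y = Dom C s"
    "Dom C x = Dom C y" "Id C B \<cdot> x = s \<cdot> y"
  then show "\<exists>h\<in>Arr C. Dom C h = Dom C x \<and> Cod C h = Dom C s \<and>
     s \<cdot> h = x \<and> Id C (Dom C s) \<cdot> h = y"
    using assms s by (intro bexI[of _ y]) auto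
qed (use assms mono_arr_arr[OF assms(1)] in auto)

section \<open>Unions, and pullbacks obtained by cancellation or transport\<close>

lemma unionD:
  assumes "is_union C s t u"
  shows "mono_arr C u" "sub_le C s u" "sub_le C t u" "Cod C s = Cod C u" "Cod C t = Cod C u"
    "u \<in> Arr C"
  using assms unfolding is_union_def sub_le_def mono_arr_def by blast+

lemma union_least:
  "\<lbrakk>is_union C s t u; mono_arr C w; sub_le C s w; sub_le C t w\<rbrakk> \<Longrightarrow> sub_le C u w"
  unfolding is_union_def by blast

lemma mono_cancel:
  assumes "mono_arr C (t \<cdot> h)" "h \<in> Arr C" "t \<in> Arr C" "Cod C h = Dom C t"
  shows "mono_arr C h"
  unfolding mono_arr_def
proof (intro conjI allI ballI impI)
  fix X g k assume *: "g \<in> hom C X (Dom C h)" "k \<in> hom C X (Dom C h)" "h \<cdot> g = h \<cdot> k"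
  then have "(t \<cdot> h) \<cdot> g = (t \<cdot> h) \<cdot> k" using assms by simp
  then show "g = k" using mono_arrD[OF assms(1), of g k] * assms by auto
qed (rule assms)

text \<open>As \<open>t\<close> is monic, \<open>t \<cdot> x = (t \<cdot> h) \<cdot> y\<close>
  forces \<open>x = h \<cdot> y\<close>. Through this square, stability under pullback yields the
  cancellation rule \<open>dist_cancel\<close>.\<close>

lemma pullback_of_factor:
  assumes "mono_arr C t" "h \<in> Arr C" "Cod C h = Dom C t" "mono_arr C (t \<cdot> h)"
  shows "is_pullback C t (t \<cdot> h) h (Id C (Dom C h))"
proof (rule pullbackI)
  have t: "t \<in> Arr C" by (rule mono_arr_arr[OF assms(1)])
  show "mono_arr C h" using mono_cancel assms t by blast
  fix x y assume *: "x \<in> Arr C" "y \<in> Arr C" "Cod C x = Dom C t" "Cod C y = Dom C (t \<cdot> h)"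
    "t \<cdot> x = (t \<cdot> h) \<cdot> y"
  then have "x = h \<cdot> y" using mono_arrD[OF assms(1), of x "h \<cdot> y"] assms t by auto
  then show "\<exists>k\<in>Arr C. Dom C k = Dom C x \<and> Cod C k = Dom C h \<and> h \<cdot> k = x \<and>
     Id C (Dom C h) \<cdot> k = y"
    using assms t * by (intro bexI[of _ y]) auto
qed (use assms mono_arr_arr[OF assms(1)] in auto)

lemma pullback_iso:
  assumes "is_pullback C f g p q" "iso_arr C j" "Cod C j = Dom C p" "mono_arr C p"
  shows "is_pullback C f g (p \<cdot> j) (q \<cdot> j)"
proof -
  note pb = pullbackD[OF assms(1)]
  obtain i where i: "j \<in> Arr C" "i \<in> Arr C" "Dom C i = Cod C j" "Cod C i = Dom C j"
    "i \<cdot> j = Id C (Dom C j)" "j \<cdot> i = Id C (Cod C j)" using assms(2) by (rule iso_arrE)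
  have ji: "j \<cdot> (i \<cdot> x) = x" if "x \<in> Arr C" "Cod C x = Dom C p" for x
    using comp_assoc_eq[OF i(6), of x] i assms that by simp
  have ij: "i \<cdot> (j \<cdot> x) = x" if "x \<in> Arr C" "Cod C x = Dom C j" for x
    using comp_assoc_eq[OF i(5), of x] i assms that by simp
  show ?thesis
  proof (rule pullbackI)
    show "f \<cdot> (p \<cdot> j) = g \<cdot> (q \<cdot> j)" using comp_assoc_eq2[OF pb(9), of j] pb i assms by simp
    show "mono_arr C (p \<cdot> j)"
      unfolding mono_arr_def
    proof (intro conjI allI ballI impI)
      fix X a b assume *: "a \<in> hom C X (Dom C (p \<cdot> j))" "b \<in> hom C X (Dom C (p \<cdot> j))"
        "(p \<cdot> j) \<cdot> a = (p \<cdot> j) \<cdot> b"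
      then have "j \<cdot> a = j \<cdot> b"
        using mono_arrD[OF assms(4), of "j \<cdot> a" "j \<cdot> b"] pb i assms by simp
      then have "i \<cdot> (j \<cdot> a) = i \<cdot> (j \<cdot> b)" by simp
      then show "a = b" using ij[of a] ij[of b] * pb i assms by simp
    qed (use pb i assms in simp)
    fix x y assume *: "x \<in> Arr C" "y \<in> Arr C" "Cod C x = Dom C f" "Cod C y = Dom C g"
      "Dom C x = Dom C y" "f \<cdot> x = g \<cdot> y"
    obtain h where h: "h \<in> Arr C" "Dom C h = Dom C x" "Cod C h = Dom C p" "p \<cdot> h = x" "q \<cdot> h = y"
      using pullback_univ[OF assms(1) *(6,1-4)] .
    then show "\<exists>h\<in>Arr C. Dom C h = Dom C x \<and> Cod C h = Dom C (p \<cdot> j) \<and> (p \<cdot> j) \<cdot> h = x \<and> (q \<cdot> j) \<cdot> h = y"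
      using ji[of h] i pb assms by (intro bexI[of _ "i \<cdot> h"]) simp_all
  qed (use pb i assms in simp_all)
qed

section \<open>The ideal of trivial arrows\<close>

lemma trivial_arrE:
  assumes "trivial_arr C \<T> \<F> f"
  obtains Z g h where "Z \<in> \<T> \<inter> \<F>" "f \<in> Arr C" "g \<in> Arr C" "Dom C g = Dom C f" "Cod C g = Z"
    "h \<in> Arr C" "Dom C h = Z" "Cod C h = Cod C f" "h \<cdot> g = f"
proof -
  obtain Z g h where *: "Z \<in> \<T> \<inter> \<F>" "g \<in> hom C (Dom C f) Z" "h \<in> hom C Z (Cod C f)" "f = h \<cdot> g"
    and f: "f \<in> Arr C"
    using assms unfolding trivial_arr_def by blast
  have "g \<in> Arr C" "Dom C g = Dom C f" "Cod C g = Z" "h \<in> Arr C" "Dom C h = Z" "Cod C h = Cod C f"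
    using *(2,3) by simp_all
  then show ?thesis using that[OF *(1) f _ _ _ _ _ _ *(4)[symmetric]] by blast
qed

lemma trivial_arrI:
  assumes "f = h \<cdot> g" "Z \<in> \<T> \<inter> \<F>" "g \<in> Arr C" "Cod C g = Z" "h \<in> Arr C" "Dom C h = Z"
  shows "trivial_arr C \<T> \<F> f"
  unfolding trivial_arr_def hom_iff
proof
  show "f \<in> Arr C" using assms by simp
  show "\<exists>Z\<in>\<T> \<inter> \<F>. \<exists>g\<in>hom C (Dom C f) Z. \<exists>h\<in>hom C Z (Cod C f). f = h \<cdot> g"
    by (rule bexI[OF _ assms(2)], rule bexI[of _ g], rule bexI[of _ h]) (use assms in auto)
qed

lemma trivial_arr_comp_right:
  assumes "trivial_arr C \<T> \<F> f" "x \<in> Arr C" "Cod C x = Dom C f"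
  shows "trivial_arr C \<T> \<F> (f \<cdot> x)"
proof -
  obtain Z g h where *: "Z \<in> \<T> \<inter> \<F>" "g \<in> Arr C" "Dom C g = Dom C f" "Cod C g = Z"
    "h \<in> Arr C" "Dom C h = Z" "h \<cdot> g = f" using trivial_arrE[OF assms(1)] by metis
  have "h \<cdot> (g \<cdot> x) = f \<cdot> x" using comp_assoc_eq[OF *(7), of x] * assms by simp
  then show ?thesis by (intro trivial_arrI[of _ h "g \<cdot> x" Z]) (use assms * in simp_all)
qed

lemma trivial_arr_comp_left:
  assumes "trivial_arr C \<T> \<F> f" "x \<in> Arr C" "Cod C f = Dom C x"
  shows "trivial_arr C \<T> \<F> (x \<cdot> f)"
proof -
  obtain Z g h where *: "Z \<in> \<T> \<inter> \<F>" "g \<in> Arr C" "Cod C g = Z"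
    "h \<in> Arr C" "Dom C h = Z" "Cod C h = Cod C f" "h \<cdot> g = f" using trivial_arrE[OF assms(1)] by metis
  show ?thesis by (rule trivial_arrI[of _ "x \<cdot> h" g Z]) (use assms * in simp_all)
qed

end

section \<open>Covers by distinguished subobjects\<close>

context coherent_system
begin

section \<open>The strict initial object\<close>

lemma zero_obj [simp]: "zero \<in> Obj C"
  using strict_initial by (simp add: strict_initial_obj_def initial_obj_def)

lemma initial_unique:
  assumes "f \<in> Arr C" "Dom C f = zero"
  shows "f = initial_arr C zero (Cod C f)"
proof -
  have "\<exists>!f'. f' \<in> hom C zero (Cod C f)"
    using strict_initial assms by (simp add: strict_initial_obj_def initial_obj_def)
  then show ?thesis using assms unfolding initial_arr_def by (metis (mono_tags, lifting) hom_iff the_equality)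
qed

lemma initial_arr [simp]:
  assumes "A \<in> Obj C"
  shows "initial_arr C zero A \<in> Arr C" "Dom C (initial_arr C zero A) = zero"
    "Cod C (initial_arr C zero A) = A"
proof -
  have "\<exists>!f'. f' \<in> hom C zero A"
    using strict_initial assms by (simp add: strict_initial_obj_def initial_obj_def)
  then have "initial_arr C zero A \<in> hom C zero A" unfolding initial_arr_def by (rule theI')
  then show "initial_arr C zero A \<in> Arr C" "Dom C (initial_arr C zero A) = zero"
    "Cod C (initial_arr C zero A) = A" by auto
qed

lemma into_zero_iso: "\<lbrakk>x \<in> Arr C; Cod C x = zero\<rbrakk> \<Longrightarrow> iso_arr C x"
  using strict_initial by (simp add: strict_initial_obj_def)

text \<open>By strictness \<open>x\<close> is an isomorphism, so its domain is initial as well and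
  admits at most one arrow to any object.\<close>

lemma eq_of_into_zero:
  assumes "x \<in> Arr C" "Cod C x = zero" "f \<in> Arr C" "g \<in> Arr C" "Dom C f = Dom C x"
    "Dom C g = Dom C x" "Cod C f = Cod C g"
  shows "f = g"
proof -
  obtain y where y: "y \<in> Arr C" "Dom C y = zero" "Cod C y = Dom C x" "y \<cdot> x = Id C (Dom C x)"
    using into_zero_iso[OF assms(1,2)] assms(2) by (metis iso_arrE)
  have "f \<cdot> y = g \<cdot> y"
    using initial_unique[of "f \<cdot> y"] initial_unique[of "g \<cdot> y"] assms y by simp
  then have "(f \<cdot> y) \<cdot> x = (g \<cdot> y) \<cdot> x" by simp
  then show ?thesis using assms y by simp
qed

section \<open>Closure properties of distinguished subobjects\<close>

lemma dist_arr [simp]: "s \<in> \<D> \<Longrightarrow> s \<in> Arr C"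
  using dist_mono by (auto simp: mono_arr_def)

text \<open>Monomorphisms that contain each other differ by an isomorphism of their domains, so
  \<open>dist_representative\<close> makes membership in \<open>\<D>\<close> a property of the
  subobject and not of its representative.\<close>

lemma dist_iso_eq:
  assumes "s \<in> \<D>" "mono_arr C u" "sub_le C u s" "sub_le C s u"
  shows "u \<in> \<D>"
proof -
  obtain h where h: "iso_arr C h" "Dom C h = Dom C u" "Cod C h = Dom C s" "s \<cdot> h = u"
    using sub_le_antisym[OF assms(2) dist_mono[OF assms(1)] assms(3,4)] by blast
  then show ?thesis using dist_representative[OF assms(1) h(1,3)] by simp
qed

text \<open>\<open>CS3\<close> provides some distinguished pullback; every other pullback of the
  same arrows represents the same subobject.\<close>

lemma pullback_dist:
  assumes "is_pullback C f s p q" "s \<in> \<D>"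
  shows "p \<in> \<D>"
proof -
  note pb = pullbackD[OF assms(1)]
  obtain p' q' where p': "is_pullback C f s p' q'" "p' \<in> \<D>"
    using CS3[OF assms(2), of f] pb by auto
  note pb' = pullbackD[OF p'(1)]
  show ?thesis
  proof (rule dist_iso_eq[OF p'(2)])
    show "mono_arr C p" by (rule pullback_mono[OF assms(1) dist_mono[OF assms(2)]])
    show "sub_le C p p'"
      using pullback_le_iff[OF p'(1), of p] pb sub_leI[of s q "f \<cdot> p"] by simp
    show "sub_le C p' p"
      using pullback_le_iff[OF assms(1), of p'] pb' sub_leI[of s q' "f \<cdot> p'"] by simp
  qed
qed

lemma dist_pullbackE:
  assumes "s \<in> \<D>" "f \<in> Arr C" "Cod C f = Cod C s"
  obtains p q where "is_pullback C f s p q" "p \<in> \<D>" "Cod C p = Dom C f" "q \<in> Arr C"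
    "Dom C q = Dom C p" "Cod C q = Dom C s" "f \<cdot> p = s \<cdot> q"
proof -
  obtain p q where "is_pullback C f s p q" "p \<in> \<D>" using CS3[OF assms] by blast
  then show ?thesis using that pullbackD[of f s p q] by auto
qed

lemma union_dist:
  assumes "is_union C s t u" "s \<in> \<D>" "t \<in> \<D>"
  shows "u \<in> \<D>"
proof -
  have "Cod C s = Cod C t" using unionD[OF assms(1)] by simp
  then obtain u' where u': "u' \<in> \<D>" "is_union C s t u'" using CS2 assms by blast
  show ?thesis
    by (rule dist_iso_eq[OF u'(1)])
      (use unionD[OF assms(1)] unionD[OF u'(2)] union_least[OF assms(1)] union_least[OF u'(2)] in blast)+
qed

text \<open>\<open>h\<close> is the inverse image along \<open>t\<close> of the distinguished
  subobject \<open>t \<cdot> h\<close>.\<close>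

lemma dist_cancel:
  assumes "t \<cdot> h \<in> \<D>" "mono_arr C t" "h \<in> Arr C" "Cod C h = Dom C t"
  shows "h \<in> \<D>"
  using pullback_dist[OF pullback_of_factor] assms dist_mono by blast

lemma dist_comp: "\<lbrakk>s \<in> \<D>; t \<in> \<D>; Cod C s = Dom C t\<rbrakk> \<Longrightarrow> t \<cdot> s \<in> \<D>"
  by (rule CS5)

section \<open>Covers and local arguments\<close>

definition cover :: "'a \<Rightarrow> 'a \<Rightarrow> 'o \<Rightarrow> bool" where
  "cover s t A \<longleftrightarrow> s \<in> \<D> \<and> t \<in> \<D> \<and> Cod C s = A \<and> Cod C t = A \<and> is_union C s t (Id C A)"

lemma coverD:
  assumes "cover s t A"
  shows "s \<in> \<D>" "t \<in> \<D>" "Cod C s = A" "Cod C t = A" "is_union C s t (Id C A)" "A \<in> Obj C"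
  using assms dist_arr[of s] dom_cod_obj(2)[of s] by (auto simp: cover_def)

text \<open>Testing against distinguished upper bounds suffices: the union \<open>u\<close> provided
  by \<open>CS2\<close> is one of them, and it lies below every monic upper bound.\<close>

lemma coverI:
  assumes "s \<in> \<D>" "t \<in> \<D>" "Cod C s = A" "Cod C t = A"
    "\<And>w. \<lbrakk>w \<in> \<D>; Cod C w = A; sub_le C s w; sub_le C t w\<rbrakk> \<Longrightarrow> sub_le C (Id C A) w"
  shows "cover s t A"
proof -
  have A: "A \<in> Obj C" using assms by auto
  obtain u where u: "u \<in> \<D>" "is_union C s t u" using CS2 assms by metis
  note uD = unionD[OF u(2)]
  have le: "sub_le C (Id C A) u" using assms(5)[of u] u uD assms(3) by auto
  have "is_union C s t (Id C A)"
    unfolding is_union_def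
  proof (intro conjI allI impI)
    show "mono_arr C (Id C A)" using A by (auto simp: mono_arr_def)
    show "sub_le C s (Id C A)" "sub_le C t (Id C A)" using assms sub_le_id by auto
    fix w assume w: "mono_arr C w \<and> sub_le C s w \<and> sub_le C t w"
    then have "sub_le C u w" using union_least[OF u(2)] by blast
    then show "sub_le C (Id C A) w" using sub_le_trans[OF le] w uD mono_arr_arr by blast
  qed
  then show ?thesis using assms by (simp add: cover_def)
qed

text \<open>\<open>x\<close> factors through \<open>u\<close>, so the pullback of \<open>u\<close>
  along \<open>x\<close> is everything, and by \<open>CS4\<close> it is the union of the pullbacks
  of \<open>s\<close> and \<open>t\<close>.\<close>

lemma local_split:
  assumes "is_union C s t u" "s \<in> \<D>" "t \<in> \<D>" "sub_le C x u" "x \<in> Arr C"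
  obtains p0 p1 where "cover p0 p1 (Dom C x)" "sub_le C (x \<cdot> p0) s" "sub_le C (x \<cdot> p1) t"
proof -
  note uD = unionD[OF assms(1)]
  have u: "u \<in> \<D>" by (rule union_dist[OF assms(1-3)])
  have c: "Cod C x = Cod C u" using assms(4) by (blast elim: sub_leE)
  obtain ps qs where s: "is_pullback C x s ps qs" "ps \<in> \<D>" "Cod C ps = Dom C x"
    using dist_pullbackE[OF assms(2,5)] c uD by metis
  obtain pt qt where t: "is_pullback C x t pt qt" "pt \<in> \<D>" "Cod C pt = Dom C x"
    using dist_pullbackE[OF assms(3,5)] c uD by metis
  obtain pu qu where pu: "is_pullback C x u pu qu" "pu \<in> \<D>" "Cod C pu = Dom C x"
    using dist_pullbackE[OF u assms(5)] c by metis
  have un: "is_union C ps pt pu" by (rule CS4[OF assms(2,3,1) s(1) t(1) pu(1)])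
  have "sub_le C (Id C (Dom C x)) pu"
    using pullback_le_iff[OF pu(1), of "Id C (Dom C x)"] assms(4,5) by simp
  then have "cover ps pt (Dom C x)"
    using s t pu un sub_le_trans union_least[OF un] dist_mono dist_arr by (intro coverI) blast+
  moreover have "sub_le C (x \<cdot> ps) s" "sub_le C (x \<cdot> pt) t"
    using pullback_le_iff[OF s(1), of ps] pullback_le_iff[OF t(1), of pt] s t
    by (auto intro!: sub_le_refl)
  ultimately show ?thesis using that by blast
qed

lemma cover_split:
  assumes "cover s t A" "x \<in> Arr C" "Cod C x = A"
  obtains p0 p1 where "cover p0 p1 (Dom C x)" "sub_le C (x \<cdot> p0) s" "sub_le C (x \<cdot> p1) t"
  using local_split[OF coverD(5,1,2)[OF assms(1)] sub_le_id] assms by metis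

text \<open>The inverse image of \<open>w\<close> along \<open>f\<close> contains \<open>p0\<close>
  and \<open>p1\<close>, hence everything.\<close>

lemma le_local:
  assumes "cover p0 p1 (Dom C f)" "f \<in> Arr C" "w \<in> \<D>"
    "sub_le C (f \<cdot> p0) w" "sub_le C (f \<cdot> p1) w"
  shows "sub_le C f w"
proof -
  note cD = coverD[OF assms(1)]
  have c: "Cod C f = Cod C w" using assms(2,4) cD by (auto elim: sub_leE)
  obtain p q where p: "is_pullback C f w p q" "p \<in> \<D>" "Cod C p = Dom C f"
    using dist_pullbackE[OF assms(3,2) c] by metis
  have "sub_le C p0 p" "sub_le C p1 p" using pullback_le_iff[OF p(1)] cD assms by auto
  then have "sub_le C (Id C (Dom C f)) p" using union_least[OF cD(5)] dist_mono[OF p(2)] by blast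
  then show ?thesis using pullback_le_iff[OF p(1), of "Id C (Dom C f)"] assms by simp
qed

end

context pretorsion_theory
begin

abbreviation triv :: "'a \<Rightarrow> bool" where
  "triv \<equiv> trivial_arr C \<T> \<F>"

lemma trivial_obj [simp]: "Z \<in> \<T> \<inter> \<F> \<Longrightarrow> Z \<in> Obj C" "Z \<in> \<T> \<Longrightarrow> Z \<in> Obj C" "Z \<in> \<F> \<Longrightarrow> Z \<in> Obj C"
  using torsion_subset torsionfree_subset by auto

lemmas trivE = trivial_arrE[where \<T> = \<T> and \<F> = \<F>]
lemmas trivI = trivial_arrI[where \<T> = \<T> and \<F> = \<F>]
lemmas triv_comp_right = trivial_arr_comp_right[where \<T> = \<T> and \<F> = \<F>]
lemmas triv_comp_left = trivial_arr_comp_left[where \<T> = \<T> and \<F> = \<F>]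

lemma triv_to: "\<lbrakk>f \<in> Arr C; Cod C f \<in> \<T> \<inter> \<F>\<rbrakk> \<Longrightarrow> triv f"
  by (rule trivI[of f "Id C (Cod C f)" f "Cod C f"]) auto

lemma triv_from: "\<lbrakk>f \<in> Arr C; Dom C f \<in> \<T> \<inter> \<F>\<rbrakk> \<Longrightarrow> triv f"
  by (rule trivI[of f f "Id C (Dom C f)" "Dom C f"]) auto

end

section \<open>Locality and reflection of triviality\<close>

context compatible
begin

lemma triv_local:
  assumes "cover p0 p1 (Dom C f)" "f \<in> Arr C" "triv (f \<cdot> p0)" "triv (f \<cdot> p1)"
  shows "triv f"
proof -
  note cD = coverD[OF assms(1)]
  show ?thesis
    by (rule CC2[OF cD(1,2,5), of p0 p1 f "Cod C f"]) (use assms cD in auto)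
qed

text \<open>If \<open>s \<cdot> x\<close> factors as \<open>h \<cdot> g\<close> through a trivial
  \<open>Z\<close>, then \<open>x\<close> factors through the pullback of \<open>s\<close> along
  \<open>h\<close>, whose domain is a distinguished subobject of \<open>Z\<close> and so trivial by
  \<open>CC1\<close>.\<close>

lemma dist_reflects_triv:
  assumes "s \<in> \<D>" "triv (s \<cdot> x)" "x \<in> Arr C" "Cod C x = Dom C s"
  shows "triv x"
proof -
  obtain Z g h where *: "Z \<in> \<T> \<inter> \<F>" "g \<in> Arr C" "Dom C g = Dom C x" "Cod C g = Z"
    "h \<in> Arr C" "Dom C h = Z" "Cod C h = Cod C s" "h \<cdot> g = s \<cdot> x"
    using trivE[OF assms(2)] assms by (metis comp_arr(2,3) dist_arr)
  obtain p q where p: "is_pullback C h s p q" "p \<in> \<D>" "Cod C p = Z" "q \<in> Arr C"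
    "Dom C q = Dom C p" "Cod C q = Dom C s"
    using dist_pullbackE[OF assms(1) *(5,7)] *(6) by metis
  obtain k where k: "k \<in> Arr C" "Cod C k = Dom C p" "q \<cdot> k = x"
    using pullback_univ[OF p(1) *(8)] * assms by metis
  have "Dom C p \<in> \<T> \<inter> \<F>" using CC1[of p] p * by simp
  then show ?thesis by (intro trivI[of x q k "Dom C p"]) (use k p in simp_all)
qed

text \<open>A canonical sequence contains a trivial composite, so some trivial object exists; the
  initial object is distinguished in it and \<open>CC1\<close> applies.\<close>

lemma zero_trivial: "zero \<in> \<T> \<inter> \<F>"
proof -
  obtain k q where "canonical_seq C \<T> \<F> zero k q" using PT2[of zero] by auto
  then have "triv (q \<cdot> k)" by (simp add: canonical_seq_def short_zexact_def is_zkernel_def)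
  then obtain Z where "Z \<in> \<T> \<inter> \<F>" by (auto elim: trivE)
  then show ?thesis using CC1[OF CS1_zero[of Z]] by auto
qed

text \<open>The projection \<open>q\<close> of the pullback of \<open>r\<close> and \<open>s\<close>
  is the universal \<open>y\<close> for which \<open>s \<cdot> y\<close> lies in
  \<open>r\<close>.\<close>

lemma trivial_on_inter_iff:
  assumes "r \<in> \<D>" "s \<in> \<D>" "Cod C r = Cod C s" "f \<in> Arr C" "Dom C f = Dom C s"
  shows "trivial_on_inter C \<T> \<F> r s f \<longleftrightarrow>
    (\<forall>y \<in> Arr C. Cod C y = Dom C s \<and> sub_le C (s \<cdot> y) r \<longrightarrow> triv (f \<cdot> y))"
proof
  assume "trivial_on_inter C \<T> \<F> r s f"
  then obtain p q where pq: "is_pullback C r s p q" "triv (f \<cdot> q)"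
    by (auto simp: trivial_on_inter_def)
  note pb = pullbackD[OF pq(1)]
  show "\<forall>y \<in> Arr C. Cod C y = Dom C s \<and> sub_le C (s \<cdot> y) r \<longrightarrow> triv (f \<cdot> y)"
  proof (intro ballI impI)
    fix y assume y: "y \<in> Arr C" "Cod C y = Dom C s \<and> sub_le C (s \<cdot> y) r"
    then obtain h where h: "h \<in> Arr C" "Cod C h = Dom C r" "r \<cdot> h = s \<cdot> y" by (blast elim: sub_leE)
    obtain k where k: "k \<in> Arr C" "Cod C k = Dom C p" "q \<cdot> k = y"
      using pullback_univ[OF pq(1) h(3)] h y by metis
    have "triv ((f \<cdot> q) \<cdot> k)" by (rule triv_comp_right[OF pq(2)]) (use k pb assms in simp_all)
    then show "triv (f \<cdot> y)" using k pb assms by simp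
  qed
next
  assume *: "\<forall>y \<in> Arr C. Cod C y = Dom C s \<and> sub_le C (s \<cdot> y) r \<longrightarrow> triv (f \<cdot> y)"
  obtain p q where p: "is_pullback C r s p q" using dist_pullbackE[OF assms(2) _ assms(3)] dist_arr[OF assms(1)] by metis
  note pb = pullbackD[OF p]
  have "sub_le C (s \<cdot> q) r" by (rule sub_leI[of r p]) (use pb in simp_all)
  then show "trivial_on_inter C \<T> \<F> r s f" using * p pb unfolding trivial_on_inter_def by blast
qed

section \<open>Equivalence of partial morphisms\<close>

text \<open>Elementwise form of \<open>trivial_on_inter\<close>. It mentions no pullback, so it
  combines well with splitting \<open>y\<close> along a cover.\<close>

definition triv_on :: "'a \<Rightarrow> 'a \<Rightarrow> 'a \<Rightarrow> bool" where
  "triv_on r s f \<longleftrightarrow> (\<forall>y \<in> Arr C. Cod C y = Dom C s \<and> sub_le C (s \<cdot> y) r \<longrightarrow> triv (f \<cdot> y))"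

lemma triv_onD:
  "\<lbrakk>triv_on r s f; y \<in> Arr C; Cod C y = Dom C s; sub_le C (s \<cdot> y) r\<rbrakk> \<Longrightarrow> triv (f \<cdot> y)"
  by (simp add: triv_on_def)

lemma triv_onI:
  "(\<And>y. \<lbrakk>y \<in> Arr C; Cod C y = Dom C s; sub_le C (s \<cdot> y) r\<rbrakk> \<Longrightarrow> triv (f \<cdot> y)) \<Longrightarrow> triv_on r s f"
  by (simp add: triv_on_def)

section \<open>Triples and the witnesses of their equivalence\<close>

abbreviation DP :: "'o \<Rightarrow> 'o \<Rightarrow> ('a \<times> 'a \<times> 'a) set" where
  "DP \<equiv> dispar C \<T> \<F> \<D>"

abbreviation SR :: "'o \<Rightarrow> 'o \<Rightarrow> (('a \<times> 'a \<times> 'a) \<times> ('a \<times> 'a \<times> 'a)) set" where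
  "SR \<equiv> stab_rel C \<T> \<F> \<D>"

lemma dispar_iff:
  "(s0, s1, f) \<in> DP A B \<longleftrightarrow>
    cover s0 s1 A \<and> f \<in> Arr C \<and> Dom C f = Dom C s1 \<and> Cod C f = B \<and> triv_on s0 s1 f"
  using trivial_on_inter_iff[of s0 s1 f]
  by (auto simp: dispar_def cover_def triv_on_def)

text \<open>The pair \<open>(u0, u1)\<close>, with inclusions \<open>i\<close>, \<open>j\<close> of \<open>u1\<close> into \<open>s\<close>, \<open>t\<close>, witnesses the equivalence
  of triples \<open>(_, s, f)\<close> and \<open>(_, t, g)\<close>.\<close>

definition agree :: "'a \<Rightarrow> 'a \<Rightarrow> 'a \<Rightarrow> 'a \<Rightarrow> 'a \<Rightarrow> 'a \<Rightarrow> 'a \<Rightarrow> 'a \<Rightarrow> bool" where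
  "agree u0 u1 i j s f t g \<longleftrightarrow>
    cover u0 u1 (Cod C s) \<and> i \<in> Arr C \<and> Dom C i = Dom C u1 \<and> Cod C i = Dom C s \<and> s \<cdot> i = u1 \<and>
    j \<in> Arr C \<and> Dom C j = Dom C u1 \<and> Cod C j = Dom C t \<and> t \<cdot> j = u1 \<and> f \<cdot> i = g \<cdot> j \<and>
    triv_on u0 s f \<and> triv_on u0 t g"

lemma agreeD:
  assumes "agree u0 u1 i j s f t g"
  shows "cover u0 u1 (Cod C s)" "i \<in> Arr C" "Dom C i = Dom C u1" "Cod C i = Dom C s" "s \<cdot> i = u1"
    "j \<in> Arr C" "Dom C j = Dom C u1" "Cod C j = Dom C t" "t \<cdot> j = u1" "f \<cdot> i = g \<cdot> j"
    "triv_on u0 s f" "triv_on u0 t g"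
  using assms unfolding agree_def by blast+

lemma agree_sym:
  assumes "agree u0 u1 i j s f t g" "Cod C s = Cod C t"
  shows "agree u0 u1 j i t g s f"
  using agreeD[OF assms(1)] assms(2) unfolding agree_def by simp

lemma stab_rel_iff:
  "((s0, s1, f), (t0, t1, g)) \<in> SR A B \<longleftrightarrow>
    (s0, s1, f) \<in> DP A B \<and> (t0, t1, g) \<in> DP A B \<and> (\<exists>u0 u1 i j. agree u0 u1 i j s1 f t1 g)"
proof (cases "(s0, s1, f) \<in> DP A B \<and> (t0, t1, g) \<in> DP A B")
  case True
  then have s: "s1 \<in> \<D>" "Cod C s1 = A" "f \<in> Arr C" "Dom C f = Dom C s1"
    and t: "t1 \<in> \<D>" "Cod C t1 = A" "g \<in> Arr C" "Dom C g = Dom C t1"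
    by (auto simp: dispar_iff cover_def)
  have *: "trivial_on_inter C \<T> \<F> u0 s1 f \<longleftrightarrow> triv_on u0 s1 f"
    "trivial_on_inter C \<T> \<F> u0 t1 g \<longleftrightarrow> triv_on u0 t1 g"
    if "u0 \<in> \<D>" "Cod C u0 = A" for u0
    unfolding triv_on_def using that s t trivial_on_inter_iff by simp_all
  show ?thesis
    unfolding stab_rel_def agree_def cover_def
    using True s t by (auto simp: * cong: conj_cong)
next
  case False
  then show ?thesis by (auto simp: stab_rel_def)
qed

text \<open>An element \<open>y\<close> over \<open>v\<close> is split along \<open>u0\<close> and
  \<open>u1\<close>. On the first part \<open>f\<close> is trivial by assumption; on the second it
  agrees with \<open>g\<close>, which is trivial over \<open>v\<close>. This serves for transitivity
  and for the invariance of triviality under the equivalence.\<close>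

lemma triv_on_transfer:
  assumes "agree u0 u1 i j s f t g" "triv_on v t g" "s \<in> \<D>" "t \<in> \<D>"
    "f \<in> Arr C" "Dom C f = Dom C s" "g \<in> Arr C" "Dom C g = Dom C t" "v \<in> \<D>"
  shows "triv_on v s f"
proof (rule triv_onI)
  note ag = agreeD[OF assms(1)]
  fix y assume y: "y \<in> Arr C" "Cod C y = Dom C s" "sub_le C (s \<cdot> y) v"
  obtain p0 p1 where p: "cover p0 p1 (Dom C y)" "sub_le C ((s \<cdot> y) \<cdot> p0) u0"
    "sub_le C ((s \<cdot> y) \<cdot> p1) u1"
    using cover_split[OF ag(1), of "s \<cdot> y"] y assms by auto
  note pD = coverD[OF p(1)]
  show "triv (f \<cdot> y)"
  proof (rule triv_local)
    show "cover p0 p1 (Dom C (f \<cdot> y))" "f \<cdot> y \<in> Arr C" using p y assms by simp_all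
    show "triv ((f \<cdot> y) \<cdot> p0)"
      using triv_onD[OF ag(11), of "y \<cdot> p0"] p(2) pD y assms by simp
    have u1: "u1 \<in> Arr C" "Cod C u1 = Cod C s" using ag(1) by (simp_all add: cover_def)
    obtain b where b: "b \<in> Arr C" "Cod C b = Dom C u1" "u1 \<cdot> b = (s \<cdot> y) \<cdot> p1"
      using p(3) by (blast elim: sub_leE)
    have ib: "i \<cdot> b = y \<cdot> p1"
      using mono_arrD[OF dist_mono[OF assms(3)], of "i \<cdot> b" "y \<cdot> p1"] comp_assoc_eq[OF ag(5), of b]
        b ag(2-4) y pD assms by simp
    have e: "f \<cdot> (y \<cdot> p1) = g \<cdot> (j \<cdot> b)"
      using comp_assoc_eq2[OF ag(10), of b] ib b ag(2-9) assms by simp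
    have tb: "t \<cdot> (j \<cdot> b) = (s \<cdot> y) \<cdot> p1"
      using comp_assoc_eq[OF ag(9), of b] b ag(2-9) assms by simp
    have "sub_le C ((s \<cdot> y) \<cdot> p1) v" using sub_le_comp_right[OF y(3)] pD y assms by simp
    then have "triv (g \<cdot> (j \<cdot> b))"
      using triv_onD[OF assms(2), of "j \<cdot> b"] tb b ag(2-9) assms by simp
    then show "triv ((f \<cdot> y) \<cdot> p1)" using e pD y assms by simp
  qed
qed

lemma triv_on_union:
  assumes "is_union C u v w" "u \<in> \<D>" "v \<in> \<D>" "Cod C s = Cod C u" "triv_on u s f" "triv_on v s f"
    "s \<in> \<D>" "f \<in> Arr C" "Dom C f = Dom C s"
  shows "triv_on w s f"
proof (rule triv_onI)
  fix y assume y: "y \<in> Arr C" "Cod C y = Dom C s" "sub_le C (s \<cdot> y) w"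
  obtain p0 p1 where p: "cover p0 p1 (Dom C y)" "sub_le C ((s \<cdot> y) \<cdot> p0) u"
    "sub_le C ((s \<cdot> y) \<cdot> p1) v"
    using local_split[OF assms(1,2,3) y(3)] y assms by auto
  note pD = coverD[OF p(1)]
  show "triv (f \<cdot> y)"
    by (rule triv_local[of p0 p1])
      (use p pD y assms triv_onD[OF assms(5), of "y \<cdot> p0"] triv_onD[OF assms(6), of "y \<cdot> p1"]
        in simp_all)
qed

text \<open>A distributive law for two covers: \<open>u1\<close> splits into a part in
  \<open>v0\<close> and a part in \<open>v1\<close>, and the latter lies in the intersection
  \<open>u1 \<cdot> p\<close>.\<close>

lemma cover_trans:
  assumes "cover u0 u1 A" "cover v0 v1 A" "is_pullback C u1 v1 p q" "is_union C u0 v0 w0"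
  shows "cover w0 (u1 \<cdot> p) A"
proof (rule coverI)
  note u = coverD[OF assms(1)] and v = coverD[OF assms(2)] and pb = pullbackD[OF assms(3)]
  note un = unionD[OF assms(4)]
  have p: "p \<in> \<D>" by (rule pullback_dist[OF assms(3) v(2)])
  show "w0 \<in> \<D>" by (rule union_dist[OF assms(4) u(1) v(1)])
  show "u1 \<cdot> p \<in> \<D>" using dist_comp p u pb by blast
  show "Cod C w0 = A" "Cod C (u1 \<cdot> p) = A" using un u pb by simp_all
  fix w assume w: "w \<in> \<D>" "Cod C w = A" "sub_le C w0 w" "sub_le C (u1 \<cdot> p) w"
  have uw: "sub_le C u0 w" "sub_le C v0 w" using sub_le_trans un w dist_arr by blast+
  obtain p0 p1 where p': "cover p0 p1 (Dom C u1)" "sub_le C (u1 \<cdot> p0) v0" "sub_le C (u1 \<cdot> p1) v1"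
    using cover_split[OF assms(2), of u1] u by auto
  note pD = coverD[OF p'(1)]
  have "sub_le C p1 p" using pullback_le_iff[OF assms(3)] pD p' by simp
  then have "sub_le C (u1 \<cdot> p1) (u1 \<cdot> p)" using sub_le_comp_left[OF _ pb(3,1,7)] by blast
  then have "sub_le C (u1 \<cdot> p1) w" using sub_le_trans w pb by auto
  moreover have "sub_le C (u1 \<cdot> p0) w" using sub_le_trans[OF p'(2) uw(2)] w v by auto
  ultimately have "sub_le C u1 w" using le_local[OF p'(1) _ w(1)] u by auto
  then show "sub_le C (Id C A) w" using union_least[OF u(5)] uw dist_mono[OF w(1)] by blast
qed

text \<open>The witness is the union of \<open>u0\<close> and \<open>v0\<close> together with the
  intersection of \<open>u1\<close> and \<open>v1\<close>. Triviality of \<open>f\<close> on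
  \<open>v0\<close> and of \<open>h\<close> on \<open>u0\<close> is transported along the two given
  equivalences.\<close>

lemma agree_trans:
  assumes "agree u0 u1 i j s f t g" "agree v0 v1 k l t g r h" "s \<in> \<D>" "t \<in> \<D>" "r \<in> \<D>"
    "Cod C s = Cod C t" "Cod C r = Cod C t"
    "f \<in> Arr C" "Dom C f = Dom C s" "g \<in> Arr C" "Dom C g = Dom C t" "h \<in> Arr C" "Dom C h = Dom C r"
  shows "\<exists>w0 w1 m n. agree w0 w1 m n s f r h"
proof -
  note a = agreeD[OF assms(1)] and b = agreeD[OF assms(2)]
  have b1: "cover v0 v1 (Cod C s)" using b(1) assms by simp
  note u = coverD[OF a(1)] and v = coverD[OF b1]
  obtain w0 where w0: "w0 \<in> \<D>" "is_union C u0 v0 w0" using CS2[OF u(1) v(1)] u v by auto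
  obtain p q where p: "is_pullback C u1 v1 p q" using CS3[OF v(2), of u1] u v by auto
  note pb = pullbackD[OF p]
  have jk: "j \<cdot> p = k \<cdot> q"
    using mono_arrD[OF dist_mono[OF assms(4)], of "j \<cdot> p" "k \<cdot> q"]
      comp_assoc_eq[OF a(9), of p] comp_assoc_eq[OF b(5), of q] a(2-9) b(2-9) pb assms by simp
  have "f \<cdot> (i \<cdot> p) = h \<cdot> (l \<cdot> q)"
    using comp_assoc_eq2[OF a(10), of p] comp_assoc_eq2[OF b(10), of q] jk
      a(2-9) b(2-9) pb assms by simp
  moreover have "s \<cdot> (i \<cdot> p) = u1 \<cdot> p" "r \<cdot> (l \<cdot> q) = u1 \<cdot> p"
    using comp_assoc_eq[OF a(5), of p] comp_assoc_eq[OF b(9), of q] a(2-9) b(2-9) pb assms by simp_all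
  moreover have "triv_on v0 s f" by (rule triv_on_transfer[OF assms(1) b(11)]) (use assms v in simp_all)
  then have "triv_on w0 s f"
    by (intro triv_on_union[OF w0(2)]) (use u v a(11) assms in simp_all)
  moreover have "triv_on u0 r h"
    by (rule triv_on_transfer[OF agree_sym[OF assms(2)] a(12)]) (use assms u in simp_all)
  then have "triv_on w0 r h"
    by (intro triv_on_union[OF w0(2)]) (use u v b(12) assms in simp_all)
  moreover have "cover w0 (u1 \<cdot> p) (Cod C s)" by (rule cover_trans[OF a(1) b1 p w0(2)])
  ultimately have "agree w0 (u1 \<cdot> p) (i \<cdot> p) (l \<cdot> q) s f r h"
    unfolding agree_def using a(2-9) b(2-9) pb assms by simp
  then show ?thesis by blast
qed

text \<open>The smaller pair \<open>(s0, s1)\<close> itself is the witness, since \<open>g\<close>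
  is trivial on \<open>t0\<close> and a fortiori on \<open>s0\<close>. This criterion yields
  reflexivity of the equivalence and associativity of composition.\<close>

lemma rel_of_le:
  assumes "(s0, s1, f) \<in> DP A B" "(t0, t1, g) \<in> DP A B" "sub_le C s0 t0"
    "j \<in> Arr C" "Dom C j = Dom C s1" "Cod C j = Dom C t1" "t1 \<cdot> j = s1" "g \<cdot> j = f"
  shows "((s0, s1, f), (t0, t1, g)) \<in> SR A B"
proof -
  have s: "cover s0 s1 A" "f \<in> Arr C" "Dom C f = Dom C s1" "triv_on s0 s1 f"
    and t: "cover t0 t1 A" "g \<in> Arr C" "Dom C g = Dom C t1" "triv_on t0 t1 g"
    using assms by (auto simp: dispar_iff)
  note sD = coverD[OF s(1)] and tD = coverD[OF t(1)]
  have "triv_on s0 t1 g"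
  proof (rule triv_onI)
    fix y assume y: "y \<in> Arr C" "Cod C y = Dom C t1" "sub_le C (t1 \<cdot> y) s0"
    show "triv (g \<cdot> y)"
      by (rule triv_onD[OF t(4) y(1,2) sub_le_trans[OF y(3) assms(3)]]) (use sD tD in simp_all)
  qed
  then have "agree s0 s1 (Id C (Dom C s1)) j s1 f t1 g"
    unfolding agree_def using s sD tD assms by simp
  then show ?thesis using assms(1,2) stab_rel_iff by blast
qed

lemma SR_equiv: "equiv (DP A B) (SR A B)"
proof (rule equivI)
  show "SR A B \<subseteq> DP A B \<times> DP A B" by (auto simp: stab_rel_def)
  show "refl_on (DP A B) (SR A B)"
  proof (rule refl_onI)
    fix x assume x: "x \<in> DP A B"
    obtain s0 s1 f where [simp]: "x = (s0, s1, f)" by (cases x)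
    have "cover s0 s1 A" "f \<in> Arr C" "Dom C f = Dom C s1" using x by (simp_all add: dispar_iff)
    then show "(x, x) \<in> SR A B"
      using rel_of_le[of s0 s1 f A B s0 s1 f "Id C (Dom C s1)"] x coverD[of s0 s1 A] sub_le_refl
      by auto
  qed
  show "sym (SR A B)"
  proof (rule symI)
    fix x y assume xy: "(x, y) \<in> SR A B"
    obtain s0 s1 f t0 t1 g where [simp]: "x = (s0, s1, f)" "y = (t0, t1, g)" by (cases x, cases y)
    obtain u0 u1 i j where a: "agree u0 u1 i j s1 f t1 g" using xy by (auto simp: stab_rel_iff)
    have "Cod C s1 = Cod C t1" using xy by (simp add: stab_rel_iff dispar_iff cover_def)
    from agree_sym[OF a this] show "(y, x) \<in> SR A B" using xy by (auto simp: stab_rel_iff)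
  qed
  show "trans (SR A B)"
  proof (rule transI)
    fix x y z assume xy: "(x, y) \<in> SR A B" and yz: "(y, z) \<in> SR A B"
    obtain s0 s1 f t0 t1 g r0 r1 h where [simp]: "x = (s0, s1, f)" "y = (t0, t1, g)" "z = (r0, r1, h)"
      by (cases x, cases y, cases z)
    obtain u0 u1 i j where a: "agree u0 u1 i j s1 f t1 g" using xy by (auto simp: stab_rel_iff)
    obtain v0 v1 k l where b: "agree v0 v1 k l t1 g r1 h" using yz by (auto simp: stab_rel_iff)
    have "(s0, s1, f) \<in> DP A B" "(t0, t1, g) \<in> DP A B" "(r0, r1, h) \<in> DP A B"
      using xy yz by (simp_all add: stab_rel_iff)
    then show "(x, z) \<in> SR A B"
      using agree_trans[OF a b] by (simp add: stab_rel_iff dispar_iff cover_def)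
  qed
qed

section \<open>Composition of partial morphisms\<close>

text \<open>The pullback of the identity along \<open>e\<close> is again the identity, so
  \<open>CS4\<close> applies.\<close>

lemma cover_pullback:
  assumes "cover v0 v1 B" "is_pullback C e v0 p0 f0" "is_pullback C e v1 p1 f1"
  shows "cover p0 p1 (Dom C e)"
proof -
  note v = coverD[OF assms(1)] and pb0 = pullbackD[OF assms(2)] and pb1 = pullbackD[OF assms(3)]
  have "is_pullback C e (Id C B) (Id C (Dom C e)) e" using pullback_id[of e B] pb0 v by simp
  then have "is_union C p0 p1 (Id C (Dom C e))" using CS4[OF v(1,2,5) assms(2,3)] by blast
  then show ?thesis
    using pullback_dist[OF assms(2) v(1)] pullback_dist[OF assms(3) v(2)] pb0 pb1
    by (simp add: cover_def)
qed

text \<open>The arrow \<open>e\<close> is kept general: for a composite of triples it is the arrow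
  \<open>f\<close> of the first one, for the congruence proof the common restriction of two
  equivalent arrows. As \<open>p0\<close> and \<open>p1\<close> cover the domain of
  \<open>u1\<close>, being below \<open>w\<close> can be checked on them.\<close>

lemma comp_cover:
  assumes "cover u0 u1 A" "cover v0 v1 B" "Dom C e = Dom C u1"
    "is_pullback C e v0 p0 f0" "is_pullback C e v1 p1 f1" "is_union C u0 (u1 \<cdot> p0) w0"
  shows "cover w0 (u1 \<cdot> p1) A"
proof (rule coverI)
  note u = coverD[OF assms(1)] and v = coverD[OF assms(2)]
    and pb0 = pullbackD[OF assms(4)] and pb1 = pullbackD[OF assms(5)] and un = unionD[OF assms(6)]
  have p: "cover p0 p1 (Dom C u1)" using cover_pullback[OF assms(2,4,5)] assms(3) by simp
  note pD = coverD[OF p]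
  show w0: "w0 \<in> \<D>" by (rule union_dist[OF assms(6)]) (use u pD dist_comp in simp_all)
  show "u1 \<cdot> p1 \<in> \<D>" using dist_comp u pD by simp
  show "Cod C w0 = A" "Cod C (u1 \<cdot> p1) = A" using un u pD by simp_all
  fix w assume w: "w \<in> \<D>" "Cod C w = A" "sub_le C w0 w" "sub_le C (u1 \<cdot> p1) w"
  have "sub_le C u0 w" "sub_le C (u1 \<cdot> p0) w" using sub_le_trans un w dist_arr by blast+
  moreover have "sub_le C u1 w" by (rule le_local[OF p]) (use u w calculation in simp_all)
  ultimately show "sub_le C (Id C A) w" using union_least[OF u(5)] dist_mono[OF w(1)] by blast
qed

text \<open>An element of \<open>w\<close> splits into two parts. Over \<open>u\<close> the arrow
  \<open>f\<close> is trivial, and since \<open>t\<close> reflects triviality so is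
  \<open>f1\<close>. The other part is sent by \<open>f\<close> into \<open>v\<close>, where
  \<open>g\<close> is trivial. The arrow \<open>i\<close> is the identity for composites of triples,
  and the inclusion of a witness for the congruence.\<close>

lemma comp_triv_on:
  assumes "is_pullback C f t p1 f1" "is_pullback C (f \<cdot> i) v p0 f0" "is_union C u (s \<cdot> (i \<cdot> p0)) w"
    "u \<in> \<D>" "s \<cdot> (i \<cdot> p0) \<in> \<D>" "s \<in> \<D>" "t \<in> \<D>" "i \<in> Arr C" "Cod C i = Dom C s"
    "Dom C f = Dom C s" "g \<in> Arr C" "Dom C g = Dom C t" "triv_on u s f" "triv_on v t g"
  shows "triv_on w (s \<cdot> p1) (g \<cdot> f1)"
proof (rule triv_onI)
  note pb1 = pullbackD[OF assms(1)] and pb0 = pullbackD[OF assms(2)]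
  fix y assume y: "y \<in> Arr C" "Cod C y = Dom C (s \<cdot> p1)" "sub_le C ((s \<cdot> p1) \<cdot> y) w"
  have y': "Cod C y = Dom C p1" using y pb1 assms by simp
  obtain q0 q1 where q: "cover q0 q1 (Dom C y)" "sub_le C (((s \<cdot> p1) \<cdot> y) \<cdot> q0) u"
    "sub_le C (((s \<cdot> p1) \<cdot> y) \<cdot> q1) (s \<cdot> (i \<cdot> p0))"
    using local_split[OF assms(3-5) y(3)] y y' assms pb1 by auto
  note qD = coverD[OF q(1)]
  show "triv ((g \<cdot> f1) \<cdot> y)"
  proof (rule triv_local)
    show "cover q0 q1 (Dom C ((g \<cdot> f1) \<cdot> y))" "(g \<cdot> f1) \<cdot> y \<in> Arr C"
      using q y y' pb1 assms by simp_all
    have sq: "f \<cdot> (p1 \<cdot> (y \<cdot> q)) = t \<cdot> (f1 \<cdot> (y \<cdot> q))" if "q \<in> \<D>" "Cod C q = Dom C y" for q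
      using comp_assoc_eq2[OF pb1(9), of "y \<cdot> q"] that y y' pb1 by simp
    have "triv (f \<cdot> (p1 \<cdot> (y \<cdot> q0)))"
      using triv_onD[OF assms(13), of "p1 \<cdot> (y \<cdot> q0)"] q(2) qD y y' pb1 assms by simp
    then have "triv (f1 \<cdot> (y \<cdot> q0))"
      using dist_reflects_triv[OF assms(7), of "f1 \<cdot> (y \<cdot> q0)"] sq qD y y' pb1 by simp
    then have "triv (g \<cdot> (f1 \<cdot> (y \<cdot> q0)))"
      using triv_comp_left[of "f1 \<cdot> (y \<cdot> q0)" g] assms qD y y' pb1 by simp
    then show "triv (((g \<cdot> f1) \<cdot> y) \<cdot> q0)" using assms qD y y' pb1 by simp
    have "sub_le C (s \<cdot> (p1 \<cdot> (y \<cdot> q1))) (s \<cdot> (i \<cdot> p0))"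
      using q(3) qD y y' pb1 assms by simp
    then have "sub_le C (p1 \<cdot> (y \<cdot> q1)) (i \<cdot> p0)"
      using sub_le_comp_mono[of s "p1 \<cdot> (y \<cdot> q1)" "i \<cdot> p0"] dist_mono qD y y' pb0 pb1 assms by simp
    then obtain c where c: "c \<in> Arr C" "Dom C c = Dom C (p1 \<cdot> (y \<cdot> q1))" "Cod C c = Dom C (i \<cdot> p0)"
      "(i \<cdot> p0) \<cdot> c = p1 \<cdot> (y \<cdot> q1)" by (blast elim: sub_leE)
    have "f \<cdot> (p1 \<cdot> (y \<cdot> q1)) = v \<cdot> (f0 \<cdot> c)"
      using comp_assoc_eq2[OF pb0(9), of c] c pb0 pb1 assms by simp
    then have "sub_le C (t \<cdot> (f1 \<cdot> (y \<cdot> q1))) v"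
      using sub_leI[of v "f0 \<cdot> c"] sq c qD y pb0 pb1 assms by simp
    then show "triv (((g \<cdot> f1) \<cdot> y) \<cdot> q1)"
      using triv_onD[OF assms(14), of "f1 \<cdot> (y \<cdot> q1)"] assms qD y y' pb1 by simp
  qed
qed

lemma composite_ex:
  assumes "x \<in> DP A B" "y \<in> DP B D"
  shows "\<exists>z. dispar_composite C y x z"
proof -
  obtain s0 s1 f t0 t1 g where [simp]: "x = (s0, s1, f)" "y = (t0, t1, g)" by (cases x, cases y)
  have s: "cover s0 s1 A" "f \<in> Arr C" "Dom C f = Dom C s1" "Cod C f = B" and t: "cover t0 t1 B"
    using assms by (simp_all add: dispar_iff)
  note sD = coverD[OF s(1)] and tD = coverD[OF t]
  obtain p0 f0 where p0: "is_pullback C f t0 p0 f0" "p0 \<in> \<D>" using CS3[OF tD(1) s(2)] s tD by auto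
  obtain p1 f1 where p1: "is_pullback C f t1 p1 f1" using CS3[OF tD(2) s(2)] s tD by auto
  have c: "Cod C p0 = Dom C s1" using pullbackD[OF p0(1)] s by simp
  then have "s1 \<cdot> p0 \<in> \<D>" using dist_comp p0 sD by simp
  then obtain r0 where "is_union C s0 (s1 \<cdot> p0) r0" using CS2[OF sD(1), of "s1 \<cdot> p0"] sD p0 c by auto
  then have "dispar_composite C y x (r0, s1 \<cdot> p1, g \<cdot> f1)" using p0 p1 by auto
  then show ?thesis by blast
qed

lemma composite_DP:
  assumes "x \<in> DP A B" "y \<in> DP B D" "dispar_composite C y x z"
  shows "z \<in> DP A D"
proof -
  obtain s0 s1 f t0 t1 g r0 r1 h where [simp]: "x = (s0, s1, f)" "y = (t0, t1, g)" "z = (r0, r1, h)"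
    by (cases x, cases y, cases z)
  have s: "cover s0 s1 A" "f \<in> Arr C" "Dom C f = Dom C s1" "Cod C f = B" "triv_on s0 s1 f"
    and t: "cover t0 t1 B" "g \<in> Arr C" "Dom C g = Dom C t1" "Cod C g = D" "triv_on t0 t1 g"
    using assms by (simp_all add: dispar_iff)
  note sD = coverD[OF s(1)] and tD = coverD[OF t(1)]
  obtain p0 f0 p1 f1 where p: "is_pullback C f t0 p0 f0" "is_pullback C f t1 p1 f1"
    "is_union C s0 (s1 \<cdot> p0) r0" and [simp]: "r1 = s1 \<cdot> p1" "h = g \<cdot> f1"
    using assms(3) by auto
  note pb0 = pullbackD[OF p(1)] and pb1 = pullbackD[OF p(2)]
  have "cover r0 (s1 \<cdot> p1) A" by (rule comp_cover[OF s(1) t(1) s(3) p])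
  moreover have e: "f \<cdot> Id C (Dom C s1) = f" "Id C (Dom C s1) \<cdot> p0 = p0" "s1 \<cdot> p0 \<in> \<D>"
    using s sD pb0 dist_comp pullback_dist[OF p(1) tD(1)] by simp_all
  have "triv_on r0 (s1 \<cdot> p1) (g \<cdot> f1)"
    by (rule comp_triv_on[where i = "Id C (Dom C s1)" and u = s0 and s = s1 and v = t0
          and ?p0.0 = p0 and ?f0.0 = f0 and f = f and t = t1])
      (use p s sD t tD e in simp_all)
  ultimately show ?thesis using s t pb1 sD by (simp add: dispar_iff)
qed

text \<open>With \<open>P0\<close>, \<open>P1\<close> the inverse images of \<open>v0\<close>,
  \<open>v1\<close> along the common restriction \<open>f \<cdot> i = f' \<cdot> j\<close>, the
  witness consists of the union \<open>w0\<close> of \<open>u0\<close> and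
  \<open>u1 \<cdot> P0\<close>, and of \<open>u1 \<cdot> P1\<close>.\<close>

lemma composite_cong:
  assumes "(x, x') \<in> SR A B" "(y, y') \<in> SR B D" "dispar_composite C y x z" "dispar_composite C y' x' z'"
  shows "(z, z') \<in> SR A D"
proof -
  obtain s0 s f t0 t g r0 r h where [simp]: "x = (s0, s, f)" "y = (t0, t, g)" "z = (r0, r, h)"
    by (cases x, cases y, cases z)
  obtain s0' s' f' t0' t' g' r0' r' h'
    where [simp]: "x' = (s0', s', f')" "y' = (t0', t', g')" "z' = (r0', r', h')"
    by (cases x', cases y', cases z')
  have DP: "x \<in> DP A B" "x' \<in> DP A B" "y \<in> DP B D" "y' \<in> DP B D"
    using assms(1,2) by (auto simp: stab_rel_iff)
  then have s: "s \<in> \<D>" "Cod C s = A" "f \<in> Arr C" "Dom C f = Dom C s" "Cod C f = B"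
    and s': "s' \<in> \<D>" "Cod C s' = A" "f' \<in> Arr C" "Dom C f' = Dom C s'" "Cod C f' = B"
    and t: "t \<in> \<D>" "Cod C t = B" "g \<in> Arr C" "Dom C g = Dom C t" "Cod C g = D"
    and t': "t' \<in> \<D>" "Cod C t' = B" "g' \<in> Arr C" "Dom C g' = Dom C t'" "Cod C g' = D"
    by (auto simp: dispar_iff dest: coverD)
  obtain u0 u1 i j where a: "agree u0 u1 i j s f s' f'" using assms(1) by (auto simp: stab_rel_iff)
  obtain v0 v1 k l where b: "agree v0 v1 k l t g t' g'" using assms(2) by (auto simp: stab_rel_iff)
  note aD = agreeD[OF a] and bD = agreeD[OF b]
  note u = coverD[OF aD(1)] and v = coverD[OF bD(1)]
  obtain p f1 where p: "is_pullback C f t p f1" and [simp]: "r = s \<cdot> p" "h = g \<cdot> f1"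
    using assms(3) by auto
  obtain p' f1' where p': "is_pullback C f' t' p' f1'" and [simp]: "r' = s' \<cdot> p'" "h' = g' \<cdot> f1'"
    using assms(4) by auto
  note pb = pullbackD[OF p] and pb' = pullbackD[OF p']
  have e: "f \<cdot> i \<in> Arr C" "Dom C (f \<cdot> i) = Dom C u1" "Cod C (f \<cdot> i) = B" using aD s s' by simp_all
  obtain P0 F0 where P0: "is_pullback C (f \<cdot> i) v0 P0 F0" "P0 \<in> \<D>"
    using CS3[OF v(1) e(1)] e v t by auto
  obtain P1 F1 where P1: "is_pullback C (f \<cdot> i) v1 P1 F1" using CS3[OF v(2) e(1)] e v t by auto
  note pb0 = pullbackD[OF P0(1)] and pb1 = pullbackD[OF P1(1)]
  have "u1 \<cdot> P0 \<in> \<D>" using dist_comp[OF P0(2) u(2)] pb0 e by simp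
  moreover have e0: "u1 \<cdot> P0 = s \<cdot> (i \<cdot> P0)" "u1 \<cdot> P0 = s' \<cdot> (j \<cdot> P0)"
    using comp_assoc_eq[OF aD(5), of P0] comp_assoc_eq[OF aD(9), of P0] aD(2-9) s s' pb0 e by simp_all
  moreover obtain w0 where w0: "is_union C u0 (u1 \<cdot> P0) w0"
    using CS2[OF u(1) calculation(1)] u P0 pb0 e by auto
  moreover have "is_pullback C (f' \<cdot> j) v0 P0 F0" using P0(1) aD(10) by simp
  ultimately have tr: "triv_on w0 (s \<cdot> p) (g \<cdot> f1)" "triv_on w0 (s' \<cdot> p') (g' \<cdot> f1')"
    using comp_triv_on[OF p P0(1), of u0 s w0 g] comp_triv_on[OF p', of j v0 P0 F0 u0 s' w0 g']
      s t s' t' u aD bD by simp_all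
  have cov: "cover w0 (u1 \<cdot> P1) A"
    using comp_cover[OF aD(1) _ e(2) P0(1) P1 w0] bD(1) s t by auto
  have e1: "u1 \<cdot> P1 = s \<cdot> (i \<cdot> P1)" "u1 \<cdot> P1 = s' \<cdot> (j \<cdot> P1)"
    using comp_assoc_eq[OF aD(5), of P1] comp_assoc_eq[OF aD(9), of P1] aD(2-9) s s' pb1 e by simp_all
  \<comment> \<open>On \<open>u1 \<cdot> P1\<close> the first arrow lands in \<open>v1\<close>,
    hence in \<open>t\<close>, which gives the inclusion \<open>m\<close> into the inverse image
    \<open>p\<close>; \<open>n\<close> arises in the same way.\<close>
  have "f \<cdot> (i \<cdot> P1) = t \<cdot> (k \<cdot> F1)"
    using comp_assoc_eq[OF bD(5), of F1] bD(2-9) aD(2-9) t s pb1 e by simp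
  then obtain m where m: "m \<in> Arr C" "Dom C m = Dom C P1" "Cod C m = Dom C p"
    "p \<cdot> m = i \<cdot> P1" "f1 \<cdot> m = k \<cdot> F1"
    using pullback_univ[OF p, of "i \<cdot> P1" "k \<cdot> F1"] bD(2-9) aD(2-9) t s pb1 e by (metis comp_arr)
  have "f' \<cdot> (j \<cdot> P1) = t' \<cdot> (l \<cdot> F1)"
    using comp_assoc_eq[OF bD(9), of F1] comp_assoc_eq2[OF aD(10), of P1] bD(2-9) aD(2-9) t t' s s' pb1 e
    by simp
  then obtain n where n: "n \<in> Arr C" "Dom C n = Dom C P1" "Cod C n = Dom C p'"
    "p' \<cdot> n = j \<cdot> P1" "f1' \<cdot> n = l \<cdot> F1"
    using pullback_univ[OF p', of "j \<cdot> P1" "l \<cdot> F1"] bD(2-9) aD(2-9) t' s' pb1 e by (metis comp_arr)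
  have "g \<cdot> (k \<cdot> F1) = g' \<cdot> (l \<cdot> F1)"
    using comp_assoc_eq2[OF bD(10), of F1] bD(2-9) t t' pb1 by simp
  then have "agree w0 (u1 \<cdot> P1) m n (s \<cdot> p) (g \<cdot> f1) (s' \<cdot> p') (g' \<cdot> f1')"
    unfolding agree_def using cov tr m n e1 s t s' t' pb pb' pb1 u e aD(2-4,6-8) by simp
  then show ?thesis
    using composite_DP[OF DP(1,3) assms(3)] composite_DP[OF DP(2,4) assms(4)]
    unfolding stab_rel_iff \<open>z = _\<close> \<open>z' = _\<close> by auto
qed

section \<open>The stable category\<close>

abbreviation \<S> :: "('o, 'o \<times> 'o \<times> ('a \<times> 'a \<times> 'a) set) cat" where
  "\<S> \<equiv> Stab C zero \<D> \<T> \<F>"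

definition cls :: "'o \<Rightarrow> 'o \<Rightarrow> 'a \<times> 'a \<times> 'a \<Rightarrow> 'o \<times> 'o \<times> ('a \<times> 'a \<times> 'a) set" where
  "cls A B x = (A, B, SR A B `` {x})"

abbreviation \<sigma> :: "'a \<Rightarrow> 'o \<times> 'o \<times> ('a \<times> 'a \<times> 'a) set" where
  "\<sigma> \<equiv> stab_sigma C zero \<D> \<T> \<F>"

lemma Stab_Obj [simp]: "Obj \<S> = Obj C"
  and Stab_Dom [simp]: "Dom \<S> (A, B, X) = A"
  and Stab_Cod [simp]: "Cod \<S> (A, B, X) = B"
  and Stab_Id: "Id \<S> A = \<sigma> (Id C A)"
  by (simp_all add: Stab_def)

lemma cls_dom_cod [simp]: "Dom \<S> (cls A B x) = A" "Cod \<S> (cls A B x) = B"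
  by (simp_all add: cls_def)

lemma DP_obj: "x \<in> DP A B \<Longrightarrow> A \<in> Obj C \<and> B \<in> Obj C"
  by (cases x) (auto simp: dispar_iff dest: coverD)

lemma cls_arr [simp]: "x \<in> DP A B \<Longrightarrow> cls A B x \<in> Arr \<S>"
  using DP_obj[of x A B] by (auto simp: cls_def Stab_def quotientI)

lemma Stab_arrE:
  assumes "F \<in> Arr \<S>" "Dom \<S> F = A" "Cod \<S> F = B"
  obtains s0 s1 f where "(s0, s1, f) \<in> DP A B" "F = cls A B (s0, s1, f)" "A \<in> Obj C" "B \<in> Obj C"
    "s0 \<in> \<D>" "s1 \<in> \<D>" "cover s0 s1 A" "Cod C s0 = A" "Cod C s1 = A"
    "f \<in> Arr C" "Dom C f = Dom C s1" "Cod C f = B" "triv_on s0 s1 f"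
proof -
  obtain X where F: "F = (A, B, X)" using assms by (cases F) auto
  then obtain x where x: "x \<in> DP A B" "X = SR A B `` {x}"
    using assms by (auto simp: Stab_def elim: quotientE)
  obtain s0 s1 f where "x = (s0, s1, f)" by (cases x)
  then show ?thesis
    using that[of s0 s1 f] x F DP_obj[OF x(1)] by (auto simp: cls_def dispar_iff dest: coverD)
qed

lemma cls_eq_iff:
  assumes "x \<in> DP A B" "y \<in> DP A B"
  shows "cls A B x = cls A B y \<longleftrightarrow> (x, y) \<in> SR A B"
  using eq_equiv_class_iff[OF SR_equiv assms] by (simp add: cls_def)

text \<open>By the congruence property every choice of representatives and of a composite gives the
  same class, so the union in the definition of composition is taken over a single set.\<close>

lemma cls_comp:
  assumes "x \<in> DP A B" "y \<in> DP B D" "dispar_composite C y x z"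
  shows "cls B D y \<cdot>\<^bsub>\<S>\<^esub> cls A B x = cls A D z"
proof -
  have "{SR A D `` {z'} | x' y' z'. x' \<in> SR A B `` {x} \<and> y' \<in> SR B D `` {y} \<and>
      dispar_composite C y' x' z'} = {SR A D `` {z}}" (is "?L = _")
  proof
    show "?L \<subseteq> {SR A D `` {z}}"
    proof
      fix X assume "X \<in> ?L"
      then obtain x' y' z' where X: "X = SR A D `` {z'}" "(x, x') \<in> SR A B" "(y, y') \<in> SR B D"
        "dispar_composite C y' x' z'" by blast
      have "(z, z') \<in> SR A D" using composite_cong[OF X(2,3) assms(3) X(4)] .
      then show "X \<in> {SR A D `` {z}}" using equiv_class_eq[OF SR_equiv] X(1) by blast
    qed
    have "x \<in> SR A B `` {x}" "y \<in> SR B D `` {y}"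
      using equiv_class_self[OF SR_equiv] assms by blast+
    then show "{SR A D `` {z}} \<subseteq> ?L" using assms(3) by blast
  qed
  then show ?thesis by (simp add: Stab_def cls_def)
qed

section \<open>Zero subobjects, triples coming from arrows, and composition with them\<close>

lemma zero_le:
  assumes "s \<in> Arr C" "Cod C s = A"
  shows "sub_le C (initial_arr C zero A) s"
proof -
  have "A \<in> Obj C" using assms by auto
  then show ?thesis
    using assms initial_unique[of "s \<cdot> initial_arr C zero (Dom C s)"]
    by (intro sub_leI[of s "initial_arr C zero (Dom C s)"]) simp_all
qed

text \<open>An arrow \<open>y\<close> into \<open>zero\<close> makes its domain initial by
  strictness, so the required factorisation of \<open>x\<close> holds automatically.\<close>

lemma zero_pullback:
  assumes "f \<in> Arr C" "Cod C f = B"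
  shows "is_pullback C f (initial_arr C zero B) (initial_arr C zero (Dom C f)) (Id C zero)"
proof (rule pullbackI)
  have B: "B \<in> Obj C" using assms by auto
  show "f \<cdot> initial_arr C zero (Dom C f) = initial_arr C zero B \<cdot> Id C zero"
    using initial_unique[of "f \<cdot> initial_arr C zero (Dom C f)"] assms B by simp
  show "mono_arr C (initial_arr C zero (Dom C f))" by (rule dist_mono[OF CS1_zero]) (use assms in simp)
  fix x y assume "x \<in> Arr C" "y \<in> Arr C" "Cod C x = Dom C f" "Cod C y = Dom C (initial_arr C zero B)"
    "Dom C x = Dom C y"
  then show "\<exists>h\<in>Arr C. Dom C h = Dom C x \<and> Cod C h = Dom C (initial_arr C zero (Dom C f)) \<and>
     initial_arr C zero (Dom C f) \<cdot> h = x \<and> Id C zero \<cdot> h = y"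
    using assms B eq_of_into_zero[of y "initial_arr C zero (Dom C f) \<cdot> y" x]
    by (intro bexI[of _ y]) auto
qed (use assms in auto)

lemma union_zero:
  assumes "s \<in> \<D>" "Cod C s = A"
  shows "is_union C s (initial_arr C zero A) s" "is_union C (initial_arr C zero A) s s"
  using assms zero_le[of s A] dist_mono[OF assms(1)] sub_le_refl[of s]
  unfolding is_union_def by auto

lemma cover_zero_id: "A \<in> Obj C \<Longrightarrow> cover (initial_arr C zero A) (Id C A) A"
  and cover_id_zero: "A \<in> Obj C \<Longrightarrow> cover (Id C A) (initial_arr C zero A) A"
  using union_zero[of "Id C A" A] CS1_whole CS1_zero by (simp_all add: cover_def)

text \<open>An element lying in the zero subobject has an initial domain by strictness, so its image
  under \<open>f\<close> factors through the trivial object \<open>zero\<close>.\<close>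

lemma triv_on_zero:
  assumes "s \<in> \<D>" "f \<in> Arr C" "Dom C f = Dom C s" "Cod C s = A"
  shows "triv_on (initial_arr C zero A) s f"
proof (rule triv_onI)
  fix y assume y: "y \<in> Arr C" "Cod C y = Dom C s" "sub_le C (s \<cdot> y) (initial_arr C zero A)"
  have A: "A \<in> Obj C" using assms by auto
  obtain c where c: "c \<in> Arr C" "Dom C c = Dom C y" "Cod C c = zero"
    using y A assms by (auto elim!: sub_leE)
  have "initial_arr C zero (Cod C f) \<cdot> c = f \<cdot> y"
    using eq_of_into_zero[of c "initial_arr C zero (Cod C f) \<cdot> c" "f \<cdot> y"] c y assms by simp
  then show "triv (f \<cdot> y)"
    using trivI[OF _ zero_trivial, of "f \<cdot> y" "initial_arr C zero (Cod C f)" c] c assms by simp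
qed

definition sg :: "'a \<Rightarrow> 'a \<times> 'a \<times> 'a" where
  "sg f = (initial_arr C zero (Dom C f), Id C (Dom C f), f)"

lemma sigma_cls: "\<sigma> f = cls (Dom C f) (Cod C f) (sg f)"
  by (simp add: cls_def sg_def stab_sigma_def)

lemma sg_DP [simp]: "\<lbrakk>f \<in> Arr C; Dom C f = A; Cod C f = B\<rbrakk> \<Longrightarrow> sg f \<in> DP A B"
  using cover_zero_id[of A] triv_on_zero[of "Id C A" f A] CS1_whole[of A]
  by (auto simp: sg_def dispar_iff)

text \<open>Zero and the whole of \<open>B\<close> pull back along \<open>f\<close> to zero and the
  whole of \<open>Dom C s1\<close>, so \<open>s0\<close> and \<open>s1\<close> stay
  unchanged.\<close>

lemma composite_sg_left:
  assumes "(s0, s1, f) \<in> DP A B" "g \<in> Arr C" "Dom C g = B"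
  shows "dispar_composite C (sg g) (s0, s1, f) (s0, s1, g \<cdot> f)"
proof -
  have s: "cover s0 s1 A" "f \<in> Arr C" "Dom C f = Dom C s1" "Cod C f = B"
    using assms by (simp_all add: dispar_iff)
  note sD = coverD[OF s(1)]
  have "s1 \<cdot> initial_arr C zero (Dom C s1) = initial_arr C zero A"
    using initial_unique[of "s1 \<cdot> initial_arr C zero (Dom C s1)"] sD by simp
  then have "is_union C s0 (s1 \<cdot> initial_arr C zero (Dom C s1)) s0" using union_zero sD by simp
  then show ?thesis
    using zero_pullback[of f B] pullback_id[of f B] s sD assms
    unfolding sg_def dispar_composite.simps
    by (intro exI[of _ "initial_arr C zero (Dom C s1)"] exI[of _ "Id C zero"]
        exI[of _ "Id C (Dom C s1)"] exI[of _ f]) simp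
qed

lemma composite_sg_right:
  assumes "(t0, t1, g) \<in> DP B D" "f \<in> Arr C" "Cod C f = B"
    "is_pullback C f t0 p0 f0" "is_pullback C f t1 p1 f1"
  shows "dispar_composite C (t0, t1, g) (sg f) (p0, p1, g \<cdot> f1)"
proof -
  have t: "cover t0 t1 B" using assms by (simp add: dispar_iff)
  note tD = coverD[OF t] and pb0 = pullbackD[OF assms(4)] and pb1 = pullbackD[OF assms(5)]
  have "p0 \<in> \<D>" using pullback_dist[OF assms(4)] tD by simp
  then show ?thesis
    using union_zero(2)[of p0 "Dom C f"] assms pb0 pb1
    unfolding sg_def dispar_composite.simps
    by (intro exI[of _ p0] exI[of _ f0] exI[of _ p1] exI[of _ f1]) simp
qed

text \<open>Both composites are built from independently chosen pullbacks and unions, so they are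
  compared by \<open>rel_of_le\<close>: \<open>b0\<close> lies below \<open>d0\<close>, and
  \<open>b1\<close> factors through \<open>d1\<close> compatibly with \<open>bb\<close> and
  \<open>dd\<close>.\<close>

lemma composite_assoc:
  assumes "x \<in> DP A B" "y \<in> DP B D" "z \<in> DP D E"
    "dispar_composite C y x yx" "dispar_composite C z yx z_yx"
    "dispar_composite C z y zy" "dispar_composite C zy x zy_x"
  shows "(z_yx, zy_x) \<in> SR A E"
proof -
  have DP: "yx \<in> DP A D" "z_yx \<in> DP A E" "zy \<in> DP B E" "zy_x \<in> DP A E"
    using composite_DP assms by blast+
  obtain s0 s1 f t0 t1 g r0 r1 h
    where [simp]: "x = (s0, s1, f)" "y = (t0, t1, g)" "z = (r0, r1, h)"
    by (cases x, cases y, cases z)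
  obtain a0 a1 aa b0 b1 bb c0 c1 cc d0 d1 dd
    where [simp]: "yx = (a0, a1, aa)" "z_yx = (b0, b1, bb)" "zy = (c0, c1, cc)" "zy_x = (d0, d1, dd)"
    by (cases yx, cases z_yx, cases zy, cases zy_x)
  have s: "s0 \<in> \<D>" "s1 \<in> \<D>" "Cod C s0 = A" "Cod C s1 = A" "f \<in> Arr C" "Dom C f = Dom C s1" "Cod C f = B"
    and t: "t0 \<in> \<D>" "t1 \<in> \<D>" "Cod C t0 = B" "Cod C t1 = B" "g \<in> Arr C" "Dom C g = Dom C t1" "Cod C g = D"
    and r: "r0 \<in> \<D>" "r1 \<in> \<D>" "Cod C r0 = D" "Cod C r1 = D" "h \<in> Arr C" "Dom C h = Dom C r1"
    and d: "d0 \<in> \<D>" and c: "c0 \<in> \<D>" "c1 \<in> \<D>"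
    using assms(1-3) DP by (auto simp: dispar_iff cover_def)
  obtain p0 f0 p1 f1 where p: "is_pullback C f t0 p0 f0" "is_pullback C f t1 p1 f1"
    "is_union C s0 (s1 \<cdot> p0) a0" "a1 = s1 \<cdot> p1" "aa = g \<cdot> f1" using assms(4) by auto
  obtain q0 g0 q1 g1 where q: "is_pullback C aa r0 q0 g0" "is_pullback C aa r1 q1 g1"
    "is_union C a0 (a1 \<cdot> q0) b0" "b1 = a1 \<cdot> q1" "bb = h \<cdot> g1" using assms(5) by auto
  obtain k0 l0 k1 l1 where k: "is_pullback C g r0 k0 l0" "is_pullback C g r1 k1 l1"
    "is_union C t0 (t1 \<cdot> k0) c0" "c1 = t1 \<cdot> k1" "cc = h \<cdot> l1" using assms(6) by auto
  obtain m0 n0 m1 n1 where m: "is_pullback C f c0 m0 n0" "is_pullback C f c1 m1 n1"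
    "is_union C s0 (s1 \<cdot> m0) d0" "d1 = s1 \<cdot> m1" "dd = cc \<cdot> n1" using assms(7) by auto
  note P = pullbackD[OF p(1)] pullbackD[OF p(2)] and Q = pullbackD[OF q(1)] pullbackD[OF q(2)]
    and K = pullbackD[OF k(1)] pullbackD[OF k(2)] and M = pullbackD[OF m(1)] pullbackD[OF m(2)]
  note Pu = unionD[OF p(3)] and Qu = unionD[OF q(3)] and Ku = unionD[OF k(3)] and Mu = unionD[OF m(3)]
  have [simp]: "Cod C p1 = Dom C s1" "Cod C p0 = Dom C s1" "Cod C q0 = Dom C p1" "Cod C q1 = Dom C p1"
    "Dom C f1 = Dom C p1" "Cod C f1 = Dom C t1" "Cod C k0 = Dom C t1" "Cod C k1 = Dom C t1"
    "Cod C m0 = Dom C s1" "Cod C m1 = Dom C s1"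
    "p0 \<in> Arr C" "p1 \<in> Arr C" "q0 \<in> Arr C" "q1 \<in> Arr C" "f1 \<in> Arr C" "k0 \<in> Arr C" "k1 \<in> Arr C"
    "m0 \<in> Arr C" "m1 \<in> Arr C" "g1 \<in> Arr C" "l1 \<in> Arr C" "n1 \<in> Arr C"
    "Cod C g1 = Dom C r1" "Cod C l1 = Dom C r1" "Cod C n1 = Dom C k1" "Dom C l1 = Dom C k1"
    "Dom C g1 = Dom C q1" "Dom C n1 = Dom C m1"
    using P(1-8,10-17) Q(1-8,10-17) K(1-8,10-17) M(1-8,10-17) p(4,5) q(4,5) k(4,5) m(4,5) s t r
    by simp_all
  have sq: "f \<cdot> (p1 \<cdot> y) = t1 \<cdot> (f1 \<cdot> y)" if "y \<in> Arr C" "Cod C y = Dom C p1" for y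
    using comp_assoc_eq2[OF P(18), of y] that s t by simp
  \<comment> \<open>An element of \<open>s1\<close> sent by \<open>f\<close> into \<open>c0\<close>
    lies in the inverse image \<open>m0\<close> and hence in \<open>d0\<close>. The parts
    \<open>s1 \<cdot> p0\<close> and \<open>a1 \<cdot> q0\<close> of \<open>b0\<close> are handled
    this way.\<close>
  have le0: "sub_le C (s1 \<cdot> y) d0" if y: "y \<in> Arr C" "Cod C y = Dom C s1" "sub_le C (f \<cdot> y) c0" for y
  proof -
    have "sub_le C y m0" using pullback_le_iff[OF m(1), of y] y s by simp
    then have "sub_le C (s1 \<cdot> y) (s1 \<cdot> m0)" using sub_le_comp_left s by simp
    then show ?thesis using sub_le_trans Mu s by (metis \<open>m0 \<in> Arr C\<close> \<open>Cod C m0 = Dom C s1\<close> comp_arr(1) dist_arr)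
  qed
  have "sub_le C p0 p0" by (rule sub_le_refl) simp
  then have "sub_le C (f \<cdot> p0) t0" using pullback_le_iff[OF p(1), of p0] s by simp
  then have "sub_le C (f \<cdot> p0) c0" using sub_le_trans Ku t dist_arr by blast
  then have "sub_le C (s1 \<cdot> p0) d0" using le0 by simp
  then have "sub_le C a0 d0" using union_least[OF p(3)] Mu(1,2) by blast
  moreover have "sub_le C (a1 \<cdot> q0) d0"
  proof -
    have "sub_le C q0 q0" by (rule sub_le_refl) simp
    then have "sub_le C (g \<cdot> (f1 \<cdot> q0)) r0"
      using pullback_le_iff[OF q(1), of q0] p(5) t by simp
    then have "sub_le C (f1 \<cdot> q0) k0" using pullback_le_iff[OF k(1), of "f1 \<cdot> q0"] t by simp
    then have "sub_le C (t1 \<cdot> (f1 \<cdot> q0)) (t1 \<cdot> k0)" using sub_le_comp_left t by simp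
    then have "sub_le C (f \<cdot> (p1 \<cdot> q0)) c0" using sub_le_trans[OF _ Ku(3)] sq[of q0] t c by simp
    then show ?thesis using le0[of "p1 \<cdot> q0"] p(4) s by simp
  qed
  ultimately have le: "sub_le C b0 d0" using union_least[OF q(3)] Mu(1) by blast
  \<comment> \<open>The inclusion \<open>j\<close> of \<open>b1\<close> into \<open>d1\<close> is
    induced in two stages: first an arrow \<open>e\<close> into the inverse image of
    \<open>r1\<close> along \<open>g\<close>, then \<open>j\<close> into the inverse image of
    \<open>c1\<close> along \<open>f\<close>.\<close>
  have "g \<cdot> (f1 \<cdot> q1) = r1 \<cdot> g1" using Q(18) p(5) t by simp
  then obtain e where e: "e \<in> Arr C" "Dom C e = Dom C q1" "Cod C e = Dom C k1"
    "k1 \<cdot> e = f1 \<cdot> q1" "l1 \<cdot> e = g1"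
    using pullback_univ[OF k(2), of "f1 \<cdot> q1" g1] t r by auto
  have "f \<cdot> (p1 \<cdot> q1) = c1 \<cdot> e" using sq[of q1] e k(4) t by simp
  then obtain j where j: "j \<in> Arr C" "Dom C j = Dom C q1" "Cod C j = Dom C m1"
    "m1 \<cdot> j = p1 \<cdot> q1" "n1 \<cdot> j = e"
    using pullback_univ[OF m(2), of "p1 \<cdot> q1" e] e s k(4) t by auto
  show ?thesis
    unfolding \<open>z_yx = _\<close> \<open>zy_x = _\<close>
    by (rule rel_of_le[OF _ _ le, where j = j])
      (use DP p(4,5) q(4,5) k(4,5) m(4,5) s t r e j in simp_all)
qed

section \<open>The category axioms and functoriality\<close>

lemma Stab_category: "category \<S>"
proof
  fix F assume F: "F \<in> Arr \<S>"
  then show "Dom \<S> F \<in> Obj \<S>" "Cod \<S> F \<in> Obj \<S>"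
    using Stab_arrE[OF F refl refl] by (metis Stab_Obj)+
next
  fix A assume "A \<in> Obj \<S>"
  then show "Id \<S> A \<in> hom \<S> A A" by (simp add: Stab_Id sigma_cls hom_def)
next
  fix F G A B D assume F: "F \<in> hom \<S> A B" and G: "G \<in> hom \<S> B D"
  obtain x where x: "x \<in> DP A B" "F = cls A B x" using F by (auto simp: hom_def elim: Stab_arrE)
  obtain y where y: "y \<in> DP B D" "G = cls B D y" using G by (auto simp: hom_def elim: Stab_arrE)
  obtain z where z: "dispar_composite C y x z" using composite_ex[OF x(1) y(1)] by blast
  show "G \<cdot>\<^bsub>\<S>\<^esub> F \<in> hom \<S> A D"
    using cls_comp[OF x(1) y(1) z] composite_DP[OF x(1) y(1) z] x y by (simp add: hom_def)
next
  fix F A B assume F: "F \<in> hom \<S> A B"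
  then obtain s0 s1 f where x: "(s0, s1, f) \<in> DP A B" "F = cls A B (s0, s1, f)" "A \<in> Obj C" "B \<in> Obj C"
    "s0 \<in> \<D>" "s1 \<in> \<D>" "Cod C s0 = A" "Cod C s1 = A" "f \<in> Arr C" "Dom C f = Dom C s1" "Cod C f = B"
    by (auto simp: hom_def elim: Stab_arrE)
  have "dispar_composite C (s0, s1, f) (sg (Id C A)) (s0, s1, f \<cdot> Id C (Dom C s1))"
    by (rule composite_sg_right[OF x(1)])
      (use x pullback_along_id[of s0 A] pullback_along_id[of s1 A] dist_mono in simp_all)
  then show "F \<cdot>\<^bsub>\<S>\<^esub> Id \<S> A = F"
    using cls_comp[OF _ x(1), of "sg (Id C A)" A] x by (simp add: Stab_Id sigma_cls)
  have "dispar_composite C (sg (Id C B)) (s0, s1, f) (s0, s1, f)"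
    using composite_sg_left[OF x(1), of "Id C B"] x by simp
  then show "Id \<S> B \<cdot>\<^bsub>\<S>\<^esub> F = F"
    using cls_comp[OF x(1), of "sg (Id C B)" B] x by (simp add: Stab_Id sigma_cls)
next
  fix F G H A B D E assume F: "F \<in> hom \<S> A B" and G: "G \<in> hom \<S> B D" and H: "H \<in> hom \<S> D E"
  obtain x where x: "x \<in> DP A B" "F = cls A B x" using F by (auto simp: hom_def elim: Stab_arrE)
  obtain y where y: "y \<in> DP B D" "G = cls B D y" using G by (auto simp: hom_def elim: Stab_arrE)
  obtain z where z: "z \<in> DP D E" "H = cls D E z" using H by (auto simp: hom_def elim: Stab_arrE)
  obtain yx where yx: "dispar_composite C y x yx" using composite_ex[OF x(1) y(1)] by blast
  obtain zy where zy: "dispar_composite C z y zy" using composite_ex[OF y(1) z(1)] by blast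
  note DP = composite_DP[OF x(1) y(1) yx] composite_DP[OF y(1) z(1) zy]
  obtain z_yx where z_yx: "dispar_composite C z yx z_yx" using composite_ex[OF DP(1) z(1)] by blast
  obtain zy_x where zy_x: "dispar_composite C zy x zy_x" using composite_ex[OF x(1) DP(2)] by blast
  show "(H \<cdot>\<^bsub>\<S>\<^esub> G) \<cdot>\<^bsub>\<S>\<^esub> F = H \<cdot>\<^bsub>\<S>\<^esub> (G \<cdot>\<^bsub>\<S>\<^esub> F)"
    using composite_assoc[OF x(1) y(1) z(1) yx z_yx zy zy_x]
      cls_eq_iff[OF composite_DP[OF DP(1) z(1) z_yx] composite_DP[OF x(1) DP(2) zy_x]]
      cls_comp[OF x(1) y(1) yx] cls_comp[OF y(1) z(1) zy] cls_comp[OF DP(1) z(1) z_yx]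
      cls_comp[OF x(1) DP(2) zy_x] x y z by simp
qed

lemma sigma_functor: "cat_functor C \<S> (\<lambda>A. A) \<sigma>"
proof -
  interpret S: category \<S> by (rule Stab_category)
  show ?thesis
  proof
    fix f A B assume "f \<in> hom C A B"
    then show "\<sigma> f \<in> hom \<S> A B" by (simp add: sigma_cls)
  next
    fix f g A B D assume *: "f \<in> hom C A B" "g \<in> hom C B D"
    have "dispar_composite C (sg g) (sg f) (sg (g \<cdot> f))"
      using composite_sg_left[of "initial_arr C zero A" "Id C A" f A B g] * sg_DP[of f A B]
      by (simp add: sg_def)
    then show "\<sigma> (g \<cdot> f) = \<sigma> g \<cdot>\<^bsub>\<S>\<^esub> \<sigma> f"
      using cls_comp[of "sg f" A B "sg g" D "sg (g \<cdot> f)"] * by (simp add: sigma_cls)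
  qed (simp_all add: Stab_Id)
qed

end

section \<open>Canonical sequences and the torsion free reflection\<close>

context pretorsion_theory
begin

section \<open>Kernels and cokernels relative to trivial arrows\<close>

lemma zkernelD:
  assumes "is_zkernel C \<T> \<F> k f"
  shows "k \<in> Arr C" "f \<in> Arr C" "Cod C k = Dom C f" "triv (f \<cdot> k)"
  using assms by (auto simp: is_zkernel_def)

lemma zkernel_factor:
  assumes "is_zkernel C \<T> \<F> k f" "m \<in> Arr C" "Cod C m = Dom C f" "triv (f \<cdot> m)"
  obtains h where "h \<in> Arr C" "Dom C h = Dom C m" "Cod C h = Dom C k" "k \<cdot> h = m"
proof -
  have "\<exists>!h. h \<in> hom C (Dom C m) (Dom C k) \<and> k \<cdot> h = m"
    using assms unfolding is_zkernel_def by blast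
  then show ?thesis using that by auto
qed

lemma zkernel_mono:
  assumes "is_zkernel C \<T> \<F> k f"
  shows "mono_arr C k"
  unfolding mono_arr_def
proof (intro conjI allI ballI impI)
  note kD = zkernelD[OF assms]
  show "k \<in> Arr C" by (rule kD)
  fix X g h assume *: "g \<in> hom C X (Dom C k)" "h \<in> hom C X (Dom C k)" "k \<cdot> g = k \<cdot> h"
  have "triv (f \<cdot> (k \<cdot> g))" using triv_comp_right[OF kD(4), of g] kD * by simp
  then have "\<exists>!x. x \<in> hom C (Dom C (k \<cdot> g)) (Dom C k) \<and> k \<cdot> x = k \<cdot> g"
    using assms * kD comp_arr[of g k] unfolding is_zkernel_def by (metis hom_iff)
  then show "g = h" using * kD by auto
qed

text \<open>If \<open>k \<cdot> x\<close> factors as \<open>h \<cdot> g\<close> through a trivial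
  \<open>Z\<close>, then \<open>f \<cdot> h\<close> starts at \<open>Z\<close> and is trivial, so
  \<open>h\<close> lifts through \<open>k\<close>; cancelling \<open>k\<close> factors
  \<open>x\<close> through \<open>Z\<close>.\<close>

lemma zkernel_reflects_triv:
  assumes "is_zkernel C \<T> \<F> k f" "triv (k \<cdot> x)" "x \<in> Arr C" "Cod C x = Dom C k"
  shows "triv x"
proof -
  note kD = zkernelD[OF assms(1)]
  obtain Z g h where z: "Z \<in> \<T> \<inter> \<F>" "g \<in> Arr C" "Dom C g = Dom C (k \<cdot> x)" "Cod C g = Z"
    "h \<in> Arr C" "Dom C h = Z" "Cod C h = Cod C (k \<cdot> x)" "h \<cdot> g = k \<cdot> x"
    using trivE[OF assms(2)] by metis
  have "triv (f \<cdot> h)" using triv_from[of "f \<cdot> h"] z kD assms by simp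
  then obtain h' where h': "h' \<in> Arr C" "Dom C h' = Z" "Cod C h' = Dom C k" "k \<cdot> h' = h"
    using zkernel_factor[OF assms(1), of h] z kD assms by auto
  have "h' \<cdot> g = x"
    using mono_arrD[OF zkernel_mono[OF assms(1)], of "h' \<cdot> g" x] comp_assoc_eq[OF h'(4), of g]
      z h' kD assms by simp
  then show ?thesis using trivI[of x h' g Z] z h' by simp
qed

lemma zcokernelD:
  assumes "is_zcokernel C \<T> \<F> q f"
  shows "q \<in> Arr C" "f \<in> Arr C" "Dom C q = Cod C f" "triv (q \<cdot> f)"
  using assms by (auto simp: is_zcokernel_def)

lemma zcokernel_factor:
  assumes "is_zcokernel C \<T> \<F> q f" "m \<in> Arr C" "Dom C m = Cod C f" "triv (m \<cdot> f)"
  obtains h where "h \<in> Arr C" "Dom C h = Cod C q" "Cod C h = Cod C m" "h \<cdot> q = m"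
proof -
  have "\<exists>!h. h \<in> hom C (Cod C q) (Cod C m) \<and> h \<cdot> q = m"
    using assms zcokernelD(3)[OF assms(1)] unfolding is_zcokernel_def by simp
  then show ?thesis using that by auto
qed

lemma zcokernel_epi:
  assumes "is_zcokernel C \<T> \<F> q f"
  shows "epi_arr C q"
  unfolding epi_arr_def
proof (intro conjI allI ballI impI)
  note qD = zcokernelD[OF assms]
  show "q \<in> Arr C" by (rule qD)
  fix Y g h assume *: "g \<in> hom C (Cod C q) Y" "h \<in> hom C (Cod C q) Y" "g \<cdot> q = h \<cdot> q"
  have "triv ((g \<cdot> q) \<cdot> f)" using triv_comp_left[OF qD(4), of g] comp_assoc[of f q g] qD *(1) by simp
  then have "\<exists>!x. x \<in> hom C (Cod C q) (Cod C (g \<cdot> q)) \<and> x \<cdot> q = g \<cdot> q"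
    using assms * qD unfolding is_zcokernel_def by (metis comp_arr hom_iff)
  then show "g = h" using * qD by auto
qed

text \<open>Dual to \<open>zkernel_reflects_triv\<close>: the first factor of
  \<open>x \<cdot> q\<close>, which ends at a trivial object, extends along
  \<open>q\<close>.\<close>

lemma zcokernel_reflects_triv:
  assumes "is_zcokernel C \<T> \<F> q f" "triv (x \<cdot> q)" "x \<in> Arr C" "Dom C x = Cod C q"
  shows "triv x"
proof -
  note qD = zcokernelD[OF assms(1)]
  obtain Z g h where z: "Z \<in> \<T> \<inter> \<F>" "g \<in> Arr C" "Dom C g = Dom C (x \<cdot> q)" "Cod C g = Z"
    "h \<in> Arr C" "Dom C h = Z" "Cod C h = Cod C (x \<cdot> q)" "h \<cdot> g = x \<cdot> q"
    using trivE[OF assms(2)] by metis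
  have "triv (g \<cdot> f)" using triv_to[of "g \<cdot> f"] z qD assms by simp
  then obtain g' where g': "g' \<in> Arr C" "Dom C g' = Cod C q" "Cod C g' = Z" "g' \<cdot> q = g"
    using zcokernel_factor[OF assms(1), of g] z qD assms by auto
  have "h \<cdot> g' = x"
    using epi_arrD[OF zcokernel_epi[OF assms(1)], of "h \<cdot> g'" x] z g' qD assms by simp
  then show ?thesis using trivI[of x h g' Z] z g' by simp
qed

section \<open>Objects recognised by their canonical sequences\<close>

lemma canonical_seqD:
  assumes "canonical_seq C \<T> \<F> A k q"
  shows "is_zkernel C \<T> \<F> k q" "is_zcokernel C \<T> \<F> q k" "k \<in> Arr C" "q \<in> Arr C"
    "Cod C k = A" "Dom C q = A" "Dom C k \<in> \<T>" "Cod C q \<in> \<F>" "triv (q \<cdot> k)"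
  using assms zkernelD[of k q] by (auto simp: canonical_seq_def short_zexact_def)

text \<open>If \<open>q\<close> is trivial, the identity of \<open>A\<close> factors through the
  kernel \<open>k\<close>. A monic arrow with a section is an isomorphism, so \<open>A\<close> is
  isomorphic to the torsion object \<open>Dom C k\<close>.\<close>

lemma torsion_of_triv_quotient:
  assumes "canonical_seq C \<T> \<F> A k q" "triv q"
  shows "A \<in> \<T>"
proof -
  note D = canonical_seqD[OF assms(1)]
  have A: "A \<in> Obj C" using D by auto
  obtain h where h: "h \<in> Arr C" "Dom C h = A" "Cod C h = Dom C k" "k \<cdot> h = Id C A"
    using zkernel_factor[OF D(1), of "Id C A"] D A assms(2) by auto
  have "h \<cdot> k = Id C (Dom C k)"
    using mono_arrD[OF zkernel_mono[OF D(1)], of "h \<cdot> k" "Id C (Dom C k)"] comp_assoc_eq[OF h(4), of k]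
      h D A by simp
  then have "iso_arr C k" using iso_arrI[of k h] h D by simp
  then have "isomorphic_objs C (Dom C k) A" using D unfolding isomorphic_objs_def by auto
  then show ?thesis using torsion_iso_closed D by blast
qed

lemma torsionfree_of_triv_kernel:
  assumes "canonical_seq C \<T> \<F> A k q" "triv k"
  shows "A \<in> \<F>"
proof -
  note D = canonical_seqD[OF assms(1)]
  have A: "A \<in> Obj C" using D by auto
  obtain h where h: "h \<in> Arr C" "Dom C h = Cod C q" "Cod C h = A" "h \<cdot> q = Id C A"
    using zcokernel_factor[OF D(2), of "Id C A"] D A assms(2) by auto
  have "q \<cdot> h = Id C (Cod C q)"
    using epi_arrD[OF zcokernel_epi[OF D(2)], of "q \<cdot> h" "Id C (Cod C q)"] h D A by simp
  then have "iso_arr C h" using iso_arrI[of h q] h D by simp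
  then have "isomorphic_objs C (Cod C q) A" using h unfolding isomorphic_objs_def by auto
  then show ?thesis using torsionfree_iso_closed D by blast
qed

text \<open>Such an object is a priori only a retract of a trivial one, but both arrows of its
  canonical sequence become trivial, which makes it torsion and torsion free.\<close>

lemma trivial_of_triv_id:
  assumes "A \<in> Obj C" "triv (Id C A)"
  shows "A \<in> \<T> \<inter> \<F>"
proof -
  obtain k q where kq: "canonical_seq C \<T> \<F> A k q" using PT2 assms by blast
  note D = canonical_seqD[OF kq]
  have "triv (q \<cdot> Id C A)" "triv (Id C A \<cdot> k)"
    using triv_comp_left[OF assms(2), of q] triv_comp_right[OF assms(2), of k] D assms by simp_all
  then show ?thesis
    using torsion_of_triv_quotient[OF kq] torsionfree_of_triv_kernel[OF kq] D by simp
qed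

section \<open>The reflection \<open>\<Phi>\<close> and its unit \<open>\<eta>\<close>\<close>

abbreviation \<eta> :: "'o \<Rightarrow> 'a" where "\<eta> \<equiv> eta C \<T> \<F>"
abbreviation \<Phi> :: "'o \<Rightarrow> 'o" where "\<Phi> \<equiv> phi_obj C \<T> \<F>"
abbreviation \<phi> :: "'a \<Rightarrow> 'a" where "\<phi> \<equiv> phi_arr C \<T> \<F>"

lemma eta_canonical: "A \<in> Obj C \<Longrightarrow> \<exists>k. canonical_seq C \<T> \<F> A k (\<eta> A)"
  unfolding eta_def using PT2[of A] by (metis (mono_tags, lifting) someI_ex)

lemma eta_arr [simp]:
  assumes "A \<in> Obj C"
  shows "\<eta> A \<in> Arr C" "Dom C (\<eta> A) = A" "Cod C (\<eta> A) = \<Phi> A" "\<Phi> A \<in> \<F>" "\<Phi> A \<in> Obj C"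
  using eta_canonical[OF assms] canonical_seqD[of A _ "\<eta> A"] by (auto simp: phi_obj_def)

lemma eta_epi:
  assumes "g \<cdot> \<eta> A = h \<cdot> \<eta> A" "A \<in> Obj C" "g \<in> Arr C" "h \<in> Arr C" "Dom C g = \<Phi> A" "Dom C h = \<Phi> A"
  shows "g = h"
proof -
  obtain k where "canonical_seq C \<T> \<F> A k (\<eta> A)" using eta_canonical assms by blast
  then have "epi_arr C (\<eta> A)" using zcokernel_epi canonical_seqD(2) by blast
  then show ?thesis using epi_arrD[OF _ assms(1)] assms by simp
qed

lemma eta_reflects_triv:
  assumes "triv (x \<cdot> \<eta> A)" "A \<in> Obj C" "x \<in> Arr C" "Dom C x = \<Phi> A"
  shows "triv x"
proof -
  obtain k where k: "canonical_seq C \<T> \<F> A k (\<eta> A)" using eta_canonical assms by blast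
  show ?thesis using zcokernel_reflects_triv[OF canonical_seqD(2)[OF k] assms(1)] assms by simp
qed

text \<open>The universal property of the reflection: \<open>f \<cdot> k\<close> runs from a torsion
  object to a torsion free one and is trivial by \<open>PT1\<close>, so the cokernel property of
  \<open>\<eta> A\<close> applies.\<close>

lemma eta_factor_free:
  assumes "f \<in> Arr C" "Dom C f = A" "Cod C f \<in> \<F>"
  obtains h where "h \<in> Arr C" "Dom C h = \<Phi> A" "Cod C h = Cod C f" "h \<cdot> \<eta> A = f"
proof -
  have A: "A \<in> Obj C" using assms by auto
  obtain k where k: "canonical_seq C \<T> \<F> A k (\<eta> A)" using eta_canonical A by blast
  note D = canonical_seqD[OF k]
  have "triv (f \<cdot> k)" using PT1[of "Dom C k" "Cod C f" "f \<cdot> k"] D assms by simp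
  then show ?thesis using zcokernel_factor[OF D(2), of f] that assms D A by auto
qed

lemma phi_arr:
  assumes "s \<in> Arr C"
  shows "\<phi> s \<in> Arr C" "Dom C (\<phi> s) = \<Phi> (Dom C s)" "Cod C (\<phi> s) = \<Phi> (Cod C s)"
    "\<phi> s \<cdot> \<eta> (Dom C s) = \<eta> (Cod C s) \<cdot> s"
proof -
  obtain h where h: "h \<in> Arr C" "Dom C h = \<Phi> (Dom C s)" "Cod C h = \<Phi> (Cod C s)"
    "h \<cdot> \<eta> (Dom C s) = \<eta> (Cod C s) \<cdot> s"
    using eta_factor_free[of "\<eta> (Cod C s) \<cdot> s" "Dom C s"] assms by auto
  have "\<phi> s = h"
    unfolding phi_arr_def
  proof (rule the_equality)
    fix h' assume "h' \<in> hom C (\<Phi> (Dom C s)) (\<Phi> (Cod C s)) \<and> h' \<cdot> \<eta> (Dom C s) = \<eta> (Cod C s) \<cdot> s"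
    then show "h' = h" using eta_epi[of h' "Dom C s" h] h assms by simp
  qed (use h in simp)
  then show "\<phi> s \<in> Arr C" "Dom C (\<phi> s) = \<Phi> (Dom C s)" "Cod C (\<phi> s) = \<Phi> (Cod C s)"
    "\<phi> s \<cdot> \<eta> (Dom C s) = \<eta> (Cod C s) \<cdot> s" using h by simp_all
qed

lemma phi_unique:
  assumes "h \<cdot> \<eta> (Dom C s) = \<eta> (Cod C s) \<cdot> s" "h \<in> Arr C" "Dom C h = \<Phi> (Dom C s)" "s \<in> Arr C"
  shows "h = \<phi> s"
  using eta_epi[of h "Dom C s" "\<phi> s"] assms phi_arr[of s] by simp

lemma phi_comp:
  assumes "s \<in> Arr C" "t \<in> Arr C" "Cod C s = Dom C t"
  shows "\<phi> t \<cdot> \<phi> s = \<phi> (t \<cdot> s)"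
proof (rule phi_unique)
  show "(\<phi> t \<cdot> \<phi> s) \<cdot> \<eta> (Dom C (t \<cdot> s)) = \<eta> (Cod C (t \<cdot> s)) \<cdot> (t \<cdot> s)"
    using comp_assoc_eq2[OF phi_arr(4)[OF assms(2)], of s] phi_arr[of s] phi_arr[of t] assms by simp
qed (use assms phi_arr[of s] phi_arr[of t] in simp_all)

end

section \<open>Distinguished subobjects and the reflection\<close>

context compatible
begin

text \<open>\<open>\<Phi>\<close> of a torsion object is trivial because its unit is. As
  \<open>\<phi> s\<close> is distinguished by \<open>CC3\<close>, \<open>CC1\<close> makes
  \<open>\<Phi> (Dom C s)\<close> trivial, and an object with trivial unit is torsion. This matters
  because the arrow of a triple is defined only on a distinguished subobject.\<close>

lemma dist_torsion:
  assumes "s \<in> \<D>" "Cod C s \<in> \<T>"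
  shows "Dom C s \<in> \<T>"
proof -
  define A where "A = Cod C s"
  have A: "A \<in> Obj C" "A \<in> \<T>" using assms by (simp_all add: A_def)
  have "triv (\<eta> A)" using PT1[of A "\<Phi> A" "\<eta> A"] A by simp
  then have "triv (Id C (\<Phi> A) \<cdot> \<eta> A)" using A by simp
  then have "triv (Id C (\<Phi> A))" using eta_reflects_triv[of "Id C (\<Phi> A)" A] A by simp
  then have "\<Phi> A \<in> \<T> \<inter> \<F>" using trivial_of_triv_id[of "\<Phi> A"] A by simp
  then have "\<Phi> (Dom C s) \<in> \<T> \<inter> \<F>"
    using CC1[OF CC3[OF assms(1)]] phi_arr[of s] assms by (simp add: A_def)
  then have "triv (\<eta> (Dom C s))" using triv_to[of "\<eta> (Dom C s)"] assms by simp
  moreover obtain k where "canonical_seq C \<T> \<F> (Dom C s) k (\<eta> (Dom C s))"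
    using eta_canonical[of "Dom C s"] assms by auto
  ultimately show ?thesis using torsion_of_triv_quotient by blast
qed

text \<open>The kernel arrow \<open>k\<close> of \<open>Dom C s\<close> becomes trivial after
  composing with \<open>s\<close>, by \<open>PT1\<close>, and \<open>s\<close> reflects
  triviality.\<close>

lemma dist_torsionfree:
  assumes "s \<in> \<D>" "Cod C s \<in> \<F>"
  shows "Dom C s \<in> \<F>"
proof -
  obtain k q where kq: "canonical_seq C \<T> \<F> (Dom C s) k q" using PT2[of "Dom C s"] assms by auto
  note D = canonical_seqD[OF kq]
  have "triv (s \<cdot> k)" using PT1[of "Dom C k" "Cod C s" "s \<cdot> k"] D assms by simp
  then have "triv k" using dist_reflects_triv[OF assms(1), of k] D by simp
  then show ?thesis using torsionfree_of_triv_kernel[OF kq] by simp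
qed

text \<open>Let a distinguished \<open>w\<close> contain both images. By locality
  \<open>\<eta> A\<close> factors through \<open>w\<close>; the domain of \<open>w\<close> is
  torsion free, so this factorisation extends along \<open>\<eta> A\<close> to a section of
  \<open>w\<close>.\<close>

lemma phi_cover:
  assumes "cover s0 s1 A"
  shows "cover (\<phi> s0) (\<phi> s1) (\<Phi> A)"
proof (rule coverI)
  note s = coverD[OF assms]
  note p0 = phi_arr[OF dist_arr[OF s(1)]] and p1 = phi_arr[OF dist_arr[OF s(2)]]
  show "\<phi> s0 \<in> \<D>" "\<phi> s1 \<in> \<D>" using CC3 s by blast+
  show "Cod C (\<phi> s0) = \<Phi> A" "Cod C (\<phi> s1) = \<Phi> A" using p0 p1 s by simp_all
  fix w assume w: "w \<in> \<D>" "Cod C w = \<Phi> A" "sub_le C (\<phi> s0) w" "sub_le C (\<phi> s1) w"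
  have "sub_le C (\<eta> A \<cdot> s0) w" "sub_le C (\<eta> A \<cdot> s1) w"
    using sub_le_comp_right[OF w(3), of "\<eta> (Dom C s0)"] sub_le_comp_right[OF w(4), of "\<eta> (Dom C s1)"]
      p0 p1 s w by simp_all
  then have "sub_le C (\<eta> A) w" using le_local[of s0 s1 "\<eta> A" w] s assms w by simp
  then obtain c where c: "c \<in> Arr C" "Dom C c = A" "Cod C c = Dom C w" "w \<cdot> c = \<eta> A"
    using s by (auto elim!: sub_leE)
  obtain d where d: "d \<in> Arr C" "Dom C d = \<Phi> A" "Cod C d = Dom C w" "d \<cdot> \<eta> A = c"
    using eta_factor_free[of c A] dist_torsionfree[OF w(1)] c w s by auto
  have "w \<cdot> d = Id C (\<Phi> A)" using eta_epi[of "w \<cdot> d" A "Id C (\<Phi> A)"] c d w s by simp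
  then show "sub_le C (Id C (\<Phi> A)) w" using sub_leI[of w d] d w by simp
qed

text \<open>\<open>s\<close> is compared with an actual pullback \<open>p\<close> by the induced
  \<open>j\<close>. The arrows \<open>\<phi> s\<close> and \<open>\<phi> p\<close> factor through
  each other, so \<open>\<phi> j\<close> is an isomorphism, and \<open>CC5\<close> makes
  \<open>j\<close> one.\<close>

lemma phi_pullback:
  assumes "s \<in> \<D>" "Cod C s = A"
  shows "is_pullback C (\<eta> A) (\<phi> s) s (\<eta> (Dom C s))"
proof -
  have A [simp]: "A \<in> Obj C" using assms by auto
  note s = phi_arr[OF dist_arr[OF assms(1)]]
  have sD: "\<phi> s \<in> \<D>" by (rule CC3[OF assms(1)])
  obtain p v where p: "is_pullback C (\<eta> A) (\<phi> s) p v" "p \<in> \<D>"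
    using CS3[OF sD, of "\<eta> A"] s assms by auto
  note pb = pullbackD[OF p(1)] and pp = phi_arr[OF dist_arr[OF p(2)]]
  obtain j where j: "j \<in> Arr C" "Dom C j = Dom C s" "Cod C j = Dom C p" "p \<cdot> j = s" "v \<cdot> j = \<eta> (Dom C s)"
    using pullback_univ[OF p(1), of s "\<eta> (Dom C s)"] s assms by auto
  have jD: "j \<in> \<D>" using dist_cancel[of p j] j p dist_mono assms by simp
  note jj = phi_arr[OF j(1)]
  obtain v' where v': "v' \<in> Arr C" "Dom C v' = \<Phi> (Dom C p)" "Cod C v' = \<Phi> (Dom C s)"
    "v' \<cdot> \<eta> (Dom C p) = v"
    using eta_factor_free[of v "Dom C p"] pb s assms by auto
  have e1: "\<phi> s \<cdot> v' = \<phi> p"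
    using eta_epi[of "\<phi> s \<cdot> v'" "Dom C p" "\<phi> p"] v' pb pp s assms by simp
  have e2: "\<phi> p \<cdot> \<phi> j = \<phi> s" using phi_comp[of j p] j p by simp
  have "v' \<cdot> \<phi> j = Id C (\<Phi> (Dom C s))"
    by (rule mono_arrD[OF dist_mono[OF sD]])
      (use comp_assoc_eq[OF e1, of "\<phi> j"] e2 v' s jj j assms in simp_all)
  moreover have "\<phi> j \<cdot> v' = Id C (\<Phi> (Dom C p))"
    by (rule mono_arrD[OF dist_mono[OF CC3[OF p(2)]]])
      (use comp_assoc_eq[OF e2, of v'] e1 v' s jj j pp pb assms in simp_all)
  ultimately have "iso_arr C (\<phi> j)" using iso_arrI[of "\<phi> j" v'] v' jj j by simp
  then have "iso_arr C j" using CC5[OF jD] by simp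
  then show ?thesis using pullback_iso[OF p(1) _ j(3)] dist_mono[OF p(2)] j by simp
qed

text \<open>The pullback \<open>v\<close> of \<open>\<eta>\<close> along a distinguished monomorphism factors through \<open>\<phi>(p)\<close>, where
  \<open>p\<close> is the other projection, so it is \<open>\<eta>\<close> up to isomorphism, as it is a distinguished
  epimorphism. Hence composition with \<open>v\<close> reflects triviality.\<close>

lemma triv_on_phi:
  assumes "u \<in> \<D>" "Cod C u = A" "t \<in> \<D>" "g \<in> Arr C" "Dom C g = Dom C t"
    "is_pullback C (\<eta> A) t p1 q1" "triv_on u p1 (g \<cdot> q1)"
  shows "triv_on (\<phi> u) t g"
proof (rule triv_onI)
  fix y assume y: "y \<in> Arr C" "Cod C y = Dom C t" "sub_le C (t \<cdot> y) (\<phi> u)"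
  have A [simp]: "A \<in> Obj C" using assms by auto
  note pb1 = pullbackD[OF assms(6)] and uu = phi_arr[OF dist_arr[OF assms(1)]]
  have t: "Cod C t = \<Phi> A" using pb1 by simp
  \<comment> \<open>\<open>b\<close> is the intersection of \<open>t\<close> and
    \<open>\<phi> u\<close>, seen inside the domain of \<open>t\<close>. The given \<open>y\<close>
    factors through it, so triviality of \<open>g \<cdot> b\<close> suffices.\<close>
  obtain b b' where b: "is_pullback C t (\<phi> u) b b'" "b \<in> \<D>"
    using CS3[OF CC3[OF assms(1)], of t] uu assms t by auto
  note pbb = pullbackD[OF b(1)]
  have r: "t \<cdot> b \<in> \<D>" using dist_comp[OF b(2) assms(3)] pbb by simp
  obtain p v where p: "is_pullback C (\<eta> A) (t \<cdot> b) p v" "p \<in> \<D>"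
    using CS3[OF r, of "\<eta> A"] t pbb by auto
  note pb = pullbackD[OF p(1)] and pp = phi_arr[OF dist_arr[OF p(2)]]
  have de: "dist_epi C \<D> v" by (rule CC4[OF A r _ p(1)]) (use t pbb in simp)
  have "Dom C b \<in> \<F>" using dist_torsionfree[OF r] t pbb by simp
  then obtain v' where v': "v' \<in> Arr C" "Dom C v' = \<Phi> (Dom C p)" "Cod C v' = Dom C b"
    "v' \<cdot> \<eta> (Dom C p) = v"
    using eta_factor_free[of v "Dom C p"] pb pbb by auto
  have "(t \<cdot> b) \<cdot> v' = \<phi> p"
    by (rule eta_epi[of _ "Dom C p"]) (use v' pb pp pbb t in simp_all)
  then have "v' \<in> \<D>"
    using dist_cancel[of "t \<cdot> b" v'] CC3[OF p(2)] dist_mono[OF r] v' pbb by simp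
  then have "iso_arr C v'"
    using de v' pb pbb p unfolding dist_epi_def by (metis (no_types, lifting) comp_arr(2) dom_cod_obj(1) eta_arr(1,2,3) hom_iff)
  then obtain w where w: "w \<in> Arr C" "Dom C w = Dom C b" "v' \<cdot> w = Id C (Dom C b)" "Cod C w = Dom C v'"
    using v' by (metis iso_arrE)
  have tv: "t \<cdot> (b \<cdot> v) = \<eta> A \<cdot> p" using pb pbb(1-8) by simp
  \<comment> \<open>\<open>c\<close> lifts \<open>p\<close> to the pullback of \<open>t\<close>,
    where the hypothesis on \<open>g \<cdot> q1\<close> can be used; it applies because
    \<open>p\<close> lies in \<open>u\<close>, the inverse image of \<open>\<phi> u\<close>.\<close>
  obtain c where c: "c \<in> Arr C" "Dom C c = Dom C p" "Cod C c = Dom C p1" "p1 \<cdot> c = p" "q1 \<cdot> c = b \<cdot> v"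
    using pullback_univ[OF assms(6) tv[symmetric]] pb pbb by auto
  have "t \<cdot> (b \<cdot> v) = \<phi> u \<cdot> (b' \<cdot> v)"
    by (rule comp_assoc_eq2[OF pbb(9)]) (use pb pbb in simp_all)
  then have "sub_le C (t \<cdot> (b \<cdot> v)) (\<phi> u)"
    using sub_leI[of "\<phi> u" "b' \<cdot> v"] pb pbb by simp
  then have "sub_le C p u"
    using pullback_le_iff[OF phi_pullback[OF assms(1,2)], of p] tv pb by simp
  then have "triv ((g \<cdot> q1) \<cdot> c)" using triv_onD[OF assms(7), of c] c by simp
  then have "triv ((g \<cdot> (b \<cdot> v')) \<cdot> \<eta> (Dom C p))" using c pb1 pb pbb v' assms by simp
  then have "triv (g \<cdot> (b \<cdot> v'))"
    using eta_reflects_triv[of "g \<cdot> (b \<cdot> v')" "Dom C p"] v' pb pbb assms by simp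
  then have "triv ((g \<cdot> (b \<cdot> v')) \<cdot> w)"
    using triv_comp_right[of "g \<cdot> (b \<cdot> v')" w] w v' pbb assms by simp
  then have "triv (g \<cdot> b)" using w v' pbb assms by simp
  moreover obtain d where "d \<in> Arr C" "Cod C d = Dom C b" "b \<cdot> d = y"
    using pullback_le_iff[OF b(1) y(1,2)] y(3) by (blast elim: sub_leE)
  ultimately show "triv (g \<cdot> y)" using triv_comp_right[of "g \<cdot> b" d] pbb assms by auto
qed

section \<open>Trivial morphisms of the stable category\<close>

abbreviation triv\<^sub>S :: "'o \<times> 'o \<times> ('a \<times> 'a \<times> 'a) set \<Rightarrow> bool" where
  "triv\<^sub>S \<equiv> trivial_arr \<S> \<T> \<F>"

text \<open>Triviality of \<open>f\<close> amounts to triviality over the whole of \<open>A\<close>,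
  which \<open>triv_on_transfer\<close> carries along the equivalence.\<close>

lemma SR_triv:
  assumes "((s0, s1, f), (t0, t1, g)) \<in> SR A B" "triv g"
  shows "triv f"
proof -
  obtain u0 u1 i j where a: "agree u0 u1 i j s1 f t1 g" using assms(1) by (auto simp: stab_rel_iff)
  have s: "s1 \<in> \<D>" "Cod C s1 = A" "f \<in> Arr C" "Dom C f = Dom C s1"
    and t: "t1 \<in> \<D>" "Cod C t1 = A" "g \<in> Arr C" "Dom C g = Dom C t1" "A \<in> Obj C"
    using assms(1) by (auto simp: stab_rel_iff dispar_iff dest: coverD)
  have "triv_on (Id C A) t1 g" using triv_comp_right[OF assms(2)] t by (auto intro: triv_onI)
  then have "triv_on (Id C A) s1 f"
    using triv_on_transfer[OF a] s t CS1_whole by simp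
  then have "triv (f \<cdot> Id C (Dom C s1))"
    using triv_onD[of "Id C A" s1 f "Id C (Dom C s1)"] sub_le_id[of s1 A] s by simp
  then show ?thesis using s by simp
qed

text \<open>The witness declares both triples zero everywhere: \<open>u0\<close> is all of
  \<open>A\<close> and \<open>u1\<close> is the zero subobject, on which any two arrows
  agree.\<close>

lemma triv_cls_eq:
  assumes "(s0, s1, f) \<in> DP A B" "(t0, t1, g) \<in> DP A B" "triv f" "triv g"
  shows "cls A B (s0, s1, f) = cls A B (t0, t1, g)"
proof -
  have s: "s1 \<in> \<D>" "Cod C s1 = A" "f \<in> Arr C" "Dom C f = Dom C s1" "Cod C f = B"
    and t: "t1 \<in> \<D>" "Cod C t1 = A" "g \<in> Arr C" "Dom C g = Dom C t1" "Cod C g = B" "A \<in> Obj C"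
    using assms by (auto simp: dispar_iff dest: coverD)
  define i where "i = (\<lambda>X. initial_arr C zero X)"
  have [simp]: "X \<in> Obj C \<Longrightarrow> i X \<in> Arr C" "X \<in> Obj C \<Longrightarrow> Dom C (i X) = zero"
    "X \<in> Obj C \<Longrightarrow> Cod C (i X) = X" for X by (simp_all add: i_def)
  have e: "x \<cdot> i (Dom C x) = i (Cod C x)" if "x \<in> Arr C" for x
    using initial_unique[of "x \<cdot> i (Dom C x)"] that by (simp add: i_def)
  have "agree (Id C A) (i A) (i (Dom C s1)) (i (Dom C t1)) s1 f t1 g"
    unfolding agree_def
    using cover_id_zero[of A] s t e[of s1] e[of t1] e[of f] e[of g] triv_comp_right[OF assms(3)]
      triv_comp_right[OF assms(4)]
    by (auto intro!: triv_onI simp flip: i_def)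
  then have "((s0, s1, f), (t0, t1, g)) \<in> SR A B" using assms stab_rel_iff by blast
  then show ?thesis using cls_eq_iff assms by blast
qed

lemma zero_DP:
  assumes "A \<in> Obj C" "B \<in> Obj C"
  shows "(Id C A, initial_arr C zero A, initial_arr C zero B) \<in> DP A B"
  using assms cover_id_zero[of A] triv_comp_right[OF triv_from, of "initial_arr C zero B"] zero_trivial
  by (auto simp: dispar_iff intro!: triv_onI)

lemma sigma_comp_left:
  assumes "(s0, s1, f) \<in> DP A B" "g \<in> Arr C" "Dom C g = B" "Cod C g = D"
  shows "\<sigma> g \<cdot>\<^bsub>\<S>\<^esub> cls A B (s0, s1, f) = cls A D (s0, s1, g \<cdot> f)" "(s0, s1, g \<cdot> f) \<in> DP A D"
  using cls_comp[OF assms(1) _ composite_sg_left[OF assms(1-3)], of D]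
    composite_DP[OF assms(1) _ composite_sg_left[OF assms(1-3)], of D] assms
  by (simp_all add: sigma_cls)

lemma sigma_comp_right:
  assumes "(t0, t1, g) \<in> DP B D" "f \<in> Arr C" "Dom C f = A" "Cod C f = B"
    "is_pullback C f t0 p0 f0" "is_pullback C f t1 p1 f1"
  shows "cls B D (t0, t1, g) \<cdot>\<^bsub>\<S>\<^esub> \<sigma> f = cls A D (p0, p1, g \<cdot> f1)" "(p0, p1, g \<cdot> f1) \<in> DP A D"
  using cls_comp[OF _ assms(1) composite_sg_right[OF assms(1,2,4-6)], of A]
    composite_DP[OF _ assms(1) composite_sg_right[OF assms(1,2,4-6)], of A] assms
  by (simp_all add: sigma_cls)

text \<open>Forwards, a factorisation through a trivial \<open>Z\<close> uses an arrow
  \<open>h\<close> on a distinguished subobject of \<open>Z\<close>, which is trivial by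
  \<open>CC1\<close>; so the composite has a trivial arrow, and \<open>SR_triv\<close> carries this
  to \<open>f\<close>. Backwards, a factorisation of \<open>f\<close> gives one of its class with
  the same \<open>s0\<close> and \<open>s1\<close>.\<close>

lemma triv_cls_iff:
  assumes "(s0, s1, f) \<in> DP A B"
  shows "triv\<^sub>S (cls A B (s0, s1, f)) \<longleftrightarrow> triv f"
proof
  have s: "s0 \<in> \<D>" "s1 \<in> \<D>" "cover s0 s1 A" "f \<in> Arr C" "Dom C f = Dom C s1" "Cod C f = B" "A \<in> Obj C"
    using assms by (auto simp: dispar_iff dest: coverD)
  {
    assume "triv\<^sub>S (cls A B (s0, s1, f))"
    then obtain Z G H where Z: "Z \<in> \<T> \<inter> \<F>" "G \<in> hom \<S> A Z" "H \<in> hom \<S> Z B"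
      "cls A B (s0, s1, f) = H \<cdot>\<^bsub>\<S>\<^esub> G"
      unfolding trivial_arr_def by auto
    obtain x where x: "x \<in> DP A Z" "G = cls A Z x" using Z(2) by (auto simp: hom_def elim: Stab_arrE)
    obtain t0 t1 h where y: "(t0, t1, h) \<in> DP Z B" "H = cls Z B (t0, t1, h)"
      using Z(3) by (auto simp: hom_def elim: Stab_arrE)
    obtain r0 r1 k where z: "dispar_composite C (t0, t1, h) x (r0, r1, k)"
      using composite_ex[OF x(1) y(1)] by auto
    then obtain p f1 g where p: "is_pullback C g t1 p f1" "k = h \<cdot> f1"
      by (cases x) auto
    have t: "t1 \<in> \<D>" "Cod C t1 = Z" "h \<in> Arr C" "Dom C h = Dom C t1"
      using y by (auto simp: dispar_iff dest: coverD)
    have "triv h" using triv_from[of h] CC1[of t1] t Z by simp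
    then have k: "triv k" using triv_comp_right[of h f1] pullbackD[OF p(1)] p(2) t by simp
    have "((s0, s1, f), (r0, r1, k)) \<in> SR A B"
      using cls_comp[OF x(1) y(1) z] cls_eq_iff[OF assms composite_DP[OF x(1) y(1) z]] Z x y by simp
    then show "triv f" using SR_triv k by blast
  }
  assume "triv f"
  then obtain Z g h where z: "Z \<in> \<T> \<inter> \<F>" "g \<in> Arr C" "Dom C g = Dom C f" "Cod C g = Z"
    "h \<in> Arr C" "Dom C h = Z" "Cod C h = B" "h \<cdot> g = f" using s(6) by (metis trivE)
  have "triv g" using triv_to[of g] z by simp
  then have g: "(s0, s1, g) \<in> DP A Z"
    using z s triv_comp_right[OF \<open>triv g\<close>] by (simp add: dispar_iff triv_on_def)
  have "\<sigma> h \<cdot>\<^bsub>\<S>\<^esub> cls A Z (s0, s1, g) = cls A B (s0, s1, f)"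
    using sigma_comp_left(1)[OF g, of h B] z by simp
  moreover have "\<sigma> h \<in> hom \<S> Z B" "cls A Z (s0, s1, g) \<in> hom \<S> A Z"
    using z g by (simp_all add: hom_def sigma_cls)
  ultimately show "triv\<^sub>S (cls A B (s0, s1, f))"
    unfolding trivial_arr_def using z(1) assms by (auto intro!: bexI)
qed

lemma triv_sigma_iff: "f \<in> Arr C \<Longrightarrow> triv\<^sub>S (\<sigma> f) \<longleftrightarrow> triv f"
  using triv_cls_iff[of "initial_arr C zero (Dom C f)" "Id C (Dom C f)" f "Dom C f" "Cod C f"]
    sg_DP[of f "Dom C f" "Cod C f"]
  by (simp add: sigma_cls sg_def)

section \<open>Canonical sequences of the stable category\<close>

text \<open>Everything takes place in the last component: \<open>f\<close> factors through
  \<open>k\<close>, and as \<open>k\<close> is monic and reflects triviality, a witness of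
  equivalence after composition with \<open>k\<close> is already one before.\<close>

lemma Stab_zkernel:
  assumes "canonical_seq C \<T> \<F> A k q"
  shows "is_zkernel \<S> \<T> \<F> (\<sigma> k) (\<sigma> q)"
proof -
  interpret F: cat_functor C \<S> "\<lambda>A. A" \<sigma> by (rule sigma_functor)
  note D = canonical_seqD[OF assms]
  have kq: "\<sigma> q \<cdot>\<^bsub>\<S>\<^esub> \<sigma> k = \<sigma> (q \<cdot> k)" using F.functor_Comp[of k "Dom C k" A q "Cod C q"] D by simp
  have "\<exists>!H. H \<in> hom \<S> X (Dom C k) \<and> \<sigma> k \<cdot>\<^bsub>\<S>\<^esub> H = M"
    if M: "M \<in> Arr \<S>" "Dom \<S> M = X" "Cod \<S> M = A" "triv\<^sub>S (\<sigma> q \<cdot>\<^bsub>\<S>\<^esub> M)" for M X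
  proof -
    obtain s0 s1 f where x: "(s0, s1, f) \<in> DP X A" "M = cls X A (s0, s1, f)"
      and s: "s0 \<in> \<D>" "s1 \<in> \<D>" "cover s0 s1 X" "Cod C s1 = X" "f \<in> Arr C" "Dom C f = Dom C s1" "Cod C f = A"
        "triv_on s0 s1 f"
      using Stab_arrE[OF M(1-3)] by metis
    have "triv (q \<cdot> f)"
      using M(4) triv_cls_iff[of s0 s1 "q \<cdot> f" X "Cod C q"] sigma_comp_left[OF x(1), of q "Cod C q"] D x
      by simp
    then obtain f' where f': "f' \<in> Arr C" "Dom C f' = Dom C f" "Cod C f' = Dom C k" "k \<cdot> f' = f"
      using zkernel_factor[OF D(1), of f] s D by auto
    have "triv_on s0 s1 f'"
    proof (rule triv_onI)
      fix y assume y: "y \<in> Arr C" "Cod C y = Dom C s1" "sub_le C (s1 \<cdot> y) s0"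
      have "triv (k \<cdot> (f' \<cdot> y))"
        using triv_onD[OF s(8) y] comp_assoc_eq[OF f'(4), of y] f' y s D by simp
      then show "triv (f' \<cdot> y)" using zkernel_reflects_triv[OF D(1), of "f' \<cdot> y"] f' y s by simp
    qed
    then have DP: "(s0, s1, f') \<in> DP X (Dom C k)" using s f' by (simp add: dispar_iff)
    show ?thesis
    proof (rule ex1I)
      show "cls X (Dom C k) (s0, s1, f') \<in> hom \<S> X (Dom C k) \<and>
        \<sigma> k \<cdot>\<^bsub>\<S>\<^esub> cls X (Dom C k) (s0, s1, f') = M"
        using DP sigma_comp_left(1)[OF DP, of k A] x f' D by (simp add: hom_def)
      fix H assume H: "H \<in> hom \<S> X (Dom C k) \<and> \<sigma> k \<cdot>\<^bsub>\<S>\<^esub> H = M"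
      then have HA: "H \<in> Arr \<S>" "Dom \<S> H = X" "Cod \<S> H = Dom C k" by (simp_all add: hom_def)
      obtain t0 t1 g where y: "(t0, t1, g) \<in> DP X (Dom C k)" "H = cls X (Dom C k) (t0, t1, g)"
        and t: "t1 \<in> \<D>" "Cod C t1 = X" "g \<in> Arr C" "Dom C g = Dom C t1" "Cod C g = Dom C k"
        using Stab_arrE[OF HA] by metis
      note tk = sigma_comp_left[OF y(1), of k A]
      have "((t0, t1, k \<cdot> g), (s0, s1, f)) \<in> SR X A"
        using H y x tk D cls_eq_iff[OF _ x(1), of "(t0, t1, k \<cdot> g)"] by simp
      then obtain u0 u1 i j where a: "agree u0 u1 i j t1 (k \<cdot> g) s1 f" by (auto simp: stab_rel_iff)
      note aD = agreeD[OF a]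
      have "g \<cdot> i = f' \<cdot> j"
        using mono_arrD[OF zkernel_mono[OF D(1)], of "g \<cdot> i" "f' \<cdot> j"] comp_assoc_eq[OF f'(4), of j]
          aD(2-10) t s f' D by simp
      moreover have "triv_on u0 t1 g"
      proof (rule triv_onI)
        fix y assume y: "y \<in> Arr C" "Cod C y = Dom C t1" "sub_le C (t1 \<cdot> y) u0"
        have "triv (k \<cdot> (g \<cdot> y))" using triv_onD[OF aD(11) y] t y D by simp
        then show "triv (g \<cdot> y)" using zkernel_reflects_triv[OF D(1), of "g \<cdot> y"] t y by simp
      qed
      moreover have "triv_on u0 s1 f'"
      proof (rule triv_onI)
        fix y assume y: "y \<in> Arr C" "Cod C y = Dom C s1" "sub_le C (s1 \<cdot> y) u0"
        have "triv (k \<cdot> (f' \<cdot> y))"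
          using triv_onD[OF aD(12) y] comp_assoc_eq[OF f'(4), of y] s f' y D by simp
        then show "triv (f' \<cdot> y)" using zkernel_reflects_triv[OF D(1), of "f' \<cdot> y"] s f' y by simp
      qed
      ultimately have "agree u0 u1 i j t1 g s1 f'" using aD unfolding agree_def by blast
      then show "H = cls X (Dom C k) (s0, s1, f')"
        using cls_eq_iff[OF y(1) DP] y DP by (auto simp: stab_rel_iff)
    qed
  qed
  then show ?thesis
    unfolding is_zkernel_def using kq D triv_sigma_iff[of "q \<cdot> k"] by (simp add: sigma_cls)
qed

text \<open>Existence half of the cokernel property, for the chosen unit \<open>\<eta> A\<close> in
  place of \<open>q\<close>, so that \<open>\<phi>\<close> and the pullback squares over
  \<open>\<eta> A\<close> are available.\<close>

lemma Stab_eta_factor: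
  assumes "canonical_seq C \<T> \<F> A k q" "M \<in> hom \<S> A X" "triv\<^sub>S (M \<cdot>\<^bsub>\<S>\<^esub> \<sigma> k)"
  shows "\<exists>H \<in> hom \<S> (\<Phi> A) X. H \<cdot>\<^bsub>\<S>\<^esub> \<sigma> (\<eta> A) = M"
proof -
  note D = canonical_seqD[OF assms(1)]
  have M: "M \<in> Arr \<S>" "Dom \<S> M = A" "Cod \<S> M = X" using assms(2) by (simp_all add: hom_def)
  obtain s0 s1 f where x: "(s0, s1, f) \<in> DP A X" "M = cls A X (s0, s1, f)"
    and s: "s0 \<in> \<D>" "s1 \<in> \<D>" "cover s0 s1 A" "Cod C s0 = A" "Cod C s1 = A" "f \<in> Arr C"
      "Dom C f = Dom C s1" "Cod C f = X" "triv_on s0 s1 f" and A: "A \<in> Obj C"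
    using Stab_arrE[OF M] by metis
  define S where "S = Dom C s1"
  have S: "S \<in> Obj C" using s by (simp add: S_def)
  note ph0 = phi_arr[OF dist_arr[OF s(1)]] and ph1 = phi_arr[OF dist_arr[OF s(2)]]
  obtain p0 f0 where p0: "is_pullback C k s0 p0 f0" using CS3[OF s(1) D(3)] D s by auto
  obtain p1 f1 where p1: "is_pullback C k s1 p1 f1" using CS3[OF s(2) D(3)] D s by auto
  note pb1 = pullbackD[OF p1]
  have tr: "triv (f \<cdot> f1)"
    using sigma_comp_right[OF x(1) D(3) refl D(5) p0 p1] assms(3) x triv_cls_iff by simp
  obtain l where l: "canonical_seq C \<T> \<F> S l (\<eta> S)" using eta_canonical[OF S] by blast
  note L = canonical_seqD[OF l]
  obtain e where e: "e \<in> Arr C" "Dom C e = \<Phi> A" "Cod C e = Cod C q" "e \<cdot> \<eta> A = q"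
    using eta_factor_free[OF D(4,6,8)] .
  \<comment> \<open>The arrow \<open>s1 \<cdot> l\<close> becomes trivial after \<open>q\<close>,
    because \<open>(e \<cdot> \<phi> s1) \<cdot> \<eta> S\<close> equals
    \<open>q \<cdot> s1\<close>. So it factors through \<open>k\<close>.\<close>
  have "triv ((e \<cdot> \<phi> s1) \<cdot> (\<eta> S \<cdot> l))"
    by (rule triv_comp_left[OF L(9)]) (use e ph1 s L S in \<open>simp_all add: S_def\<close>)
  moreover have "\<phi> s1 \<cdot> (\<eta> S \<cdot> l) = \<eta> A \<cdot> (s1 \<cdot> l)"
    by (rule comp_assoc_eq2) (use ph1 s L S A in \<open>simp_all add: S_def\<close>)
  moreover have "e \<cdot> (\<eta> A \<cdot> (s1 \<cdot> l)) = q \<cdot> (s1 \<cdot> l)"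
    by (rule comp_assoc_eq[OF e(4)]) (use e s L A in \<open>simp_all add: S_def\<close>)
  ultimately have "triv (q \<cdot> (s1 \<cdot> l))" using e ph1 s L S by (simp add: S_def)
  then obtain h where h: "h \<in> Arr C" "Dom C h = Dom C l" "Cod C h = Dom C k" "k \<cdot> h = s1 \<cdot> l"
    using zkernel_factor[OF D(1), of "s1 \<cdot> l"] s L D by (auto simp: S_def)
  \<comment> \<open>This factor lands in the inverse image of \<open>s1\<close> along
    \<open>k\<close>, on which \<open>f\<close> is trivial; therefore \<open>f \<cdot> l\<close> is
    trivial and \<open>f\<close> extends along \<open>\<eta> S\<close>.\<close>
  obtain d where d: "d \<in> Arr C" "Dom C d = Dom C h" "Cod C d = Dom C p1" "f1 \<cdot> d = l"
    using pullback_univ[OF p1 h(4,1) L(3) h(3)] L by (metis S_def)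
  have "triv ((f \<cdot> f1) \<cdot> d)" by (rule triv_comp_right[OF tr]) (use d pb1 s in simp_all)
  then have "triv (f \<cdot> l)" using d pb1 s by simp
  then obtain f' where f': "f' \<in> Arr C" "Dom C f' = \<Phi> S" "Cod C f' = X" "f' \<cdot> \<eta> S = f"
    using zcokernel_factor[OF L(2), of f] s L S by (auto simp: S_def)
  note pp0 = phi_pullback[OF s(1,4)] and pp1 = phi_pullback[OF s(2,5)]
  have "triv_on (\<phi> s0) (\<phi> s1) f'"
    by (rule triv_on_phi[OF s(1,4) CC3[OF s(2)] _ _ pp1])
      (use f' ph1 s in \<open>simp_all add: S_def\<close>)
  then have H: "(\<phi> s0, \<phi> s1, f') \<in> DP (\<Phi> A) X"
    using phi_cover[OF s(3)] f' ph1 by (simp add: dispar_iff S_def)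
  have "cls (\<Phi> A) X (\<phi> s0, \<phi> s1, f') \<cdot>\<^bsub>\<S>\<^esub> \<sigma> (\<eta> A) = M"
    using sigma_comp_right(1)[OF H _ _ _ pp0 pp1] f' x A by (simp add: S_def)
  then show ?thesis using H by (intro bexI[of _ "cls (\<Phi> A) X (\<phi> s0, \<phi> s1, f')"]) (simp_all add: hom_def)
qed

text \<open>If \<open>(u0, u1)\<close> witnesses the equivalence of the triples pulled back along
  \<open>\<eta> A\<close>, its image under \<open>\<phi>\<close> is a witness over
  \<open>\<Phi> A\<close>: the arrows agree since units are epic, and \<open>triv_on_phi\<close>
  provides triviality.\<close>

lemma Stab_eta_epi:
  assumes "H \<in> hom \<S> (\<Phi> A) X" "H' \<in> hom \<S> (\<Phi> A) X" "A \<in> Obj C"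
    "H \<cdot>\<^bsub>\<S>\<^esub> \<sigma> (\<eta> A) = H' \<cdot>\<^bsub>\<S>\<^esub> \<sigma> (\<eta> A)"
  shows "H = H'"
proof -
  have H: "H \<in> Arr \<S>" "Dom \<S> H = \<Phi> A" "Cod \<S> H = X" and H': "H' \<in> Arr \<S>" "Dom \<S> H' = \<Phi> A" "Cod \<S> H' = X"
    using assms(1,2) by (simp_all add: hom_def)
  obtain t0 t g where x: "(t0, t, g) \<in> DP (\<Phi> A) X" "H = cls (\<Phi> A) X (t0, t, g)"
    and t: "t0 \<in> \<D>" "t \<in> \<D>" "Cod C t0 = \<Phi> A" "Cod C t = \<Phi> A" "g \<in> Arr C" "Dom C g = Dom C t" "Cod C g = X"
    using Stab_arrE[OF H] by metis
  obtain t0' t' g' where x': "(t0', t', g') \<in> DP (\<Phi> A) X" "H' = cls (\<Phi> A) X (t0', t', g')"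
    and t': "t0' \<in> \<D>" "t' \<in> \<D>" "Cod C t0' = \<Phi> A" "Cod C t' = \<Phi> A" "g' \<in> Arr C" "Dom C g' = Dom C t'" "Cod C g' = X"
    using Stab_arrE[OF H'] by metis
  obtain p0 q0 where p0: "is_pullback C (\<eta> A) t0 p0 q0" using CS3[OF t(1), of "\<eta> A"] t assms by auto
  obtain p q where p: "is_pullback C (\<eta> A) t p q" using CS3[OF t(2), of "\<eta> A"] t assms by auto
  obtain p0' q0' where p0': "is_pullback C (\<eta> A) t0' p0' q0'" using CS3[OF t'(1), of "\<eta> A"] t' assms by auto
  obtain p' q' where p': "is_pullback C (\<eta> A) t' p' q'" using CS3[OF t'(2), of "\<eta> A"] t' assms by auto
  note pb = pullbackD[OF p] and pb' = pullbackD[OF p']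
  have "((p0, p, g \<cdot> q), (p0', p', g' \<cdot> q')) \<in> SR A X"
    using sigma_comp_right[OF x(1) _ _ _ p0 p, of A] sigma_comp_right[OF x'(1) _ _ _ p0' p', of A]
      cls_eq_iff[of "(p0, p, g \<cdot> q)" A X "(p0', p', g' \<cdot> q')"] assms(3,4) x x' by simp
  then obtain u0 u1 i j where a: "agree u0 u1 i j p (g \<cdot> q) p' (g' \<cdot> q')" by (auto simp: stab_rel_iff)
  note aD = agreeD[OF a]
  have cA: "Cod C p = A" "Cod C p' = A" using pb pb' assms(3) by simp_all
  have cov: "cover u0 u1 A" using aD(1) cA by simp
  note u = coverD[OF cov]
  define U where "U = Dom C u1"
  have U: "U \<in> Obj C" using u by (simp add: U_def)
  note ph = phi_arr[OF dist_arr[OF u(2)]]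
  \<comment> \<open>The inclusion of \<open>u1\<close> into the pullback of \<open>t\<close>
    descends to one of \<open>\<phi> u1\<close> into \<open>t\<close>, as the domain of
    \<open>t\<close> is torsion free.\<close>
  have lift: "\<exists>c \<in> Arr C. Dom C c = \<Phi> U \<and> Cod C c = Dom C t \<and> c \<cdot> \<eta> U = q \<cdot> i \<and> t \<cdot> c = \<phi> u1"
    if t: "t \<in> \<D>" "Cod C t = \<Phi> A" and p: "is_pullback C (\<eta> A) t p q"
      and i: "i \<in> Arr C" "Dom C i = U" "Cod C i = Dom C p" "p \<cdot> i = u1" for t p q i
  proof -
    note pb = pullbackD[OF p]
    have "Dom C t \<in> \<F>" using dist_torsionfree[OF t(1)] t assms(3) by simp
    then obtain c where c: "c \<in> Arr C" "Dom C c = \<Phi> U" "Cod C c = Dom C t" "c \<cdot> \<eta> U = q \<cdot> i"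
      using eta_factor_free[of "q \<cdot> i" U] pb i by auto
    have "\<eta> A \<cdot> (p \<cdot> i) = t \<cdot> (q \<cdot> i)" by (rule comp_assoc_eq2[OF pb(9)]) (use pb i in simp_all)
    then have "t \<cdot> c = \<phi> u1"
      using phi_unique[of "t \<cdot> c" u1] c i t u U by (simp add: U_def)
    then show ?thesis using c by blast
  qed
  obtain c where c: "c \<in> Arr C" "Dom C c = \<Phi> U" "Cod C c = Dom C t" "c \<cdot> \<eta> U = q \<cdot> i" "t \<cdot> c = \<phi> u1"
    using lift[OF t(2,4) p aD(2) _ aD(4,5)] aD(3) U_def by auto
  obtain c' where c': "c' \<in> Arr C" "Dom C c' = \<Phi> U" "Cod C c' = Dom C t'" "c' \<cdot> \<eta> U = q' \<cdot> j"
      "t' \<cdot> c' = \<phi> u1"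
    using lift[OF t'(2,4) p' aD(6) _ aD(8,9)] aD(7) U_def by auto
  have "g \<cdot> (q \<cdot> i) = g' \<cdot> (q' \<cdot> j)"
    using aD(2-10) pb(4,6,8) pb'(4,6,8) t t' by simp
  then have "g \<cdot> c = g' \<cdot> c'"
    using eta_epi[of "g \<cdot> c" U "g' \<cdot> c'"] c c' t t' U by simp
  moreover have "triv_on (\<phi> u0) t g" by (rule triv_on_phi[OF u(1,3) t(2,5,6) p aD(11)])
  moreover have "triv_on (\<phi> u0) t' g'" by (rule triv_on_phi[OF u(1,3) t'(2,5,6) p' aD(12)])
  ultimately have "agree (\<phi> u0) (\<phi> u1) c c' t g t' g'"
    unfolding agree_def using phi_cover[OF cov] c c' t ph by (simp add: U_def)
  then show ?thesis using cls_eq_iff[OF x(1) x'(1)] x x' by (auto simp: stab_rel_iff)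
qed

text \<open>An arbitrary cokernel arrow \<open>q\<close> and the chosen \<open>\<eta> A\<close>
  factor through each other by \<open>e\<close> and \<open>d\<close>; existence and uniqueness are
  transported along \<open>\<sigma> d\<close> and \<open>\<sigma> e\<close>.\<close>

lemma Stab_zcokernel:
  assumes "canonical_seq C \<T> \<F> A k q"
  shows "is_zcokernel \<S> \<T> \<F> (\<sigma> q) (\<sigma> k)"
proof -
  interpret F: cat_functor C \<S> "\<lambda>A. A" \<sigma> by (rule sigma_functor)
  note D = canonical_seqD[OF assms]
  define Q where "Q = Cod C q"
  have A: "A \<in> Obj C" using D by auto
  have kq: "\<sigma> q \<cdot>\<^bsub>\<S>\<^esub> \<sigma> k = \<sigma> (q \<cdot> k)" using F.functor_Comp[of k "Dom C k" A q "Cod C q"] D by simp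
  obtain e where e: "e \<in> Arr C" "Dom C e = \<Phi> A" "Cod C e = Q" "e \<cdot> \<eta> A = q"
    using eta_factor_free[OF D(4,6,8)] Q_def by auto
  have "triv (\<eta> A \<cdot> k)" using PT1[of "Dom C k" "\<Phi> A" "\<eta> A \<cdot> k"] D A by simp
  then obtain d where d: "d \<in> Arr C" "Dom C d = Q" "Cod C d = \<Phi> A" "d \<cdot> q = \<eta> A"
    using zcokernel_factor[OF D(2), of "\<eta> A"] D A Q_def by auto
  have ed: "e \<cdot> d = Id C Q"
    using epi_arrD[OF zcokernel_epi[OF D(2)], of "e \<cdot> d" "Id C Q"] d e D by (auto simp: Q_def)
  have S: "\<sigma> e \<in> hom \<S> (\<Phi> A) Q" "\<sigma> d \<in> hom \<S> Q (\<Phi> A)" "\<sigma> q \<in> hom \<S> A Q" "\<sigma> (\<eta> A) \<in> hom \<S> A (\<Phi> A)"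
    using F.functor_hom d e D A by (simp_all add: Q_def)
  have Sc: "\<sigma> e \<cdot>\<^bsub>\<S>\<^esub> \<sigma> (\<eta> A) = \<sigma> q" "\<sigma> d \<cdot>\<^bsub>\<S>\<^esub> \<sigma> q = \<sigma> (\<eta> A)" "\<sigma> e \<cdot>\<^bsub>\<S>\<^esub> \<sigma> d = Id \<S> Q"
    using F.functor_Comp[of "\<eta> A" A "\<Phi> A" e Q] F.functor_Comp[of q A Q d "\<Phi> A"]
      F.functor_Comp[of d Q "\<Phi> A" e Q] F.functor_Id[of Q] d e ed D A by (auto simp: Q_def)
  have "\<exists>!H. H \<in> hom \<S> Q X \<and> H \<cdot>\<^bsub>\<S>\<^esub> \<sigma> q = M"
    if M: "M \<in> Arr \<S>" "Dom \<S> M = A" "Cod \<S> M = X" "triv\<^sub>S (M \<cdot>\<^bsub>\<S>\<^esub> \<sigma> k)" for M X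
  proof -
    obtain G where G: "G \<in> hom \<S> (\<Phi> A) X" "G \<cdot>\<^bsub>\<S>\<^esub> \<sigma> (\<eta> A) = M"
      using Stab_eta_factor[OF assms _ M(4), of X] M by auto
    show ?thesis
    proof (rule ex1I)
      show "G \<cdot>\<^bsub>\<S>\<^esub> \<sigma> d \<in> hom \<S> Q X \<and> (G \<cdot>\<^bsub>\<S>\<^esub> \<sigma> d) \<cdot>\<^bsub>\<S>\<^esub> \<sigma> q = M"
        using F.target.Comp_in_hom[OF S(2) G(1)] F.target.Comp_assoc[OF S(3,2) G(1)] G Sc by simp
      fix H assume H: "H \<in> hom \<S> Q X \<and> H \<cdot>\<^bsub>\<S>\<^esub> \<sigma> q = M"
      then have H1: "H \<in> hom \<S> Q X" and H2: "H \<cdot>\<^bsub>\<S>\<^esub> \<sigma> q = M" by blast+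
      have "(H \<cdot>\<^bsub>\<S>\<^esub> \<sigma> e) \<cdot>\<^bsub>\<S>\<^esub> \<sigma> (\<eta> A) = G \<cdot>\<^bsub>\<S>\<^esub> \<sigma> (\<eta> A)"
        using F.target.Comp_assoc[OF S(4,1) H1] Sc H2 G by simp
      then have "H \<cdot>\<^bsub>\<S>\<^esub> \<sigma> e = G"
        using Stab_eta_epi[OF F.target.Comp_in_hom[OF S(1) H1] G(1) A] by blast
      then show "H = G \<cdot>\<^bsub>\<S>\<^esub> \<sigma> d"
        using F.target.Comp_assoc[OF S(2,1) H1] F.target.Comp_Id[OF H1] Sc by simp
    qed
  qed
  then show ?thesis
    unfolding is_zcokernel_def using kq D triv_sigma_iff[of "q \<cdot> k"] by (simp add: sigma_cls Q_def)
qed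

section \<open>The axioms of a torsion theory for the stable category\<close>

lemma Stab_canonical_seq:
  assumes "canonical_seq C \<T> \<F> A k q"
  shows "canonical_seq \<S> \<T> \<F> A (\<sigma> k) (\<sigma> q)"
  using Stab_zkernel[OF assms] Stab_zcokernel[OF assms] canonical_seqD[OF assms]
  by (simp add: canonical_seq_def short_zexact_def sigma_cls)

lemma Stab_PT1:
  assumes "A \<in> \<T>" "B \<in> \<F>" "F \<in> hom \<S> A B"
  shows "triv\<^sub>S F"
proof -
  have F: "F \<in> Arr \<S>" "Dom \<S> F = A" "Cod \<S> F = B" using assms(3) by (simp_all add: hom_def)
  obtain s0 s1 f where x: "(s0, s1, f) \<in> DP A B" "F = cls A B (s0, s1, f)"
    and s: "s1 \<in> \<D>" "Cod C s1 = A" "f \<in> Arr C" "Dom C f = Dom C s1" "Cod C f = B"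
    using Stab_arrE[OF F] by metis
  have "triv f" using PT1[of "Dom C s1" B f] dist_torsion[OF s(1)] assms s by simp
  then show ?thesis using triv_cls_iff x by blast
qed

text \<open>The class \<open>f\<close> followed by \<open>\<sigma> (\<eta> X)\<close> runs from a
  torsion to a torsion free object and is trivial. Cancelling \<open>f\<close> by its inverse makes
  \<open>\<sigma> (\<eta> X)\<close>, hence \<open>\<eta> X\<close>, trivial, so \<open>X\<close> is
  torsion.\<close>

lemma Stab_torsion_iso_closed:
  assumes "A \<in> \<T>" "isomorphic_objs \<S> A X"
  shows "X \<in> \<T>"
proof -
  interpret F: cat_functor C \<S> "\<lambda>A. A" \<sigma> by (rule sigma_functor)
  obtain f where f: "f \<in> hom \<S> A X" "iso_arr \<S> f" using assms(2) by (auto simp: isomorphic_objs_def)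
  obtain g where g: "g \<in> hom \<S> X A" "f \<cdot>\<^bsub>\<S>\<^esub> g = Id \<S> X" using f by (auto elim: F.target.iso_arrE)
  have X: "X \<in> Obj C" using f(1) F.target.Cod_in_Obj[of f] by (simp del: split_paired_All)
  have q: "\<sigma> (\<eta> X) \<in> hom \<S> X (\<Phi> X)" using F.functor_hom X by simp
  have "triv\<^sub>S (\<sigma> (\<eta> X) \<cdot>\<^bsub>\<S>\<^esub> f)"
    using Stab_PT1[OF assms(1) _ F.target.Comp_in_hom[OF f(1) q]] X by simp
  then have "triv\<^sub>S ((\<sigma> (\<eta> X) \<cdot>\<^bsub>\<S>\<^esub> f) \<cdot>\<^bsub>\<S>\<^esub> g)"
    using F.target.trivial_arr_comp_right[of \<T> \<F> "\<sigma> (\<eta> X) \<cdot>\<^bsub>\<S>\<^esub> f" g] f g q by simp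
  then have "triv (\<eta> X)"
    using F.target.Comp_assoc[OF g(1) f(1) q] F.target.Comp_Id[OF q] g triv_sigma_iff[of "\<eta> X"] X by simp
  then show ?thesis using eta_canonical[OF X] torsion_of_triv_quotient by blast
qed

lemma Stab_torsionfree_iso_closed:
  assumes "A \<in> \<F>" "isomorphic_objs \<S> A X"
  shows "X \<in> \<F>"
proof -
  interpret F: cat_functor C \<S> "\<lambda>A. A" \<sigma> by (rule sigma_functor)
  obtain f where f: "f \<in> hom \<S> A X" "iso_arr \<S> f" using assms(2) by (auto simp: isomorphic_objs_def)
  obtain g where g: "g \<in> hom \<S> X A" "f \<cdot>\<^bsub>\<S>\<^esub> g = Id \<S> X" using f by (auto elim: F.target.iso_arrE)
  have X: "X \<in> Obj C" using f(1) F.target.Cod_in_Obj[of f] by (simp del: split_paired_All)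
  obtain k q where kq: "canonical_seq C \<T> \<F> X k q" using PT2[OF X] by blast
  note D = canonical_seqD[OF kq]
  have k: "\<sigma> k \<in> hom \<S> (Dom C k) X" using F.functor_hom D by simp
  have "triv\<^sub>S (g \<cdot>\<^bsub>\<S>\<^esub> \<sigma> k)"
    using Stab_PT1[OF D(7) assms(1) F.target.Comp_in_hom[OF k g(1)]] .
  then have "triv\<^sub>S (f \<cdot>\<^bsub>\<S>\<^esub> (g \<cdot>\<^bsub>\<S>\<^esub> \<sigma> k))"
    using F.target.trivial_arr_comp_left[of \<T> \<F> "g \<cdot>\<^bsub>\<S>\<^esub> \<sigma> k" f] f g k by simp
  then have "triv k"
    using F.target.Comp_assoc[OF k g(1) f(1)] F.target.Id_Comp[OF k] g triv_sigma_iff[of k] D by simp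
  then show ?thesis using torsionfree_of_triv_kernel[OF kq] by blast
qed

text \<open>Parallel classes with trivial arrows coincide by \<open>triv_cls_eq\<close>. The arrow
  of a class from \<open>Z\<close> starts at a distinguished subobject of \<open>Z\<close>, trivial
  by \<open>CC1\<close>; the arrow of a class to \<open>Z\<close> ends at \<open>Z\<close>.\<close>

lemma Stab_zero_obj:
  assumes "Z \<in> \<T> \<inter> \<F>"
  shows "zero_obj \<S> Z"
proof -
  let ?z = "\<lambda>A B. cls A B (Id C A, initial_arr C zero A, initial_arr C zero B)"
  have Z: "Z \<in> Obj C" using assms by simp
  have hom: "?z A B \<in> hom \<S> A B" if "A \<in> Obj C" "B \<in> Obj C" for A B
    using zero_DP[OF that] by (simp add: hom_def)
  have uniq: "F = ?z A B" if "F \<in> hom \<S> A B" "A \<in> \<T> \<inter> \<F> \<or> B \<in> \<T> \<inter> \<F>" for A B F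
  proof -
    have F: "F \<in> Arr \<S>" "Dom \<S> F = A" "Cod \<S> F = B" using that(1) by (simp_all add: hom_def)
    obtain s0 s1 f where x: "(s0, s1, f) \<in> DP A B" "F = cls A B (s0, s1, f)" "A \<in> Obj C" "B \<in> Obj C"
      and s: "s1 \<in> \<D>" "Cod C s1 = A" "f \<in> Arr C" "Dom C f = Dom C s1" "Cod C f = B"
      using Stab_arrE[OF F] by metis
    have "triv f"
      using that(2) triv_from[of f] triv_to[of f] CC1[OF s(1)] s by auto
    then show ?thesis
      using triv_cls_eq[OF x(1) zero_DP[OF x(3,4)]] triv_from[of "initial_arr C zero B"] zero_trivial x
      by simp
  qed
  have "\<exists>!F. F \<in> hom \<S> Z A" "\<exists>!F. F \<in> hom \<S> A Z" if "A \<in> Obj C" for A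
    using hom[OF Z that] uniq[of _ Z A] hom[OF that Z] uniq[of _ A Z] assms by blast+
  then show ?thesis using Z by (simp add: zero_obj_def initial_obj_def terminal_obj_def)
qed

lemma Stab_pretorsion_theory: "pretorsion_theory \<S> \<T> \<F>"
proof -
  interpret S: category \<S> by (rule Stab_category)
  show ?thesis
  proof
    fix A assume "A \<in> Obj \<S>"
    then show "\<exists>k q. canonical_seq \<S> \<T> \<F> A k q" using PT2[of A] Stab_canonical_seq by (metis Stab_Obj)
  qed (use torsion_subset torsionfree_subset Stab_torsion_iso_closed Stab_torsionfree_iso_closed
      Stab_PT1 in auto)
qed

end

theorem theorem5p6:
  fixes E :: "('o, 'a) cat" and zero :: 'o and \<D> :: "'a set" and \<T> \<F> :: "'o set"
  assumes "category E"
    and "strict_initial_obj E zero"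
    and "pretorsion_theory E \<T> \<F>"
    and "coherent_system E zero \<D>"
    and "compatible E zero \<D> \<T> \<F>"
  shows "torsion_theory (Stab E zero \<D> \<T> \<F>) \<T> \<F> \<and>
         torsion_functor E \<T> \<F> (Stab E zero \<D> \<T> \<F>) \<T> \<F>
           (\<lambda>A. A) (stab_sigma E zero \<D> \<T> \<F>)"
proof -
  interpret compatible E zero \<D> \<T> \<F> by (rule assms)
  have "torsion_theory_axioms \<S> \<T> \<F>" using Stab_zero_obj by unfold_locales
  moreover have "torsion_functor_axioms E \<T> \<F> \<S> \<T> \<F> (\<lambda>A. A) \<sigma>"
    using Stab_canonical_seq by unfold_locales
  ultimately show ?thesis
    using Stab_pretorsion_theory sigma_functor assms(3)
    by (simp add: torsion_theory_def torsion_functor_def)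
qed

end
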